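(* Let $0<\beta<1$ and $\delta>0$ with $\delta\ll\beta^2$, and let $K\subset\mathbb{B}_1^n\setminus\mathbb{B}_\beta^n$, where $\mathbb{B}_r^n$ is the closed Euclidean ball of radius $r$ in $\mathbb{R}^n$. Let $\rho(t)=\max(0,t)$ be applied entrywise, and let $M\in\mathbb{R}^{m\times n}$ be a random matrix such that $\sqrt{m}\,M$ has i.i.d. standard normal entries. There is a constant $C$ such that if $m\ge C\delta^{-4}\omega(K)^4$, then with high probability, for all $x,y\in K$, $$\Big|\cos\angle\big(\rho(Mx),\rho(My)\big)-\big(\cos\angle(x,y)+\psi(x,y)\big)\Big|\le\frac{15\delta}{\beta^2-2\delta},$$ where $\psi(x,y)=\frac1\pi\big(\sin\angle(x,y)-\angle(x,y)\cos\angle(x,y)\big)$.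
   Context: For nonzero $u,v$, $\angle(u,v)=\cos^{-1}\!\big(\frac{u^Tv}{\|u\|_2\|v\|_2}\big)\in[0,\pi]$. The Gaussian mean width of $K$ is $\omega(K)=\mathbb{E}\big[\sup_{x,y\in K}\langle g,x-y\rangle\big]$ with $g\in\mathbb{R}^n$ having i.i.d. standard normal entries. *)

theory Defs
  imports "HOL-Probability.Probability"
begin

text \<open>Vectors of R^k are represented as functions nat => real, only coordinates i < k matter.\<close>

definition inner_n :: "nat \<Rightarrow> (nat \<Rightarrow> real) \<Rightarrow> (nat \<Rightarrow> real) \<Rightarrow> real" where
  "inner_n k u v = (\<Sum>i<k. u i * v i)"

definition norm_n :: "nat \<Rightarrow> (nat \<Rightarrow> real) \<Rightarrow> real" where
  "norm_n k u = sqrt (inner_n k u u)"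

definition angle_n :: "nat \<Rightarrow> (nat \<Rightarrow> real) \<Rightarrow> (nat \<Rightarrow> real) \<Rightarrow> real" where
  "angle_n k u v = arccos (inner_n k u v / (norm_n k u * norm_n k v))"

definition vecs :: "nat \<Rightarrow> (nat \<Rightarrow> real) set" where
  "vecs k = {x. \<forall>i\<ge>k. x i = 0}"

definition annulus :: "nat \<Rightarrow> real \<Rightarrow> (nat \<Rightarrow> real) set" where
  "annulus n \<beta> = {x \<in> vecs n. \<beta> < norm_n n x \<and> norm_n n x \<le> 1}"

definition relu :: "real \<Rightarrow> real" where
  "relu t = max 0 t"

definition relu_layer :: "nat \<Rightarrow> nat \<Rightarrow> (nat \<times> nat \<Rightarrow> real) \<Rightarrow> (nat \<Rightarrow> real) \<Rightarrow> (nat \<Rightarrow> real)" where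
  "relu_layer m n M x = (\<lambda>i. if i < m then relu (\<Sum>j<n. M (i, j) * x j) else 0)"

definition std_gaussian :: "real measure" where
  "std_gaussian = density lborel (normal_density 0 1)"

definition gaussian_vector :: "nat \<Rightarrow> (nat \<Rightarrow> real) measure" where
  "gaussian_vector n = PiM {..<n} (\<lambda>_. std_gaussian)"

text \<open>Standard Gaussian m x n matrix G (i.i.d. N(0,1) entries); the paper's M is G / sqrt m.\<close>
definition gaussian_matrix :: "nat \<Rightarrow> nat \<Rightarrow> (nat \<times> nat \<Rightarrow> real) measure" where
  "gaussian_matrix m n = PiM ({..<m} \<times> {..<n}) (\<lambda>_. std_gaussian)"

definition gaussian_width :: "nat \<Rightarrow> (nat \<Rightarrow> real) set \<Rightarrow> real" where
  "gaussian_width n K =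
     integral\<^sup>L (gaussian_vector n) (\<lambda>g. SUP p \<in> K \<times> K. inner_n n g (\<lambda>i. fst p i - snd p i))"

definition psi :: "nat \<Rightarrow> (nat \<Rightarrow> real) \<Rightarrow> (nat \<Rightarrow> real) \<Rightarrow> real" where
  "psi n x y = (sin (angle_n n x y) - angle_n n x y * cos (angle_n n x y)) / pi"

end

theory Submission
  imports Defs "HOL-Real_Asymp.Real_Asymp"
begin

text \<open>
  Rotating the plane of \<open>x\<close> and \<open>y\<close> to the first two coordinates, the expectation of
  \<open>relu \<langle>g, x\<rangle> * relu \<langle>g, y\<rangle>\<close> is an explicit integral, equal to
  \<open>|x| |y| (cos \<theta> + \<psi>) / 2\<close>. Hence it suffices that the empirical averages over the rows of the matrix
  are within \<open>\<delta>\<close> of this kernel, uniformly on \<open>K \<times> K\<close>. A Bernstein bound and a union bound give this on a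
  finite net of \<open>K\<close> at scale \<open>\<epsilon>\<close> proportional to \<open>\<delta>\<close>, and the Lipschitz property of the rectifier transfers it
  to \<open>K\<close> once \<open>|G (x - y)|\<close> is small for all \<open>x, y\<close> in \<open>K\<close> at distance at most \<open>\<epsilon>\<close>.
  With \<open>\<omega>\<close> the Gaussian width, Sudakov minoration bounds the logarithm of the size of the net by a multiple of
  \<open>(1 + \<omega>)\<^sup>2 / \<delta>\<^sup>2\<close>. Where the claimed failure probability is below 1, \<open>\<delta>\<^sup>4 m\<close> exceeds
  a large constant, so together with the hypothesis it exceeds a large multiple of \<open>(1 + \<omega>)\<^sup>4\<close>, hence of
  \<open>(1 + \<omega>)\<^sup>2\<close>.
\<close>

section \<open>Rotation invariance of the Gaussian measure\<close>

text \<open>Only the mean of a supremum over \<open>K\<close> is given, so every uniform bound has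
  to come from that one number. It enters twice: through covering numbers, which make the union
  bound affordable, and as the mean of a maximum in the control of short differences, where the size
  of the set must not appear at all. The second use requires exponential moments of the maximum
  around its mean. A maximum is not smooth, so the interpolation between two independent Gaussian
  vectors (the argument of Maurey and Pisier) runs through finitely many small rotations, whose
  number then tends to infinity. Estimates are proved for finite subsets, with constants independent
  of their size, and reach \<open>K\<close> through countable dense subsets and continuity.
  Integrals of nonnegative functions are preferred because exchanging their order requires no
  integrability. A one-point set has width 0, while the packing argument divides by the bound on the
  width; this is why \<open>1 + \<omega>\<close> takes the place of \<open>\<omega>\<close>.\<close>

abbreviation gamma :: "real measure" ("\<gamma>") where "\<gamma> \<equiv> std_gaussian"

lemma sets_std_gaussian [measurable_cong, simp]: "sets \<gamma> = sets borel"
  by (simp add: std_gaussian_def)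

lemma space_std_gaussian [simp]: "space \<gamma> = UNIV"
  by (simp add: std_gaussian_def)

lemma prob_space_std_gaussian: "prob_space \<gamma>"
  unfolding std_gaussian_def by (rule prob_space_normal_density) simp

interpretation std_gaussian: prob_space \<gamma>
  by (rule prob_space_std_gaussian)

interpretation std_gaussian_prod: product_sigma_finite "\<lambda>_. \<gamma>"
  by (rule product_sigma_finite.intro) (rule std_gaussian.sigma_finite_measure_axioms)

lemma prob_space_gaussian_vector: "prob_space (gaussian_vector n)"
  unfolding gaussian_vector_def by (intro prob_space_PiM prob_space_std_gaussian)

interpretation gaussian_vector: prob_space "gaussian_vector n" for n
  by (rule prob_space_gaussian_vector)

interpretation gaussian_vector_pair: pair_prob_space "gaussian_vector n" "gaussian_vector k" for n k
  by unfold_locales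

lemma sets_gaussian_vector [measurable_cong]:
  "sets (gaussian_vector n) = sets (PiM {..<n} (\<lambda>_. borel))"
  unfolding gaussian_vector_def by (intro sets_PiM_cong) simp_all

lemma nn_integral_std_gaussian:
  assumes [measurable]: "f \<in> borel_measurable borel"
  shows "(\<integral>\<^sup>+x. f x \<partial>\<gamma>) = (\<integral>\<^sup>+x. ennreal (normal_density 0 1 x) * f x \<partial>lborel)"
  unfolding std_gaussian_def by (subst nn_integral_density) auto

text \<open>The joint density depends only on the distance to the origin; all rotation invariance
  below rests on this.\<close>

lemma normal_density_01_mult_cong:
  assumes "x\<^sup>2 + y\<^sup>2 = u\<^sup>2 + v\<^sup>2"
  shows "normal_density 0 1 x * normal_density 0 1 y = normal_density 0 1 u * normal_density 0 1 v"
proof -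
  have "exp (- x\<^sup>2 / 2) * exp (- y\<^sup>2 / 2) = exp (- u\<^sup>2 / 2) * exp (- v\<^sup>2 / 2)"
    unfolding exp_add [symmetric] using assms by (intro arg_cong [where f = exp]) (simp add: field_simps)
  then show ?thesis
    by (simp add: normal_density_def field_simps)
qed

lemma nn_integral_std_gaussian2:
  assumes [measurable]: "case_prod f \<in> borel_measurable (borel \<Otimes>\<^sub>M borel)"
  shows "(\<integral>\<^sup>+x. \<integral>\<^sup>+y. f x y \<partial>\<gamma> \<partial>\<gamma>) =
    (\<integral>\<^sup>+x. \<integral>\<^sup>+y. ennreal (normal_density 0 1 x * normal_density 0 1 y) * f x y \<partial>lborel \<partial>lborel)"
  by (simp add: nn_integral_std_gaussian nn_integral_cmult [symmetric] ennreal_mult mult.assoc)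

text \<open>The rotation is composed of one-dimensional affine substitutions, first in the second
  variable and then, after Fubini, in the first; the Jacobians \<open>1 / a\<close> and
  \<open>a\<close> cancel. This divides by \<open>a\<close>, so quarter turns are treated apart:
  they are a swap of coordinates combined with sign changes.\<close>

lemma std_gaussian_rotation:
  fixes f :: "real \<Rightarrow> real \<Rightarrow> ennreal"
  assumes f [measurable]: "case_prod f \<in> borel_measurable (borel \<Otimes>\<^sub>M borel)"
    and ab: "a\<^sup>2 + b\<^sup>2 = 1"
  shows "(\<integral>\<^sup>+x. \<integral>\<^sup>+y. f (a * x + b * y) (a * y - b * x) \<partial>\<gamma> \<partial>\<gamma>) = (\<integral>\<^sup>+x. \<integral>\<^sup>+y. f x y \<partial>\<gamma> \<partial>\<gamma>)"
proof (cases "a = 0")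
  case True
  then have b: "\<bar>b\<bar> = 1" "b \<noteq> 0"
    using ab by (auto simp: power2_eq_1_iff)
  let ?d = "normal_density 0 1"
  have "(\<integral>\<^sup>+x. \<integral>\<^sup>+y. f x y \<partial>\<gamma> \<partial>\<gamma>) = (\<integral>\<^sup>+x. \<integral>\<^sup>+y. ennreal (?d x * ?d y) * f x y \<partial>lborel \<partial>lborel)"
    by (rule nn_integral_std_gaussian2) fact
  also have "\<dots> = (\<integral>\<^sup>+x. \<integral>\<^sup>+y. ennreal (?d (b * x) * ?d y) * f (b * x) y \<partial>lborel \<partial>lborel)"
    by (subst nn_integral_real_affine [where c = b and t = 0]) (simp_all add: b)
  also have "\<dots> = (\<integral>\<^sup>+x. \<integral>\<^sup>+y. ennreal (?d (b * x) * ?d (- b * y)) * f (b * x) (- b * y) \<partial>lborel \<partial>lborel)"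
    by (rule nn_integral_cong, subst nn_integral_real_affine [where c = "- b" and t = 0]) (simp_all add: b)
  also have "\<dots> = (\<integral>\<^sup>+y. \<integral>\<^sup>+x. ennreal (?d (b * x) * ?d (- b * y)) * f (b * x) (- b * y) \<partial>lborel \<partial>lborel)"
    by (rule lborel_pair.Fubini'[symmetric]) simp
  also have "\<dots> = (\<integral>\<^sup>+y. \<integral>\<^sup>+x. ennreal (?d y * ?d x) * f (b * x) (- b * y) \<partial>lborel \<partial>lborel)"
    using True ab by (intro nn_integral_cong arg_cong2 [where f = "(*)"] arg_cong [where f = ennreal]
        normal_density_01_mult_cong) (auto simp: power_mult_distrib)
  also have "\<dots> = (\<integral>\<^sup>+x. \<integral>\<^sup>+y. f (a * x + b * y) (a * y - b * x) \<partial>\<gamma> \<partial>\<gamma>)"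
    by (subst nn_integral_std_gaussian2) (simp_all add: True)
  finally show ?thesis ..
next
  case a: False
  let ?d = "normal_density 0 1"
  let ?g = "\<lambda>u v. ennreal (?d u * ?d v) * f u v"
  have "(\<integral>\<^sup>+x. \<integral>\<^sup>+y. f x y \<partial>\<gamma> \<partial>\<gamma>) = (\<integral>\<^sup>+u. \<integral>\<^sup>+v. ?g u v \<partial>lborel \<partial>lborel)"
    by (rule nn_integral_std_gaussian2) fact
  also have "\<dots> = (\<integral>\<^sup>+u. ennreal \<bar>1 / a\<bar> * (\<integral>\<^sup>+y. ?g u (- b / a * u + 1 / a * y) \<partial>lborel) \<partial>lborel)"
    by (rule nn_integral_cong, rule nn_integral_real_affine) (use a in auto)
  also have "\<dots> = ennreal \<bar>1 / a\<bar> * (\<integral>\<^sup>+u. \<integral>\<^sup>+y. ?g u (- b / a * u + 1 / a * y) \<partial>lborel \<partial>lborel)"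
    by (rule nn_integral_cmult) simp
  also have "\<dots> = ennreal \<bar>1 / a\<bar> * (\<integral>\<^sup>+y. \<integral>\<^sup>+u. ?g u (- b / a * u + 1 / a * y) \<partial>lborel \<partial>lborel)"
    by (subst lborel_pair.Fubini') simp_all
  also have "\<dots> = ennreal \<bar>1 / a\<bar> * (\<integral>\<^sup>+y. ennreal \<bar>a\<bar> * (\<integral>\<^sup>+x.
        ?g (b * y + a * x) (- b / a * (b * y + a * x) + 1 / a * y) \<partial>lborel) \<partial>lborel)"
    by (intro arg_cong2 [where f = "(*)"] refl nn_integral_cong nn_integral_real_affine) (use a in auto)
  also have "\<dots> = ennreal \<bar>1 / a\<bar> * (ennreal \<bar>a\<bar> * (\<integral>\<^sup>+y. \<integral>\<^sup>+x.
        ?g (b * y + a * x) (- b / a * (b * y + a * x) + 1 / a * y) \<partial>lborel \<partial>lborel))"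
    by (subst nn_integral_cmult) simp_all
  also have "\<dots> = (\<integral>\<^sup>+y. \<integral>\<^sup>+x. ?g (b * y + a * x) (- b / a * (b * y + a * x) + 1 / a * y) \<partial>lborel \<partial>lborel)"
    using a by (simp add: mult.assoc [symmetric] ennreal_mult [symmetric] abs_mult [symmetric])
  also have "\<dots> = (\<integral>\<^sup>+y. \<integral>\<^sup>+x. ennreal (?d y * ?d x) * f (a * x + b * y) (a * y - b * x) \<partial>lborel \<partial>lborel)"
  proof (intro nn_integral_cong)
    fix x y :: real
    have "a * (- b / a * (b * y + a * x) + 1 / a * y) = (1 - b\<^sup>2) * y - a * b * x"
      using a by (simp add: field_simps power2_eq_square)
    also have "1 - b\<^sup>2 = a * a" using ab by (simp add: power2_eq_square)
    finally have "a * (- b / a * (b * y + a * x) + 1 / a * y) = a * (a * y - b * x)"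
      by (simp add: algebra_simps)
    then have 1: "- b / a * (b * y + a * x) + 1 / a * y = a * y - b * x"
      using a by (simp only: mult_cancel_left) simp
    have "(b * y + a * x)\<^sup>2 + (a * y - b * x)\<^sup>2 = (a\<^sup>2 + b\<^sup>2) * (y\<^sup>2 + x\<^sup>2)"
      by (simp add: power2_eq_square algebra_simps)
    then have 2: "?d (b * y + a * x) * ?d (a * y - b * x) = ?d y * ?d x"
      by (intro normal_density_01_mult_cong) (simp add: ab)
    show "?g (b * y + a * x) (- b / a * (b * y + a * x) + 1 / a * y) =
        ennreal (?d y * ?d x) * f (a * x + b * y) (a * y - b * x)"
      unfolding 1 2 by (simp add: add.commute)
  qed
  also have "\<dots> = (\<integral>\<^sup>+x. \<integral>\<^sup>+y. f (a * x + b * y) (a * y - b * x) \<partial>\<gamma> \<partial>\<gamma>)"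
    by (subst lborel_pair.Fubini') (simp_all add: nn_integral_std_gaussian2 mult.commute)
  finally show ?thesis ..
qed

text \<open>Restricted to the first \<open>n\<close> coordinates because the points of
  \<open>gaussian_vector n\<close> are extensional functions. Plain scaling is written with second
  coefficient 0.\<close>

definition lincomb_n :: "nat \<Rightarrow> real \<Rightarrow> (nat \<Rightarrow> real) \<Rightarrow> real \<Rightarrow> (nat \<Rightarrow> real) \<Rightarrow> (nat \<Rightarrow> real)" where
  "lincomb_n n a x b y = (\<lambda>i\<in>{..<n}. a * x i + b * y i)"

lemma measurable_gaussian_vector_component:
  "i < n \<Longrightarrow> (\<lambda>x. x i) \<in> borel_measurable (gaussian_vector n)"
  unfolding measurable_cong_sets [OF sets_gaussian_vector refl] by measurable

lemma measurable_lincomb_n [measurable (raw)]: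
  assumes [measurable]: "X \<in> M \<rightarrow>\<^sub>M gaussian_vector n" "Y \<in> M \<rightarrow>\<^sub>M gaussian_vector n"
    "a \<in> borel_measurable M" "b \<in> borel_measurable M"
  shows "(\<lambda>w. lincomb_n n (a w) (X w) (b w) (Y w)) \<in> M \<rightarrow>\<^sub>M gaussian_vector n"
proof -
  have 1: "(\<lambda>w. X w i) \<in> borel_measurable M" "(\<lambda>w. Y w i) \<in> borel_measurable M" if "i < n" for i
    using that by (auto intro: measurable_compose [OF assms(1)] measurable_compose [OF assms(2)]
        measurable_gaussian_vector_component)
  show ?thesis
    unfolding measurable_cong_sets [OF refl sets_gaussian_vector] lincomb_n_def
    by (intro measurable_restrict) (use 1 in measurable)
qed

lemma measurable_inner_n [measurable (raw)]:
  assumes "X \<in> M \<rightarrow>\<^sub>M gaussian_vector n" "Y \<in> M \<rightarrow>\<^sub>M gaussian_vector n"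
  shows "(\<lambda>w. inner_n n (X w) (Y w)) \<in> borel_measurable M"
proof -
  have "(\<lambda>w. X w i) \<in> borel_measurable M" "(\<lambda>w. Y w i) \<in> borel_measurable M" if "i < n" for i
    using that by (auto intro: measurable_compose [OF assms(1)] measurable_compose [OF assms(2)]
        measurable_gaussian_vector_component)
  then show ?thesis
    unfolding inner_n_def by measurable
qed

lemma measurable_inner_n_const [measurable (raw)]:
  assumes "X \<in> M \<rightarrow>\<^sub>M gaussian_vector n"
  shows "(\<lambda>w. inner_n n (X w) y) \<in> borel_measurable M" "(\<lambda>w. inner_n n y (X w)) \<in> borel_measurable M"
proof -
  have "(\<lambda>w. X w i) \<in> borel_measurable M" if "i < n" for i
    using that by (auto intro: measurable_compose [OF assms] measurable_gaussian_vector_component)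
  then show "(\<lambda>w. inner_n n (X w) y) \<in> borel_measurable M" "(\<lambda>w. inner_n n y (X w)) \<in> borel_measurable M"
    unfolding inner_n_def by measurable
qed

lemma measurable_fun_upd_gaussian_vector [measurable (raw)]:
  assumes "X \<in> M \<rightarrow>\<^sub>M gaussian_vector n" "a \<in> borel_measurable M"
  shows "(\<lambda>w. (X w)(n := a w)) \<in> M \<rightarrow>\<^sub>M gaussian_vector (Suc n)"
  using assms unfolding gaussian_vector_def
  by (intro measurable_fun_upd [where J = "{..<n}"]) (auto simp: lessThan_Suc)

lemma nn_integral_gaussian_vector_0:
  "(\<integral>\<^sup>+X. f X \<partial>gaussian_vector 0) = f (\<lambda>_. undefined)"
  by (simp add: gaussian_vector_def nn_integral_empty PiM_empty nn_integral_count_space_finite)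

lemma nn_integral_gaussian_vector_Suc:
  assumes "f \<in> borel_measurable (gaussian_vector (Suc n))"
  shows "(\<integral>\<^sup>+X. f X \<partial>gaussian_vector (Suc n)) = (\<integral>\<^sup>+t. \<integral>\<^sup>+X. f (X(n := t)) \<partial>gaussian_vector n \<partial>\<gamma>)"
  using assms unfolding gaussian_vector_def lessThan_Suc
  by (intro std_gaussian_prod.product_nn_integral_insert_rev) auto

lemma lincomb_n_fun_upd:
  "lincomb_n (Suc n) a (X(n := s)) b (Y(n := t)) = (lincomb_n n a X b Y)(n := a * s + b * t)"
  by (auto simp: lincomb_n_def fun_eq_iff less_Suc_eq)

interpretation std_gaussian_vec: pair_prob_space \<gamma> "gaussian_vector k" for k
  by unfold_locales

interpretation std_gaussian_pair: pair_prob_space \<gamma> \<gamma>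
  by unfold_locales

text \<open>The two vectors are rotated coordinate by coordinate: splitting off the last coordinate
  of each leaves a planar rotation of \<open>(s, t)\<close>, and the induction hypothesis is applied
  with \<open>s\<close> and \<open>t\<close> fixed.\<close>

lemma gaussian_vector_rotation:
  fixes f :: "(nat \<Rightarrow> real) \<Rightarrow> (nat \<Rightarrow> real) \<Rightarrow> ennreal"
  assumes "case_prod f \<in> borel_measurable (gaussian_vector n \<Otimes>\<^sub>M gaussian_vector n)"
    and ab: "a\<^sup>2 + b\<^sup>2 = 1"
  shows "(\<integral>\<^sup>+X. \<integral>\<^sup>+Y. f (lincomb_n n a X b Y) (lincomb_n n a Y (- b) X) \<partial>gaussian_vector n \<partial>gaussian_vector n)
    = (\<integral>\<^sup>+X. \<integral>\<^sup>+Y. f X Y \<partial>gaussian_vector n \<partial>gaussian_vector n)"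
  using assms(1)
proof (induction n arbitrary: f)
  case 0
  have "lincomb_n 0 c X d Y = (\<lambda>_. undefined)" for c X d Y
    by (auto simp: lincomb_n_def)
  then show ?case
    by (simp add: nn_integral_gaussian_vector_0 gaussian_vector.emeasure_space_1)
next
  case (Suc n)
  note [measurable] = Suc.prems
  let ?g = "gaussian_vector n" and ?g' = "gaussian_vector (Suc n)"
  have split: "(\<integral>\<^sup>+X. \<integral>\<^sup>+Y. h X Y \<partial>?g' \<partial>?g') =
      (\<integral>\<^sup>+s. \<integral>\<^sup>+t. \<integral>\<^sup>+X. \<integral>\<^sup>+Y. h (X(n := s)) (Y(n := t)) \<partial>?g \<partial>?g \<partial>\<gamma> \<partial>\<gamma>)"
    if [measurable]: "case_prod h \<in> borel_measurable (?g' \<Otimes>\<^sub>M ?g')" for h :: "_ \<Rightarrow> _ \<Rightarrow> ennreal"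
  proof -
    have "(\<integral>\<^sup>+X. \<integral>\<^sup>+Y. h X Y \<partial>?g' \<partial>?g') = (\<integral>\<^sup>+s. \<integral>\<^sup>+X. \<integral>\<^sup>+Y. h (X(n := s)) Y \<partial>?g' \<partial>?g \<partial>\<gamma>)"
      by (subst nn_integral_gaussian_vector_Suc) auto
    also have "\<dots> = (\<integral>\<^sup>+s. \<integral>\<^sup>+X. \<integral>\<^sup>+t. \<integral>\<^sup>+Y. h (X(n := s)) (Y(n := t)) \<partial>?g \<partial>\<gamma> \<partial>?g \<partial>\<gamma>)"
      by (intro nn_integral_cong nn_integral_gaussian_vector_Suc) auto
    also have "\<dots> = (\<integral>\<^sup>+s. \<integral>\<^sup>+t. \<integral>\<^sup>+X. \<integral>\<^sup>+Y. h (X(n := s)) (Y(n := t)) \<partial>?g \<partial>?g \<partial>\<gamma> \<partial>\<gamma>)"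
      by (intro nn_integral_cong std_gaussian_vec.Fubini') measurable
    finally show ?thesis .
  qed
  have "(\<integral>\<^sup>+X. \<integral>\<^sup>+Y. f (lincomb_n (Suc n) a X b Y) (lincomb_n (Suc n) a Y (- b) X) \<partial>?g' \<partial>?g') =
     (\<integral>\<^sup>+s. \<integral>\<^sup>+t. \<integral>\<^sup>+X. \<integral>\<^sup>+Y. f ((lincomb_n n a X b Y)(n := a * s + b * t))
        ((lincomb_n n a Y (- b) X)(n := a * t - b * s)) \<partial>?g \<partial>?g \<partial>\<gamma> \<partial>\<gamma>)"
    by (subst split) (auto simp: lincomb_n_fun_upd)
  also have "\<dots> = (\<integral>\<^sup>+s. \<integral>\<^sup>+t. \<integral>\<^sup>+X. \<integral>\<^sup>+Y. f (X(n := a * s + b * t)) (Y(n := a * t - b * s)) \<partial>?g \<partial>?g \<partial>\<gamma> \<partial>\<gamma>)"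
  proof (rule nn_integral_cong, rule nn_integral_cong)
    fix s t :: real
    show "(\<integral>\<^sup>+X. \<integral>\<^sup>+Y. f ((lincomb_n n a X b Y)(n := a * s + b * t))
        ((lincomb_n n a Y (- b) X)(n := a * t - b * s)) \<partial>?g \<partial>?g) =
      (\<integral>\<^sup>+X. \<integral>\<^sup>+Y. f (X(n := a * s + b * t)) (Y(n := a * t - b * s)) \<partial>?g \<partial>?g)"
      by (rule Suc.IH [where f = "\<lambda>X Y. f (X(n := a * s + b * t)) (Y(n := a * t - b * s))"]) measurable
  qed
  also have "\<dots> = (\<integral>\<^sup>+s. \<integral>\<^sup>+t. \<integral>\<^sup>+X. \<integral>\<^sup>+Y. f (X(n := s)) (Y(n := t)) \<partial>?g \<partial>?g \<partial>\<gamma> \<partial>\<gamma>)"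
    by (rule std_gaussian_rotation [OF _ ab,
        where f = "\<lambda>s t. \<integral>\<^sup>+X. \<integral>\<^sup>+Y. f (X(n := s)) (Y(n := t)) \<partial>?g \<partial>?g"]) measurable
  also have "\<dots> = (\<integral>\<^sup>+X. \<integral>\<^sup>+Y. f X Y \<partial>?g' \<partial>?g')"
    by (rule split [symmetric]) measurable
  finally show ?case .
qed

section \<open>Gaussian shifts, bivariate laws and the arc-cosine kernel\<close>

text \<open>The Cameron-Martin formula in one dimension: the exponential factor turns the density
  centred at 0 into the one centred at \<open>v\<close>.\<close>

lemma std_gaussian_shift:
  assumes [measurable]: "f \<in> borel_measurable borel"
  shows "(\<integral>\<^sup>+x. f (x + v) \<partial>\<gamma>) = (\<integral>\<^sup>+x. f x * ennreal (exp (v * x - v\<^sup>2 / 2)) \<partial>\<gamma>)"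
proof -
  have "(\<integral>\<^sup>+x. f x * ennreal (exp (v * x - v\<^sup>2 / 2)) \<partial>\<gamma>) =
      (\<integral>\<^sup>+x. ennreal (normal_density 0 1 x) * (f x * ennreal (exp (v * x - v\<^sup>2 / 2))) \<partial>lborel)"
    by (rule nn_integral_std_gaussian) measurable
  also have "\<dots> = (\<integral>\<^sup>+x. ennreal (normal_density v 1 x) * f x \<partial>lborel)"
  proof (intro nn_integral_cong)
    fix x :: real
    have "normal_density 0 1 x * exp (v * x - v\<^sup>2 / 2) = normal_density v 1 x"
      by (simp add: normal_density_def mult_exp_exp) (simp add: power2_eq_square field_simps)
    then show "ennreal (normal_density 0 1 x) * (f x * ennreal (exp (v * x - v\<^sup>2 / 2))) =
        ennreal (normal_density v 1 x) * f x"
      by (metis ennreal_mult exp_ge_zero mult.assoc mult.commute normal_density_nonneg)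
  qed
  also have "\<dots> = (\<integral>\<^sup>+x. ennreal (normal_density v 1 (v + 1 * x)) * f (v + 1 * x) \<partial>lborel)"
    by (subst nn_integral_real_affine [where c = 1 and t = v]) auto
  also have "\<dots> = (\<integral>\<^sup>+x. ennreal (normal_density 0 1 x) * f (x + v) \<partial>lborel)"
    by (intro nn_integral_cong) (simp add: normal_density_def add.commute)
  also have "\<dots> = (\<integral>\<^sup>+x. f (x + v) \<partial>\<gamma>)"
    by (rule nn_integral_std_gaussian [symmetric]) measurable
  finally show ?thesis ..
qed

lemma inner_n_fun_upd [simp]:
  "inner_n n (X(n := t)) y = inner_n n X y" "inner_n n x (Y(n := t)) = inner_n n x Y"
  by (simp_all add: inner_n_def)

lemma inner_n_Suc: "inner_n (Suc n) x y = inner_n n x y + x n * y n"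
  by (simp add: inner_n_def)

text \<open>Cameron-Martin for vectors. It yields the Laplace transform of linear forms (with
  \<open>f\<close> constant) and, in Sudakov minoration, the measure of translated sets.\<close>

lemma gaussian_vector_shift:
  assumes "f \<in> borel_measurable (gaussian_vector n)"
  shows "(\<integral>\<^sup>+X. f (\<lambda>i\<in>{..<n}. X i + v i) \<partial>gaussian_vector n) =
    (\<integral>\<^sup>+X. f X * ennreal (exp (inner_n n X v - inner_n n v v / 2)) \<partial>gaussian_vector n)"
  using assms
proof (induction n arbitrary: f)
  case 0
  show ?case
    by (simp add: nn_integral_gaussian_vector_0 inner_n_def restrict_def gaussian_vector.emeasure_space_1)
next
  case (Suc n)
  note [measurable] = Suc.prems
  have shift: "(\<lambda>X. \<lambda>i\<in>{..<k}. X i + v i) \<in> gaussian_vector k \<rightarrow>\<^sub>M gaussian_vector k" for k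
    unfolding measurable_cong_sets [OF refl sets_gaussian_vector]
    by (rule measurable_restrict) auto
  have upd: "(\<lambda>i\<in>{..<Suc n}. (X(n := t)) i + v i) = (\<lambda>i\<in>{..<n}. X i + v i)(n := t + v n)" for X t
    by (auto simp: fun_eq_iff less_Suc_eq)
  have "(\<integral>\<^sup>+X. f (\<lambda>i\<in>{..<Suc n}. X i + v i) \<partial>gaussian_vector (Suc n)) =
      (\<integral>\<^sup>+t. \<integral>\<^sup>+X. f ((\<lambda>i\<in>{..<n}. X i + v i)(n := t + v n)) \<partial>gaussian_vector n \<partial>\<gamma>)"
    using measurable_compose [OF shift Suc.prems]
    by (subst nn_integral_gaussian_vector_Suc) (auto simp only: upd)
  also have "\<dots> = (\<integral>\<^sup>+t. \<integral>\<^sup>+X. f (X(n := t + v n)) * ennreal (exp (inner_n n X v - inner_n n v v / 2))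
      \<partial>gaussian_vector n \<partial>\<gamma>)"
  proof (rule nn_integral_cong)
    fix t :: real
    show "(\<integral>\<^sup>+X. f ((\<lambda>i\<in>{..<n}. X i + v i)(n := t + v n)) \<partial>gaussian_vector n) =
      (\<integral>\<^sup>+X. f (X(n := t + v n)) * ennreal (exp (inner_n n X v - inner_n n v v / 2)) \<partial>gaussian_vector n)"
      by (rule Suc.IH [where f = "\<lambda>X. f (X(n := t + v n))"]) measurable
  qed
  also have "\<dots> = (\<integral>\<^sup>+t. (\<integral>\<^sup>+X. f (X(n := t)) * ennreal (exp (inner_n n X v - inner_n n v v / 2))
      \<partial>gaussian_vector n) * ennreal (exp (v n * t - (v n)\<^sup>2 / 2)) \<partial>\<gamma>)"
    by (rule std_gaussian_shift) measurable
  also have "\<dots> = (\<integral>\<^sup>+t. \<integral>\<^sup>+X. f (X(n := t)) * ennreal (exp (inner_n (Suc n) (X(n := t)) v - inner_n (Suc n) v v / 2))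
      \<partial>gaussian_vector n \<partial>\<gamma>)"
  proof (intro nn_integral_cong)
    fix t :: real
    have eq: "exp (inner_n (Suc n) (X(n := t)) v - inner_n (Suc n) v v / 2) =
        exp (inner_n n X v - inner_n n v v / 2) * exp (v n * t - (v n)\<^sup>2 / 2)" for X
      by (simp add: inner_n_Suc exp_add [symmetric] power2_eq_square field_simps)
    show "(\<integral>\<^sup>+X. f (X(n := t)) * ennreal (exp (inner_n n X v - inner_n n v v / 2)) \<partial>gaussian_vector n)
        * ennreal (exp (v n * t - (v n)\<^sup>2 / 2)) =
      (\<integral>\<^sup>+X. f (X(n := t)) * ennreal (exp (inner_n (Suc n) (X(n := t)) v - inner_n (Suc n) v v / 2))
      \<partial>gaussian_vector n)"
      unfolding eq by (subst nn_integral_multc [symmetric]) (simp_all add: ennreal_mult mult.assoc)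
  qed
  also have "\<dots> = (\<integral>\<^sup>+X. f X * ennreal (exp (inner_n (Suc n) X v - inner_n (Suc n) v v / 2)) \<partial>gaussian_vector (Suc n))"
    by (rule nn_integral_gaussian_vector_Suc [symmetric]) measurable
  finally show ?case .
qed

text \<open>Polar coordinates with the direction \<open>(1, 0)\<close> as default at the origin,
  which spares later arguments a case distinction for vanishing vectors.\<close>

lemma unit_vector_direction:
  fixes a p :: real
  obtains \<alpha> \<beta> where "\<alpha>\<^sup>2 + \<beta>\<^sup>2 = 1" "a = sqrt (a\<^sup>2 + p\<^sup>2) * \<alpha>" "p = sqrt (a\<^sup>2 + p\<^sup>2) * \<beta>"
proof (cases "a\<^sup>2 + p\<^sup>2 = 0")
  case True
  then have "a = 0" "p = 0" by (simp_all add: sum_power2_eq_zero_iff)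
  then show ?thesis using that [of 1 0] by simp
next
  case False
  have "(a / sqrt (a\<^sup>2 + p\<^sup>2))\<^sup>2 + (p / sqrt (a\<^sup>2 + p\<^sup>2))\<^sup>2 = 1"
    using False by (simp add: power_divide add_divide_distrib [symmetric])
  then show ?thesis using False that [of "a / sqrt (a\<^sup>2 + p\<^sup>2)" "p / sqrt (a\<^sup>2 + p\<^sup>2)"] by simp
qed

lemma std_gaussian_lincomb:
  assumes [measurable]: "h \<in> borel_measurable borel"
  shows "(\<integral>\<^sup>+r. \<integral>\<^sup>+t. h (d * r + c * t) \<partial>\<gamma> \<partial>\<gamma>) = (\<integral>\<^sup>+t. h (sqrt (d\<^sup>2 + c\<^sup>2) * t) \<partial>\<gamma>)"
proof -
  obtain \<alpha> \<beta> where ab: "\<alpha>\<^sup>2 + \<beta>\<^sup>2 = 1" "d = sqrt (d\<^sup>2 + c\<^sup>2) * \<alpha>" "c = sqrt (d\<^sup>2 + c\<^sup>2) * \<beta>"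
    by (rule unit_vector_direction)
  have "(\<integral>\<^sup>+r. \<integral>\<^sup>+t. h (d * r + c * t) \<partial>\<gamma> \<partial>\<gamma>) =
    (\<integral>\<^sup>+r. \<integral>\<^sup>+t. h (sqrt (d\<^sup>2 + c\<^sup>2) * (\<alpha> * r + \<beta> * t)) \<partial>\<gamma> \<partial>\<gamma>)"
    by (subst ab(2), subst ab(3)) (simp add: algebra_simps)
  also have "\<dots> = (\<integral>\<^sup>+r. \<integral>\<^sup>+t. h (sqrt (d\<^sup>2 + c\<^sup>2) * r) \<partial>\<gamma> \<partial>\<gamma>)"
    by (rule std_gaussian_rotation [OF _ ab(1), where f = "\<lambda>x _. h (sqrt (d\<^sup>2 + c\<^sup>2) * x)"]) measurable
  finally show ?thesis by (simp add: std_gaussian.emeasure_space_1[simplified])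
qed

text \<open>The triple \<open>(a, b, c)\<close> is the Cholesky factor of the Gram matrix of \<open>x\<close> and \<open>y\<close>.\<close>
lemma gaussian_vector_bivariate:
  "\<exists>a b c. 0 \<le> a \<and> 0 \<le> c \<and> a\<^sup>2 = inner_n n x x \<and> a * b = inner_n n x y \<and> b\<^sup>2 + c\<^sup>2 = inner_n n y y \<and>
    (\<forall>\<Psi>::real \<Rightarrow> real \<Rightarrow> ennreal. case_prod \<Psi> \<in> borel_measurable (borel \<Otimes>\<^sub>M borel) \<longrightarrow>
      (\<integral>\<^sup>+g. \<Psi> (inner_n n g x) (inner_n n g y) \<partial>gaussian_vector n) =
      (\<integral>\<^sup>+s. \<integral>\<^sup>+t. \<Psi> (a * s) (b * s + c * t) \<partial>\<gamma> \<partial>\<gamma>))"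
proof (induction n)
  case 0
  show ?case
    by (rule exI [of _ 0], rule exI [of _ 0], rule exI [of _ 0])
      (auto simp: inner_n_def gaussian_vector.emeasure_space_1 std_gaussian.emeasure_space_1[simplified])
next
  case (Suc n)
  then obtain a b c where abc: "0 \<le> a" "0 \<le> c" "a\<^sup>2 = inner_n n x x" "a * b = inner_n n x y"
      "b\<^sup>2 + c\<^sup>2 = inner_n n y y"
    and law: "\<And>\<Psi>::real \<Rightarrow> real \<Rightarrow> ennreal. case_prod \<Psi> \<in> borel_measurable (borel \<Otimes>\<^sub>M borel) \<Longrightarrow>
      (\<integral>\<^sup>+g. \<Psi> (inner_n n g x) (inner_n n g y) \<partial>gaussian_vector n) =
      (\<integral>\<^sup>+s. \<integral>\<^sup>+t. \<Psi> (a * s) (b * s + c * t) \<partial>\<gamma> \<partial>\<gamma>)" by blast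
  define p q a' where "p = x n" and "q = y n" and "a' = sqrt (a\<^sup>2 + p\<^sup>2)"
  obtain \<alpha> \<beta> where ab: "\<alpha>\<^sup>2 + \<beta>\<^sup>2 = 1" and a: "a = a' * \<alpha>" and p: "p = a' * \<beta>"
    using unit_vector_direction [of a p] unfolding a'_def by metis
  \<comment> \<open>A Givens rotation updates the Cholesky factor: \<open>b'\<close> is the
    component of the second row along the new first axis, \<open>d\<close> the component orthogonal
    to it. The latter is then merged with the old residual \<open>c\<close> into
    \<open>c'\<close>.\<close>
  define b' d where "b' = b * \<alpha> + q * \<beta>" and "d = q * \<alpha> - b * \<beta>"
  define c' where "c' = sqrt (d\<^sup>2 + c\<^sup>2)"
  have "b'\<^sup>2 + d\<^sup>2 = (b\<^sup>2 + q\<^sup>2) * (\<alpha>\<^sup>2 + \<beta>\<^sup>2)"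
    unfolding b'_def d_def by (simp add: power2_eq_square algebra_simps)
  then have "b'\<^sup>2 + c'\<^sup>2 = inner_n (Suc n) y y"
    using abc(5) ab by (simp add: c'_def inner_n_Suc q_def power2_eq_square)
  moreover have "a' * b' = inner_n (Suc n) x y"
    using abc(4) by (simp add: inner_n_Suc b'_def p_def [symmetric] q_def [symmetric])
      (simp add: a p algebra_simps)
  moreover have "a'\<^sup>2 = inner_n (Suc n) x x"
  proof -
    have "a'\<^sup>2 = a\<^sup>2 + p\<^sup>2"
      unfolding a'_def by (rule real_sqrt_pow2) simp
    then show ?thesis
      unfolding abc(3) by (simp add: inner_n_Suc p_def power2_eq_square [of "x n"])
  qed
  moreover have "0 \<le> a'" "0 \<le> c'" by (simp_all add: a'_def c'_def)
  moreover have "(\<integral>\<^sup>+g. \<Psi> (inner_n (Suc n) g x) (inner_n (Suc n) g y) \<partial>gaussian_vector (Suc n)) =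
      (\<integral>\<^sup>+s. \<integral>\<^sup>+t. \<Psi> (a' * s) (b' * s + c' * t) \<partial>\<gamma> \<partial>\<gamma>)"
    if [measurable]: "case_prod \<Psi> \<in> borel_measurable (borel \<Otimes>\<^sub>M borel)" for \<Psi> :: "real \<Rightarrow> real \<Rightarrow> ennreal"
  proof -
    have "(\<integral>\<^sup>+g. \<Psi> (inner_n (Suc n) g x) (inner_n (Suc n) g y) \<partial>gaussian_vector (Suc n)) =
       (\<integral>\<^sup>+r. \<integral>\<^sup>+g. \<Psi> (inner_n n g x + r * p) (inner_n n g y + r * q) \<partial>gaussian_vector n \<partial>\<gamma>)"
      by (subst nn_integral_gaussian_vector_Suc, measurable) (simp add: inner_n_Suc p_def q_def)
    also have "\<dots> = (\<integral>\<^sup>+r. \<integral>\<^sup>+s. \<integral>\<^sup>+t. \<Psi> (a * s + r * p) (b * s + c * t + r * q) \<partial>\<gamma> \<partial>\<gamma> \<partial>\<gamma>)"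
      by (rule nn_integral_cong, rule law) measurable
    also have "\<dots> = (\<integral>\<^sup>+s. \<integral>\<^sup>+r. \<integral>\<^sup>+t. \<Psi> (a * s + r * p) (b * s + c * t + r * q) \<partial>\<gamma> \<partial>\<gamma> \<partial>\<gamma>)"
      by (rule std_gaussian_pair.Fubini') measurable
    also have "\<dots> = (\<integral>\<^sup>+s. \<integral>\<^sup>+r. \<integral>\<^sup>+t. \<Psi> (a' * (\<alpha> * s + \<beta> * r))
        (b' * (\<alpha> * s + \<beta> * r) + d * (\<alpha> * r - \<beta> * s) + c * t) \<partial>\<gamma> \<partial>\<gamma> \<partial>\<gamma>)"
    proof (intro nn_integral_cong arg_cong2 [where f = \<Psi>])
      fix s r t :: real
      have "b' * (\<alpha> * s + \<beta> * r) + d * (\<alpha> * r - \<beta> * s) = (b * s + q * r) * (\<alpha>\<^sup>2 + \<beta>\<^sup>2)"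
        unfolding b'_def d_def by (simp add: power2_eq_square algebra_simps)
      then show "b * s + c * t + r * q = b' * (\<alpha> * s + \<beta> * r) + d * (\<alpha> * r - \<beta> * s) + c * t"
        using ab by simp
    qed (simp add: a p algebra_simps)
    also have "\<dots> = (\<integral>\<^sup>+s. \<integral>\<^sup>+r. \<integral>\<^sup>+t. \<Psi> (a' * s) (b' * s + d * r + c * t) \<partial>\<gamma> \<partial>\<gamma> \<partial>\<gamma>)"
      by (rule std_gaussian_rotation [OF _ ab, where f = "\<lambda>s r. \<integral>\<^sup>+t. \<Psi> (a' * s) (b' * s + d * r + c * t) \<partial>\<gamma>"])
        measurable
    also have "\<dots> = (\<integral>\<^sup>+s. \<integral>\<^sup>+t. \<Psi> (a' * s) (b' * s + c' * t) \<partial>\<gamma> \<partial>\<gamma>)"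
    proof (rule nn_integral_cong)
      fix s :: real
      show "(\<integral>\<^sup>+r. \<integral>\<^sup>+t. \<Psi> (a' * s) (b' * s + d * r + c * t) \<partial>\<gamma> \<partial>\<gamma>) =
          (\<integral>\<^sup>+t. \<Psi> (a' * s) (b' * s + c' * t) \<partial>\<gamma>)"
        unfolding c'_def add.assoc
        by (rule std_gaussian_lincomb [where h = "\<lambda>u. \<Psi> (a' * s) (b' * s + u)"]) measurable
    qed
    finally show ?thesis .
  qed
  ultimately show ?case by blast
qed

section \<open>The kernel integral in radial and angular variables\<close>

lemma nn_integral_cube_gaussian_tail:
  fixes k :: real
  assumes k: "0 < k"
  shows "(\<integral>\<^sup>+s. ennreal (s^3 * exp (- k * s\<^sup>2 / 2)) * indicator {0..} s \<partial>lborel) = ennreal (2 / k\<^sup>2)"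
proof -
  \<comment> \<open>Found by integrating by parts once. In the application \<open>k\<close> is
    \<open>1 + t * t\<close> with \<open>t\<close> the slope, so the result supplies the angular
    weight.\<close>
  let ?F = "\<lambda>s. - ((s\<^sup>2 / k + 2 / k\<^sup>2) * exp (- k * s\<^sup>2 / 2))"
  have "(?F \<longlongrightarrow> 0) at_top" using k by real_asymp
  moreover have "DERIV ?F s :> s^3 * exp (- k * s\<^sup>2 / 2)" for s
    using k by (auto intro!: derivative_eq_intros simp: power2_eq_square power3_eq_cube field_simps)
  ultimately have "(\<integral>\<^sup>+s. ennreal (s^3 * exp (- k * s\<^sup>2 / 2)) * indicator {0..} s \<partial>lborel) = ennreal (0 - ?F 0)"
    by (intro nn_integral_FTC_atLeast) auto
  then show ?thesis by simp
qed

lemma relu_nonneg [simp]: "0 \<le> relu t"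
  by (simp add: relu_def)

lemma relu_mult: "0 \<le> c \<Longrightarrow> relu (c * t) = c * relu t"
  by (auto simp: relu_def max_def mult_le_0_iff zero_le_mult_iff)

lemma borel_measurable_relu [measurable]: "relu \<in> borel_measurable borel"
  unfolding relu_def by measurable

text \<open>The angular part. The rectifier cuts the line at \<open>t0\<close>, which is minus the
  cotangent of \<theta>. The weight has an elementary primitive because
  \<open>t / (1 + t * t) + arctan t\<close> has derivative
  \<open>2 / (1 + t\<^sup>2)\<^sup>2\<close>.\<close>

lemma nn_integral_relu_cauchy:
  assumes s: "0 < sin \<theta>" and \<theta>: "0 \<le> \<theta>" "\<theta> \<le> pi"
  shows "(\<integral>\<^sup>+t. ennreal (relu (cos \<theta> + sin \<theta> * t) / (1 + t\<^sup>2)\<^sup>2 / pi) \<partial>lborel) =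
    ennreal ((sin \<theta> + (pi - \<theta>) * cos \<theta>) / (2 * pi))"
proof -
  define c \<sigma> where "c = cos \<theta>" and "\<sigma> = sin \<theta>"
  define t0 where "t0 = - c / \<sigma>"
  have \<sigma>: "\<sigma> > 0" using s by (simp add: \<sigma>_def)
  have cs: "c\<^sup>2 + \<sigma>\<^sup>2 = 1" by (simp add: c_def \<sigma>_def)
  have pos: "1 + t * t > 0" for t :: real
    by (smt (verit) mult_minus_left zero_le_square)
  let ?H = "\<lambda>t. (c / 2 * (t / (1 + t * t) + arctan t) - \<sigma> / 2 * (1 / (1 + t * t))) / pi"
  let ?h = "\<lambda>t. (c + \<sigma> * t) / (1 + t\<^sup>2)\<^sup>2 / pi"
  have deriv: "DERIV ?H t :> ?h t" for t
  proof -
    have 1: "DERIV (\<lambda>t. t / (1 + t * t)) t :> (1 - t * t) / ((1 + t * t) * (1 + t * t))"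
      using pos [of t] by (auto intro!: derivative_eq_intros simp: divide_simps)
    have 2: "DERIV (\<lambda>t. 1 / (1 + t * t)) t :> - (2 * t) / ((1 + t * t) * (1 + t * t))"
      using pos [of t] by (auto intro!: derivative_eq_intros simp: divide_simps)
    have "(c / 2 * ((1 - t * t) / ((1 + t * t) * (1 + t * t)) + inverse (1 + t\<^sup>2)) -
        \<sigma> / 2 * (- (2 * t) / ((1 + t * t) * (1 + t * t)))) / pi = ?h t"
      using pos [of t] by (simp add: power2_eq_square divide_simps)
    then show ?thesis
      by (rule DERIV_cong [OF DERIV_cdivide [OF DERIV_diff [OF
            DERIV_cmult [OF DERIV_add [OF 1 DERIV_arctan]] DERIV_cmult [OF 2]]]])
  qed
  have lim: "(?H \<longlongrightarrow> c / 4) at_top"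
  proof -
    have "((\<lambda>t::real. t / (1 + t * t)) \<longlongrightarrow> 0) at_top" "((\<lambda>t::real. 1 / (1 + t * t)) \<longlongrightarrow> 0) at_top"
      by real_asymp+
    then have "(?H \<longlongrightarrow> (c / 2 * (0 + pi / 2) - \<sigma> / 2 * 0) / pi) at_top"
      by (intro tendsto_intros tendsto_arctan_at_top) simp_all
    then show ?thesis by simp
  qed
  have "(\<integral>\<^sup>+t. ennreal (relu (c + \<sigma> * t) / (1 + t\<^sup>2)\<^sup>2 / pi) \<partial>lborel) =
      (\<integral>\<^sup>+t. ennreal (?h t) * indicator {t0..} t \<partial>lborel)"
    using \<sigma> by (intro nn_integral_cong) (auto simp: relu_def t0_def field_simps indicator_def max_def not_le)
  also have "\<dots> = ennreal (c / 4 - ?H t0)"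
    using \<sigma> by (intro nn_integral_FTC_atLeast deriv lim) (auto simp: t0_def field_simps)
  also have "c / 4 - ?H t0 = (\<sigma> + (pi - \<theta>) * c) / (2 * pi)"
  proof -
    \<comment> \<open>This is where the angle itself, and not only its sine and cosine, enters the
      kernel.\<close>
    have "arctan t0 = \<theta> - pi / 2"
    proof (rule arctan_unique)
      have "\<theta> \<noteq> 0" "\<theta> \<noteq> pi" using s by auto
      then show "- (pi / 2) < \<theta> - pi / 2" "\<theta> - pi / 2 < pi / 2" using \<theta> by auto
      show "tan (\<theta> - pi / 2) = t0"
        by (simp add: tan_def t0_def c_def \<sigma>_def sin_diff cos_diff)
    qed
    moreover have "1 + t0 * t0 = 1 / \<sigma>\<^sup>2"
      using \<sigma> cs by (simp add: t0_def power2_eq_square field_simps)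
    ultimately have "c / 4 - ?H t0 =
        c / 4 - (c / 2 * (- c * \<sigma> + (\<theta> - pi / 2)) - \<sigma> / 2 * \<sigma>\<^sup>2) / pi"
      using \<sigma> by (simp add: t0_def power2_eq_square)
    also have "\<dots> = (\<sigma> * (c\<^sup>2 + \<sigma>\<^sup>2) + (pi - \<theta>) * c) / (2 * pi)"
      by (simp add: field_simps power2_eq_square)
    finally show ?thesis by (simp add: cs)
  qed
  finally show ?thesis by (simp add: c_def \<sigma>_def)
qed

lemma nn_integral_std_gaussian_sq: "(\<integral>\<^sup>+s. ennreal (s\<^sup>2) \<partial>\<gamma>) = 1"
proof -
  have "(\<integral>\<^sup>+s. ennreal (s\<^sup>2) \<partial>\<gamma>) = (\<integral>\<^sup>+s. ennreal (normal_density 0 1 s * s ^ (2 * 1)) \<partial>lborel)"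
    by (subst nn_integral_std_gaussian) (auto simp: ennreal_mult)
  also have "\<dots> = 1"
    using std_normal_moment_even [of 1] by (subst nn_integral_eq_integral) (auto simp: has_bochner_integral_iff fact_numeral)
  finally show ?thesis .
qed

text \<open>By symmetry the positive part carries half of the second moment. This settles the
  degenerate angle 0 of the kernel.\<close>

lemma nn_integral_relu_sq: "(\<integral>\<^sup>+s. ennreal (relu s * relu s) \<partial>\<gamma>) = ennreal (1 / 2)"
proof -
  have "(\<integral>\<^sup>+s. ennreal (relu s * relu s) \<partial>\<gamma>) = (\<integral>\<^sup>+s. ennreal (relu (- s) * relu (- s)) \<partial>\<gamma>)"
    by (subst (1 2) nn_integral_std_gaussian, measurable,
        subst nn_integral_real_affine [where c = "-1" and t = 0]) (auto simp: normal_density_def)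
  then have "2 * (\<integral>\<^sup>+s. ennreal (relu s * relu s) \<partial>\<gamma>) =
      (\<integral>\<^sup>+s. ennreal (relu s * relu s) \<partial>\<gamma>) + (\<integral>\<^sup>+s. ennreal (relu (- s) * relu (- s)) \<partial>\<gamma>)"
    by (simp add: mult_2)
  also have "\<dots> = (\<integral>\<^sup>+s. ennreal (s\<^sup>2) \<partial>\<gamma>)"
    by (subst nn_integral_add [symmetric], measurable, intro nn_integral_cong)
      (auto simp: relu_def max_def power2_eq_square ennreal_plus [symmetric] simp del: ennreal_plus)
  also have "\<dots> = 1" by (rule nn_integral_std_gaussian_sq)
  finally have "2 * (\<integral>\<^sup>+s. ennreal (relu s * relu s) \<partial>\<gamma>) = 2 * (1 / 2)"
    by (simp add: ennreal_mult_divide_eq ennreal_times_divide)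
  then have "(\<integral>\<^sup>+s. ennreal (relu s * relu s) \<partial>\<gamma>) = 1 / 2"
    by (subst (asm) ennreal_mult_cancel_left) simp
  also have "\<dots> = ennreal (1 / 2)"
    using divide_ennreal [of 1 2] by simp
  finally show ?thesis .
qed

text \<open>The arc-cosine kernel of order one. Replacing the second variable by its slope
  \<open>t\<close> relative to the first separates the variables, since the rectifier is
  homogeneous. The separated integral assumes \<open>sin \<theta> > 0\<close>; at the angles 0 and
  \<open>pi\<close> the second variable drops out and the value is immediate.\<close>

lemma arccos_kernel:
  assumes \<theta>: "0 \<le> \<theta>" "\<theta> \<le> pi"
  shows "(\<integral>\<^sup>+s. \<integral>\<^sup>+t. ennreal (relu s * relu (cos \<theta> * s + sin \<theta> * t)) \<partial>\<gamma> \<partial>\<gamma>) =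
    ennreal ((sin \<theta> + (pi - \<theta>) * cos \<theta>) / (2 * pi))"
proof (cases "sin \<theta> = 0")
  case True
  then have "\<theta> = 0 \<or> \<theta> = pi"
    using \<theta> sin_gt_zero [of \<theta>] by fastforce
  moreover have z: "relu s * relu (- s) = 0" for s by (simp add: relu_def max_def)
  ultimately show ?thesis
    by (auto simp: z simp del: mult_eq_0_iff simp: nn_integral_relu_sq std_gaussian.emeasure_space_1 [simplified])
next
  case False
  then have s: "0 < sin \<theta>" using sin_ge_zero [OF \<theta>] by linarith
  let ?d = "normal_density 0 1"
  let ?K = "\<lambda>t. relu (cos \<theta> + sin \<theta> * t)"
  have "(\<integral>\<^sup>+s. \<integral>\<^sup>+t. ennreal (relu s * relu (cos \<theta> * s + sin \<theta> * t)) \<partial>\<gamma> \<partial>\<gamma>) =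
      (\<integral>\<^sup>+s. \<integral>\<^sup>+t. ennreal (?d s * ?d t) * ennreal (relu s * relu (cos \<theta> * s + sin \<theta> * t)) \<partial>lborel \<partial>lborel)"
    by (rule nn_integral_std_gaussian2) measurable
  also have "\<dots> = (\<integral>\<^sup>+s. \<integral>\<^sup>+t. ennreal (?K t / (2 * pi)) *
      (ennreal (s^3 * exp (- (1 + t\<^sup>2) * s\<^sup>2 / 2)) * indicator {0..} s) \<partial>lborel \<partial>lborel)"
  proof (rule nn_integral_cong)
    fix s :: real
    show "(\<integral>\<^sup>+t. ennreal (?d s * ?d t) * ennreal (relu s * relu (cos \<theta> * s + sin \<theta> * t)) \<partial>lborel) =
      (\<integral>\<^sup>+t. ennreal (?K t / (2 * pi)) * (ennreal (s^3 * exp (- (1 + t\<^sup>2) * s\<^sup>2 / 2)) * indicator {0..} s) \<partial>lborel)"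
    proof (cases "s > 0")
      case False
      then have "relu s = 0" "s^3 * indicator {0..} s = 0" by (auto simp: relu_def indicator_def)
      then show ?thesis using False by (auto simp: indicator_def)
    next
      \<comment> \<open>Three factors \<open>s\<close> are collected: the Jacobian of
        \<open>t\<close> to \<open>s * t\<close>, the value \<open>relu s\<close>, and the
        homogeneity of the second rectifier.\<close>
      case True
      have "(\<integral>\<^sup>+t. ennreal (?d s * ?d t) * ennreal (relu s * relu (cos \<theta> * s + sin \<theta> * t)) \<partial>lborel) =
        ennreal \<bar>s\<bar> * (\<integral>\<^sup>+t. ennreal (?d s * ?d (0 + s * t)) * ennreal (relu s * relu (cos \<theta> * s + sin \<theta> * (0 + s * t))) \<partial>lborel)"
        using True by (intro nn_integral_real_affine) auto
      also have "\<dots> = (\<integral>\<^sup>+t. ennreal \<bar>s\<bar> * (ennreal (?d s * ?d (0 + s * t)) * ennreal (relu s * relu (cos \<theta> * s + sin \<theta> * (0 + s * t)))) \<partial>lborel)"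
        by (rule nn_integral_cmult [symmetric]) measurable
      also have "\<dots> = (\<integral>\<^sup>+t. ennreal (?K t / (2 * pi)) * (ennreal (s^3 * exp (- (1 + t\<^sup>2) * s\<^sup>2 / 2)) * indicator {0..} s) \<partial>lborel)"
      proof (intro nn_integral_cong)
        fix t :: real
        have r: "relu (cos \<theta> * s + sin \<theta> * (0 + s * t)) = s * ?K t" "relu s = s"
          using True relu_mult [of s "cos \<theta> + sin \<theta> * t"] by (simp_all add: algebra_simps relu_def)
        have e: "?d s * ?d (0 + s * t) = exp (- (1 + t\<^sup>2) * s\<^sup>2 / 2) / (2 * pi)"
          by (simp add: normal_density_def mult_exp_exp) (simp add: algebra_simps power2_eq_square add_divide_distrib diff_divide_distrib)
        have "\<bar>s\<bar> * ((?d s * ?d (0 + s * t)) * (relu s * relu (cos \<theta> * s + sin \<theta> * (0 + s * t)))) =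
            ?K t / (2 * pi) * (s^3 * exp (- (1 + t\<^sup>2) * s\<^sup>2 / 2))"
          unfolding r e using True by (simp add: power3_eq_cube)
        then show "ennreal \<bar>s\<bar> * (ennreal (?d s * ?d (0 + s * t)) * ennreal (relu s * relu (cos \<theta> * s + sin \<theta> * (0 + s * t)))) =
            ennreal (?K t / (2 * pi)) * (ennreal (s^3 * exp (- (1 + t\<^sup>2) * s\<^sup>2 / 2)) * indicator {0..} s)"
          using True by (simp add: ennreal_mult [symmetric])
      qed
      finally show ?thesis .
    qed
  qed
  also have "\<dots> = (\<integral>\<^sup>+t. \<integral>\<^sup>+s. ennreal (?K t / (2 * pi)) *
      (ennreal (s^3 * exp (- (1 + t\<^sup>2) * s\<^sup>2 / 2)) * indicator {0..} s) \<partial>lborel \<partial>lborel)"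
    by (rule lborel_pair.Fubini') measurable
  also have "\<dots> = (\<integral>\<^sup>+t. ennreal (?K t / (1 + t\<^sup>2)\<^sup>2 / pi) \<partial>lborel)"
  proof (intro nn_integral_cong)
    fix t :: real
    have pos: "1 + t\<^sup>2 > 0" by (smt (verit) zero_le_power2)
    have "(\<integral>\<^sup>+s. ennreal (?K t / (2 * pi)) * (ennreal (s^3 * exp (- (1 + t\<^sup>2) * s\<^sup>2 / 2)) * indicator {0..} s) \<partial>lborel) =
        ennreal (?K t / (2 * pi)) * ennreal (2 / (1 + t\<^sup>2)\<^sup>2)"
      by (subst nn_integral_cmult) (simp_all only: nn_integral_cube_gaussian_tail [OF pos], measurable)
    also have "\<dots> = ennreal (?K t / (1 + t\<^sup>2)\<^sup>2 / pi)"
      by (simp add: ennreal_mult [symmetric] mult.commute)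
    finally show "(\<integral>\<^sup>+s. ennreal (?K t / (2 * pi)) * (ennreal (s^3 * exp (- (1 + t\<^sup>2) * s\<^sup>2 / 2)) * indicator {0..} s) \<partial>lborel)
      = ennreal (?K t / (1 + t\<^sup>2)\<^sup>2 / pi)" .
  qed
  also have "\<dots> = ennreal ((sin \<theta> + (pi - \<theta>) * cos \<theta>) / (2 * pi))"
    by (rule nn_integral_relu_cauchy [OF s \<theta>])
  finally show ?thesis .
qed

section \<open>Euclidean geometry and the kernel as an expectation\<close>

abbreviation diff_n :: "(nat \<Rightarrow> real) \<Rightarrow> (nat \<Rightarrow> real) \<Rightarrow> nat \<Rightarrow> real" where
  "diff_n x y \<equiv> \<lambda>i. x i - y i"

lemma norm_n_eq_L2_set: "norm_n n x = L2_set x {..<n}"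
  by (simp add: norm_n_def inner_n_def L2_set_def power2_eq_square)

lemma norm_n_nonneg [simp]: "0 \<le> norm_n n x"
  by (simp add: norm_n_eq_L2_set L2_set_nonneg)

lemma inner_n_self: "inner_n n x x = (norm_n n x)\<^sup>2"
  by (simp add: norm_n_def inner_n_def sum_nonneg)

lemma inner_n_Cauchy_Schwarz: "\<bar>inner_n n x y\<bar> \<le> norm_n n x * norm_n n y"
proof -
  have "\<bar>inner_n n x y\<bar> \<le> (\<Sum>i<n. \<bar>x i\<bar> * \<bar>y i\<bar>)"
    unfolding inner_n_def by (rule order_trans [OF sum_abs]) (simp add: abs_mult)
  also have "\<dots> \<le> norm_n n x * norm_n n y"
    unfolding norm_n_eq_L2_set by (rule L2_set_mult_ineq)
  finally show ?thesis .
qed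

lemma inner_n_diff_right: "inner_n n g (diff_n x y) = inner_n n g x - inner_n n g y"
  by (simp add: inner_n_def right_diff_distrib sum_subtractf)

lemma norm_n_triangle_diff: "norm_n n (diff_n x z) \<le> norm_n n (diff_n x y) + norm_n n (diff_n y z)"
  using L2_set_triangle_ineq [of "diff_n x y" "diff_n y z" "{..<n}"] by (simp add: norm_n_eq_L2_set)

lemma norm_n_diff_commute: "norm_n n (diff_n x y) = norm_n n (diff_n y x)"
  by (simp add: norm_n_eq_L2_set L2_set_def power2_commute)

lemma norm_n_triangle: "norm_n n x \<le> norm_n n y + norm_n n (diff_n x y)"
  using norm_n_triangle_diff [of n x "\<lambda>_. 0" y] by simp

lemma gaussian_vector_univariate:
  assumes [measurable]: "h \<in> borel_measurable borel"
  shows "(\<integral>\<^sup>+g. h (inner_n n g x) \<partial>gaussian_vector n) = (\<integral>\<^sup>+s. h (norm_n n x * s) \<partial>\<gamma>)"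
proof -
  obtain a where a: "0 \<le> a" "a\<^sup>2 = inner_n n x x"
    and law: "\<And>\<Psi>::real \<Rightarrow> real \<Rightarrow> ennreal. case_prod \<Psi> \<in> borel_measurable (borel \<Otimes>\<^sub>M borel) \<Longrightarrow>
      \<exists>b c. (\<integral>\<^sup>+g. \<Psi> (inner_n n g x) (inner_n n g x) \<partial>gaussian_vector n) =
      (\<integral>\<^sup>+s. \<integral>\<^sup>+t. \<Psi> (a * s) (b * s + c * t) \<partial>\<gamma> \<partial>\<gamma>)"
    using gaussian_vector_bivariate [of n x x] by blast
  have "a = norm_n n x"
    using a by (metis inner_n_self norm_n_nonneg power2_eq_imp_eq)
  then show ?thesis
    using law [of "\<lambda>s _. h s"] by (simp add: std_gaussian.emeasure_space_1 [simplified])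
qed

text \<open>The limit of the empirical averages: \<open>cos \<theta> + psi\<close> equals
  \<open>(sin \<theta> + (pi - \<theta>) * cos \<theta>) / pi\<close>, so this is the value in
  \<open>arccos_kernel\<close> scaled by both norms.\<close>

definition relu_kernel :: "nat \<Rightarrow> (nat \<Rightarrow> real) \<Rightarrow> (nat \<Rightarrow> real) \<Rightarrow> real" where
  "relu_kernel n x y = norm_n n x * norm_n n y * (cos (angle_n n x y) + psi n x y) / 2"

text \<open>In polar form the second Cholesky row \<open>(b, c)\<close> has radius
  \<open>norm_n n y\<close> and angle \<open>angle_n n x y\<close>, because \<open>a * b\<close> is
  the inner product and \<open>a\<close> the norm of \<open>x\<close>. Homogeneity of the rectifier
  pulls out both norms and leaves \<open>arccos_kernel\<close>.\<close>

lemma nn_integral_relu_kernel: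
  assumes "norm_n n x \<noteq> 0" "norm_n n y \<noteq> 0"
  shows "(\<integral>\<^sup>+g. ennreal (relu (inner_n n g x) * relu (inner_n n g y)) \<partial>gaussian_vector n) =
    ennreal (relu_kernel n x y)"
    and relu_kernel_nonneg: "0 \<le> relu_kernel n x y"
proof -
  obtain a b c where a: "0 \<le> a" "0 \<le> c" "a\<^sup>2 = inner_n n x x" "a * b = inner_n n x y" "b\<^sup>2 + c\<^sup>2 = inner_n n y y"
    and law: "\<And>\<Psi>::real \<Rightarrow> real \<Rightarrow> ennreal. case_prod \<Psi> \<in> borel_measurable (borel \<Otimes>\<^sub>M borel) \<Longrightarrow>
      (\<integral>\<^sup>+g. \<Psi> (inner_n n g x) (inner_n n g y) \<partial>gaussian_vector n) =
      (\<integral>\<^sup>+s. \<integral>\<^sup>+t. \<Psi> (a * s) (b * s + c * t) \<partial>\<gamma> \<partial>\<gamma>)"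
    using gaussian_vector_bivariate [of n x y] by blast
  define r \<theta> where "r = norm_n n y" and "\<theta> = angle_n n x y"
  have r: "r > 0" "r\<^sup>2 = b\<^sup>2 + c\<^sup>2" using assms a(5) by (simp_all add: r_def inner_n_self order_less_le)
  have ax: "a = norm_n n x"
    using a by (metis inner_n_self norm_n_nonneg power2_eq_imp_eq)
  have "b\<^sup>2 \<le> r\<^sup>2" using r by simp
  then have "\<bar>b\<bar> \<le> r" using r abs_le_square_iff [of b r] by simp
  then have br: "\<bar>b / r\<bar> \<le> 1" using r by simp
  have th: "\<theta> = arccos (b / r)"
    unfolding \<theta>_def angle_n_def a(4) [symmetric] using assms by (simp add: ax r_def)
  have "-1 \<le> b / r" "b / r \<le> 1" using br by linarith+
  then have \<theta>: "0 \<le> \<theta>" "\<theta> \<le> pi"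
    unfolding th by (rule arccos_lbound, rule arccos_ubound)
  have "cos \<theta> = b / r" unfolding th by (rule cos_arccos_abs [OF br])
  then have cos: "b = r * cos \<theta>" using r(1) by simp
  have "c\<^sup>2 = (r * sin \<theta>)\<^sup>2"
  proof -
    have "c\<^sup>2 = r\<^sup>2 * (1 - (cos \<theta>)\<^sup>2)"
      using r(2) unfolding cos by (simp add: power_mult_distrib right_diff_distrib)
    then show ?thesis by (simp add: power_mult_distrib sin_squared_eq)
  qed
  then have sin: "c = r * sin \<theta>"
    by (rule power2_eq_imp_eq) (use a(2) r(1) sin_ge_zero [OF \<theta>] in auto)
  have val: "a * r * ((sin \<theta> + (pi - \<theta>) * cos \<theta>) / (2 * pi)) = relu_kernel n x y"
  proof -
    show ?thesis
      unfolding relu_kernel_def psi_def \<theta>_def [symmetric] r_def [symmetric] ax [symmetric]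
      by (simp add: field_simps)
  qed
  \<comment> \<open>With \<open>u = pi - \<theta>\<close> this is \<open>sin u - u * cos u\<close>,
    which vanishes at 0 and has derivative \<open>u * sin u\<close>.\<close>
  have pos: "0 \<le> sin \<theta> + (pi - \<theta>) * cos \<theta>"
  proof -
    have "sin 0 - 0 * cos 0 \<le> sin (pi - \<theta>) - (pi - \<theta>) * cos (pi - \<theta>)"
    proof (rule DERIV_nonneg_imp_nondecreasing [where f = "\<lambda>u. sin u - u * cos u"])
      fix u assume "0 \<le> u" "u \<le> pi - \<theta>"
      moreover have "DERIV (\<lambda>u. sin u - u * cos u) u :> u * sin u"
        by (auto intro!: derivative_eq_intros)
      ultimately show "\<exists>y. DERIV (\<lambda>u. sin u - u * cos u) u :> y \<and> 0 \<le> y"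
        using \<theta>(1) sin_ge_zero [of u] by (intro exI [of _ "u * sin u"]) auto
    qed (use \<theta> in simp)
    then show ?thesis by simp
  qed
  show "0 \<le> relu_kernel n x y"
    unfolding val [symmetric] using pos a(1) r(1) by simp
  have "(\<integral>\<^sup>+g. ennreal (relu (inner_n n g x) * relu (inner_n n g y)) \<partial>gaussian_vector n) =
      (\<integral>\<^sup>+s. \<integral>\<^sup>+t. ennreal (relu (a * s) * relu (b * s + c * t)) \<partial>\<gamma> \<partial>\<gamma>)"
    by (rule law [of "\<lambda>s t. ennreal (relu s * relu t)"]) measurable
  also have "\<dots> = (\<integral>\<^sup>+s. \<integral>\<^sup>+t. ennreal (a * r) * ennreal (relu s * relu (cos \<theta> * s + sin \<theta> * t)) \<partial>\<gamma> \<partial>\<gamma>)"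
  proof (intro nn_integral_cong)
    fix s t :: real
    have "relu (b * s + c * t) = r * relu (cos \<theta> * s + sin \<theta> * t)"
      using relu_mult [of r "cos \<theta> * s + sin \<theta> * t"] r(1) by (simp add: cos sin algebra_simps)
    then have "relu (a * s) * relu (b * s + c * t) = a * r * (relu s * relu (cos \<theta> * s + sin \<theta> * t))"
      by (simp add: relu_mult a(1))
    then show "ennreal (relu (a * s) * relu (b * s + c * t)) =
        ennreal (a * r) * ennreal (relu s * relu (cos \<theta> * s + sin \<theta> * t))"
      using a(1) r(1) by (simp add: ennreal_mult)
  qed
  also have "\<dots> = ennreal (a * r) * (\<integral>\<^sup>+s. \<integral>\<^sup>+t. ennreal (relu s * relu (cos \<theta> * s + sin \<theta> * t)) \<partial>\<gamma> \<partial>\<gamma>)"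
    by (simp add: nn_integral_cmult)
  also have "\<dots> = ennreal (a * r * ((sin \<theta> + (pi - \<theta>) * cos \<theta>) / (2 * pi)))"
    unfolding arccos_kernel [OF \<theta>] using a(1) r(1) pos by (subst ennreal_mult) auto
  finally show "(\<integral>\<^sup>+g. ennreal (relu (inner_n n g x) * relu (inner_n n g y)) \<partial>gaussian_vector n) =
    ennreal (relu_kernel n x y)" unfolding val .
qed

lemma has_bochner_integral_relu_kernel:
  assumes "norm_n n x \<noteq> 0" "norm_n n y \<noteq> 0"
  shows "has_bochner_integral (gaussian_vector n) (\<lambda>g. relu (inner_n n g x) * relu (inner_n n g y)) (relu_kernel n x y)"
  using nn_integral_relu_kernel [OF assms] relu_kernel_nonneg [OF assms]
  by (intro has_bochner_integral_nn_integral) auto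

lemma relu_kernel_self:
  assumes "norm_n n x \<noteq> 0"
  shows "relu_kernel n x x = (norm_n n x)\<^sup>2 / 2"
  using assms by (simp add: relu_kernel_def angle_n_def psi_def inner_n_self power2_eq_square)

lemma has_bochner_integral_inner_n_sq:
  "has_bochner_integral (gaussian_vector n) (\<lambda>g. (inner_n n g x)\<^sup>2) ((norm_n n x)\<^sup>2)"
proof (rule has_bochner_integral_nn_integral)
  have "(\<integral>\<^sup>+g. ennreal ((inner_n n g x)\<^sup>2) \<partial>gaussian_vector n) = (\<integral>\<^sup>+s. ennreal ((norm_n n x * s)\<^sup>2) \<partial>\<gamma>)"
    by (rule gaussian_vector_univariate [where h = "\<lambda>t. ennreal (t\<^sup>2)"]) measurable
  also have "\<dots> = ennreal ((norm_n n x)\<^sup>2)"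
    by (simp add: power_mult_distrib ennreal_mult nn_integral_cmult nn_integral_std_gaussian_sq)
  finally show "(\<integral>\<^sup>+g. ennreal ((inner_n n g x)\<^sup>2) \<partial>gaussian_vector n) = ennreal ((norm_n n x)\<^sup>2)" .
qed auto

lemma mult_squares_bound: "\<bar>a\<bar> * \<bar>b\<bar> \<le> a\<^sup>2 + b\<^sup>2" for a b :: real
proof -
  have "0 \<le> (\<bar>a\<bar> - \<bar>b\<bar>)\<^sup>2" by simp
  then have "2 * (\<bar>a\<bar> * \<bar>b\<bar>) \<le> a\<^sup>2 + b\<^sup>2" by (simp add: power2_diff)
  moreover have "0 \<le> \<bar>a\<bar> * \<bar>b\<bar>" by simp
  ultimately show ?thesis by linarith
qed

lemma integrable_inner_n_prod:
  "integrable (gaussian_vector n) (\<lambda>g. \<bar>inner_n n g x\<bar> * \<bar>inner_n n g y\<bar>)"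
proof (rule Bochner_Integration.integrable_bound)
  show "integrable (gaussian_vector n) (\<lambda>g. (inner_n n g x)\<^sup>2 + (inner_n n g y)\<^sup>2)"
    using has_bochner_integral_inner_n_sq [of n] by (simp add: has_bochner_integral_iff)
  show "AE g in gaussian_vector n. norm (\<bar>inner_n n g x\<bar> * \<bar>inner_n n g y\<bar>) \<le> norm ((inner_n n g x)\<^sup>2 + (inner_n n g y)\<^sup>2)"
  proof (rule AE_I2)
    fix g
    show "norm (\<bar>inner_n n g x\<bar> * \<bar>inner_n n g y\<bar>) \<le> norm ((inner_n n g x)\<^sup>2 + (inner_n n g y)\<^sup>2)"
      using mult_squares_bound [of "inner_n n g x" "inner_n n g y"] by (simp add: abs_mult)
  qed
qed measurable

text \<open>Cauchy-Schwarz for expectations, from the weighted inequality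
  \<open>2 u v \<le> s u\<^sup>2 + v\<^sup>2 / s\<close>. The optimal weight is the quotient of the
  norms; adding \<open>e\<close> to both keeps it defined and positive when a norm vanishes, and
  \<open>e\<close> then tends to 0.\<close>

lemma expectation_inner_n_prod_le:
  "(LINT g|gaussian_vector n. \<bar>inner_n n g x\<bar> * \<bar>inner_n n g y\<bar>) \<le> norm_n n x * norm_n n y"
proof -
  note int = has_bochner_integral_inner_n_sq [of n, unfolded has_bochner_integral_iff]
  define p q where "p = norm_n n x" and "q = norm_n n y"
  have pq: "0 \<le> p" "0 \<le> q" by (simp_all add: p_def q_def)
  have bound: "(LINT g|gaussian_vector n. \<bar>inner_n n g x\<bar> * \<bar>inner_n n g y\<bar>) \<le> (p + e) * (q + e)"
    if e: "0 < e" for e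
  proof -
    define s where "s = (q + e) / (p + e)"
    have s: "s > 0" using e pq by (simp add: s_def)
    have "(LINT g|gaussian_vector n. \<bar>inner_n n g x\<bar> * \<bar>inner_n n g y\<bar>) \<le>
        (LINT g|gaussian_vector n. (s * (inner_n n g x)\<^sup>2 + (inner_n n g y)\<^sup>2 / s) / 2)"
    proof (rule integral_mono)
      show "integrable (gaussian_vector n) (\<lambda>g. (s * (inner_n n g x)\<^sup>2 + (inner_n n g y)\<^sup>2 / s) / 2)"
        using int by simp
      fix g
      let ?u = "\<bar>inner_n n g x\<bar>" and ?v = "\<bar>inner_n n g y\<bar>"
      have "0 \<le> (s * ?u - ?v)\<^sup>2 / s" using s by simp
      also have "\<dots> = s * ?u\<^sup>2 + ?v\<^sup>2 / s - 2 * (?u * ?v)"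
        using s by (simp add: power2_diff field_simps power2_eq_square)
      finally show "?u * ?v \<le> (s * (inner_n n g x)\<^sup>2 + (inner_n n g y)\<^sup>2 / s) / 2" by simp
    qed (rule integrable_inner_n_prod)
    also have "\<dots> = (s * p\<^sup>2 + q\<^sup>2 / s) / 2"
      using int by (simp add: p_def q_def)
    also have "\<dots> \<le> (s * (p + e)\<^sup>2 + (q + e)\<^sup>2 / s) / 2"
      using s e pq by (intro divide_right_mono add_mono mult_left_mono power_mono) auto
    also have "\<dots> = (p + e) * (q + e)"
      using e pq by (simp add: s_def power2_eq_square)
    finally show ?thesis .
  qed
  have "((\<lambda>e. (p + e) * (q + e)) \<longlongrightarrow> (p + 0) * (q + 0)) (at_right 0)"
    by (intro tendsto_intros)
  then have "(LINT g|gaussian_vector n. \<bar>inner_n n g x\<bar> * \<bar>inner_n n g y\<bar>) \<le> (p + 0) * (q + 0)"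
  proof (rule tendsto_lowerbound)
    show "\<forall>\<^sub>F e in at_right 0. (LINT g|gaussian_vector n. \<bar>inner_n n g x\<bar> * \<bar>inner_n n g y\<bar>) \<le> (p + e) * (q + e)"
      using eventually_at_right_less [of 0] by eventually_elim (rule bound)
  qed simp
  then show ?thesis by (simp add: p_def q_def)
qed

lemma relu_lipschitz: "\<bar>relu s - relu t\<bar> \<le> \<bar>s - t\<bar>"
  by (simp add: relu_def max_def)

lemma relu_le_abs: "relu t \<le> \<bar>t\<bar>"
  by (simp add: relu_def)

text \<open>Read off from the expectation and not from the formula with angles, since
  \<open>arccos\<close> is not Lipschitz at the ends of its domain.\<close>

lemma relu_kernel_lipschitz:
  assumes nz: "norm_n n x \<noteq> 0" "norm_n n y \<noteq> 0" "norm_n n x' \<noteq> 0" "norm_n n y' \<noteq> 0"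
  shows "\<bar>relu_kernel n x y - relu_kernel n x' y'\<bar> \<le>
    norm_n n (diff_n x x') * norm_n n y + norm_n n x' * norm_n n (diff_n y y')"
proof -
  note int = has_bochner_integral_relu_kernel [unfolded has_bochner_integral_iff]
  let ?Z = "\<lambda>x y g. relu (inner_n n g x) * relu (inner_n n g y)"
  let ?B = "\<lambda>x y g. \<bar>inner_n n g x\<bar> * \<bar>inner_n n g y\<bar>"
  have "\<bar>relu_kernel n x y - relu_kernel n x' y'\<bar> = \<bar>LINT g|gaussian_vector n. ?Z x y g - ?Z x' y' g\<bar>"
    using int nz by simp
  also have "\<dots> \<le> (LINT g|gaussian_vector n. \<bar>?Z x y g - ?Z x' y' g\<bar>)"
    by (rule integral_abs_bound)
  also have "\<dots> \<le> (LINT g|gaussian_vector n. ?B (diff_n x x') y g + ?B x' (diff_n y y') g)"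
  proof (rule integral_mono)
    show "integrable (gaussian_vector n) (\<lambda>g. \<bar>?Z x y g - ?Z x' y' g\<bar>)"
      by (intro Bochner_Integration.integrable_abs Bochner_Integration.integrable_diff int [THEN conjunct1] nz)
    show "integrable (gaussian_vector n) (\<lambda>g. ?B (diff_n x x') y g + ?B x' (diff_n y y') g)"
      by (intro Bochner_Integration.integrable_add integrable_inner_n_prod)
    fix g
    let ?a = "relu (inner_n n g x)" and ?b = "relu (inner_n n g y)"
      and ?a' = "relu (inner_n n g x')" and ?b' = "relu (inner_n n g y')"
    have "\<bar>?Z x y g - ?Z x' y' g\<bar> = \<bar>(?a - ?a') * ?b + ?a' * (?b - ?b')\<bar>" by (simp add: algebra_simps)
    also have "\<dots> \<le> \<bar>?a - ?a'\<bar> * \<bar>?b\<bar> + \<bar>?a'\<bar> * \<bar>?b - ?b'\<bar>"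
      by (rule order_trans [OF abs_triangle_ineq]) (simp add: abs_mult)
    also have "\<dots> \<le> ?B (diff_n x x') y g + ?B x' (diff_n y y') g"
      unfolding inner_n_diff_right
      by (intro add_mono mult_mono relu_lipschitz) (simp_all add: relu_le_abs)
    finally show "\<bar>?Z x y g - ?Z x' y' g\<bar> \<le> ?B (diff_n x x') y g + ?B x' (diff_n y y') g" .
  qed
  also have "\<dots> = (LINT g|gaussian_vector n. ?B (diff_n x x') y g) + (LINT g|gaussian_vector n. ?B x' (diff_n y y') g)"
    by (intro Bochner_Integration.integral_add integrable_inner_n_prod)
  also have "\<dots> \<le> norm_n n (diff_n x x') * norm_n n y + norm_n n x' * norm_n n (diff_n y y')"
    by (intro add_mono expectation_inner_n_prod_le)
  finally show ?thesis .
qed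

section \<open>Exponential moments of Gaussian linear forms\<close>

lemma nn_integral_exp_sq_quarter: "(\<integral>\<^sup>+s. ennreal (exp (s\<^sup>2 / 4)) \<partial>\<gamma>) = ennreal (sqrt 2)"
proof -
  \<comment> \<open>The tilted density is, up to its normalisation, the normal density of variance
    2.\<close>
  have "normal_density 0 1 s * exp (s\<^sup>2 / 4) = sqrt 2 * normal_density 0 (sqrt 2) s" for s
    by (simp add: normal_density_def mult_exp_exp real_sqrt_mult field_simps)
  then have "(\<integral>\<^sup>+s. ennreal (exp (s\<^sup>2 / 4)) \<partial>\<gamma>) = (\<integral>\<^sup>+s. ennreal (sqrt 2) * ennreal (normal_density 0 (sqrt 2) s) \<partial>lborel)"
    by (subst nn_integral_std_gaussian) (auto simp: ennreal_mult [symmetric])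
  also have "\<dots> = ennreal (sqrt 2)"
    using prob_space.emeasure_space_1 [OF prob_space_normal_density [of "sqrt 2" 0]]
    by (simp add: nn_integral_cmult emeasure_density)
  finally show ?thesis .
qed

lemma nn_integral_exp_inner_n_sq:
  assumes "norm_n n x \<le> 1"
  shows "(\<integral>\<^sup>+g. ennreal (exp ((inner_n n g x)\<^sup>2 / 4)) \<partial>gaussian_vector n) \<le> ennreal (sqrt 2)"
proof -
  have "(\<integral>\<^sup>+g. ennreal (exp ((inner_n n g x)\<^sup>2 / 4)) \<partial>gaussian_vector n) =
      (\<integral>\<^sup>+s. ennreal (exp ((norm_n n x * s)\<^sup>2 / 4)) \<partial>\<gamma>)"
    by (rule gaussian_vector_univariate [where h = "\<lambda>t. ennreal (exp (t\<^sup>2 / 4))"]) measurable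
  also have "\<dots> \<le> (\<integral>\<^sup>+s. ennreal (exp (s\<^sup>2 / 4)) \<partial>\<gamma>)"
    using assms by (intro nn_integral_mono ennreal_leI)
      (simp add: power_mult_distrib mult_left_le_one_le power_le_one)
  finally show ?thesis by (simp add: nn_integral_exp_sq_quarter)
qed

text \<open>The shift formula for the constant function 1.\<close>

lemma nn_integral_exp_inner_n:
  "(\<integral>\<^sup>+g. ennreal (exp (inner_n n g v)) \<partial>gaussian_vector n) = ennreal (exp ((norm_n n v)\<^sup>2 / 2))"
proof -
  have "1 = (\<integral>\<^sup>+X. 1 * ennreal (exp (inner_n n X v - inner_n n v v / 2)) \<partial>gaussian_vector n)"
    using gaussian_vector_shift [of "\<lambda>_. 1" n v] by (simp add: gaussian_vector.emeasure_space_1)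
  then have "ennreal (exp ((norm_n n v)\<^sup>2 / 2)) * 1 = (\<integral>\<^sup>+X. ennreal (exp ((norm_n n v)\<^sup>2 / 2)) * ennreal (exp (inner_n n X v - inner_n n v v / 2)) \<partial>gaussian_vector n)"
    by (subst nn_integral_cmult) simp_all
  also have "\<dots> = (\<integral>\<^sup>+g. ennreal (exp (inner_n n g v)) \<partial>gaussian_vector n)"
    by (simp add: ennreal_mult [symmetric] mult_exp_exp inner_n_self)
  finally show ?thesis by simp
qed

section \<open>Concentration for a single pair of points\<close>

lemma exp_Markov_inequality:
  assumes [measurable]: "f \<in> borel_measurable M"
  shows "emeasure M {x \<in> space M. a \<le> f x} \<le> ennreal (exp (- a)) * (\<integral>\<^sup>+x. ennreal (exp (f x)) \<partial>M)"
proof -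
  have "a \<le> f x \<longleftrightarrow> 1 \<le> ennreal (exp (- a)) * ennreal (exp (f x))" for x
    by (simp add: ennreal_mult [symmetric] mult_exp_exp flip: ennreal_1)
  then have "emeasure M {x \<in> space M. a \<le> f x} = emeasure M {x \<in> space M. 1 \<le> ennreal (exp (- a)) * ennreal (exp (f x))}"
    by simp
  also have "\<dots> \<le> ennreal (exp (- a)) * (\<integral>\<^sup>+x. ennreal (exp (f x)) * indicator (space M) x \<partial>M)"
    by (rule nn_integral_Markov_inequality) measurable
  also have "(\<integral>\<^sup>+x. ennreal (exp (f x)) * indicator (space M) x \<partial>M) = (\<integral>\<^sup>+x. ennreal (exp (f x)) \<partial>M)"
    by (rule nn_integral_cong) simp
  finally show ?thesis .
qed

text \<open>A product of products, so that independence of the rows is built in and sums over rows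
  have factorising exponential moments. \<open>distr_rows_of\<close> relates this to the measure
  indexed by pairs.\<close>

definition gaussian_rows :: "nat \<Rightarrow> nat \<Rightarrow> (nat \<Rightarrow> nat \<Rightarrow> real) measure" where
  "gaussian_rows m n = PiM {..<m} (\<lambda>_. gaussian_vector n)"

lemma prob_space_gaussian_rows: "prob_space (gaussian_rows m n)"
  unfolding gaussian_rows_def by (intro prob_space_PiM prob_space_gaussian_vector)

interpretation gaussian_rows: prob_space "gaussian_rows m n" for m n
  by (rule prob_space_gaussian_rows)

interpretation gaussian_vector_prod: product_sigma_finite "\<lambda>_. gaussian_vector n" for n
  by (rule product_sigma_finite.intro) (rule gaussian_vector.sigma_finite_measure_axioms)

lemma measurable_gaussian_rows_component:
  "i < m \<Longrightarrow> (\<lambda>G. G i) \<in> gaussian_rows m n \<rightarrow>\<^sub>M gaussian_vector n"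
  unfolding gaussian_rows_def by (rule measurable_component_singleton) simp

text \<open>Products of Gaussians have exponential moments only near 0, so the second-order Taylor
  remainder is absorbed into \<open>exp (z / 4)\<close>, whose mean is controlled: one factor
  \<open>exp (z / 8)\<close> bounds the remainder's exponential and another bounds
  \<open>z\<^sup>2 / 128\<close>.\<close>

lemma exp_le_quadratic:
  fixes s z :: real
  assumes "\<bar>s\<bar> \<le> 1 / 8" "0 \<le> z"
  shows "exp (s * z) \<le> 1 + s * z + 64 * s\<^sup>2 * exp (z / 4)"
proof -
  obtain t where t: "\<bar>t\<bar> \<le> \<bar>s * z\<bar>" "exp (s * z) = (\<Sum>m<2. (s * z) ^ m / fact m) + exp t / fact 2 * (s * z)\<^sup>2"
    using Maclaurin_exp_le [of "s * z" 2] by blast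
  have sum: "(\<Sum>m<2. (s * z) ^ m / fact m) = 1 + s * z"
    by (simp add: numeral_2_eq_2)
  have "\<bar>s * z\<bar> \<le> z / 8"
    using mult_right_mono [OF assms(1), of z] assms(2) by (simp add: abs_mult)
  then have et: "exp t \<le> exp (z / 8)" using t(1) by simp
  have "(z / 8)\<^sup>2 / 2 \<le> exp (z / 8)"
    using exp_lower_Taylor_quadratic [of "z / 8"] assms(2) by simp
  then have "z\<^sup>2 / 2 \<le> 64 * exp (z / 8)" by (simp add: power_divide)
  then have "s\<^sup>2 * (exp t * (z\<^sup>2 / 2)) \<le> s\<^sup>2 * (exp (z / 8) * (64 * exp (z / 8)))"
    using et by (intro mult_left_mono mult_mono) auto
  also have "\<dots> = 64 * s\<^sup>2 * exp (z / 4)"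
    by (simp add: mult_exp_exp)
  finally show ?thesis
    unfolding t(2) sum by (simp add: power_mult_distrib fact_numeral mult_ac)
qed

text \<open>The inequality of arithmetic and geometric means is used twice, in the exponent and on
  the exponentials, and reduces the pair to single linear forms; no joint law is involved.\<close>

lemma nn_integral_exp_relu_prod:
  assumes "norm_n n x \<le> 1" "norm_n n y \<le> 1"
  shows "(\<integral>\<^sup>+g. ennreal (exp (relu (inner_n n g x) * relu (inner_n n g y) / 4)) \<partial>gaussian_vector n) \<le> ennreal (3 / 2)"
proof -
  have "(\<integral>\<^sup>+g. ennreal (exp (relu (inner_n n g x) * relu (inner_n n g y) / 4)) \<partial>gaussian_vector n) \<le>
    (\<integral>\<^sup>+g. ennreal (1 / 2) * ennreal (exp ((inner_n n g x)\<^sup>2 / 4)) + ennreal (1 / 2) * ennreal (exp ((inner_n n g y)\<^sup>2 / 4))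
      \<partial>gaussian_vector n)"
  proof (rule nn_integral_mono)
    fix g
    define u v where "u = inner_n n g x" and "v = inner_n n g y"
    have "relu u * relu v \<le> \<bar>u\<bar> * \<bar>v\<bar>"
      by (intro mult_mono relu_le_abs) auto
    also have "\<dots> \<le> (u\<^sup>2 + v\<^sup>2) / 2"
      using sum_squares_bound [of "\<bar>u\<bar>" "\<bar>v\<bar>"] by simp
    finally have "exp (relu u * relu v / 4) \<le> exp ((u\<^sup>2 + v\<^sup>2) / 2 / 4)" by simp
    also have "\<dots> = exp (u\<^sup>2 / 8) * exp (v\<^sup>2 / 8)"
      by (simp add: mult_exp_exp add_divide_distrib)
    also have "\<dots> \<le> ((exp (u\<^sup>2 / 8))\<^sup>2 + (exp (v\<^sup>2 / 8))\<^sup>2) / 2"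
      using sum_squares_bound [of "exp (u\<^sup>2 / 8)" "exp (v\<^sup>2 / 8)"] by simp
    also have "\<dots> = 1 / 2 * exp (u\<^sup>2 / 4) + 1 / 2 * exp (v\<^sup>2 / 4)"
      by (simp add: exp_double [symmetric])
    finally have "ennreal (exp (relu u * relu v / 4)) \<le> ennreal (1 / 2 * exp (u\<^sup>2 / 4) + 1 / 2 * exp (v\<^sup>2 / 4))"
      by (rule ennreal_leI)
    also have "\<dots> = ennreal (1 / 2) * ennreal (exp (u\<^sup>2 / 4)) + ennreal (1 / 2) * ennreal (exp (v\<^sup>2 / 4))"
        by (subst ennreal_plus) (simp_all only: ennreal_mult mult_nonneg_nonneg exp_ge_zero zero_le_divide_1_iff zero_le_numeral)
    finally show "ennreal (exp (relu (inner_n n g x) * relu (inner_n n g y) / 4)) \<le>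
       ennreal (1 / 2) * ennreal (exp ((inner_n n g x)\<^sup>2 / 4)) + ennreal (1 / 2) * ennreal (exp ((inner_n n g y)\<^sup>2 / 4))"
      unfolding u_def v_def .
  qed
  also have "\<dots> = ennreal (1 / 2) * (\<integral>\<^sup>+g. ennreal (exp ((inner_n n g x)\<^sup>2 / 4)) \<partial>gaussian_vector n) +
      ennreal (1 / 2) * (\<integral>\<^sup>+g. ennreal (exp ((inner_n n g y)\<^sup>2 / 4)) \<partial>gaussian_vector n)"
    by (simp add: nn_integral_add nn_integral_cmult)
  also have "\<dots> \<le> ennreal (1 / 2) * ennreal (sqrt 2) + ennreal (1 / 2) * ennreal (sqrt 2)"
    by (intro add_mono mult_left_mono nn_integral_exp_inner_n_sq assms) auto
  also have "\<dots> = ennreal (1 / 2 * sqrt 2) + ennreal (1 / 2 * sqrt 2)"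
    by (simp only: ennreal_mult zero_le_divide_1_iff zero_le_numeral real_sqrt_ge_zero)
  also have "\<dots> = ennreal (1 / 2 * sqrt 2 + 1 / 2 * sqrt 2)"
    by (rule ennreal_plus [symmetric]) simp_all
  also have "\<dots> = ennreal (sqrt 2)" by simp
  also have "\<dots> \<le> ennreal (3 / 2)"
    by (intro ennreal_leI real_le_lsqrt) (auto simp: power2_eq_square)
  finally show ?thesis .
qed

text \<open>Subtracting the mean cancels the linear Taylor term, leaving
  \<open>64 * (3 / 2) = 96\<close> times \<open>s\<^sup>2\<close>.\<close>

lemma relu_prod_mgf:
  assumes x: "norm_n n x \<noteq> 0" "norm_n n x \<le> 1" and y: "norm_n n y \<noteq> 0" "norm_n n y \<le> 1" and s: "\<bar>s\<bar> \<le> 1 / 8"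
  shows "(\<integral>\<^sup>+g. ennreal (exp (s * (relu (inner_n n g x) * relu (inner_n n g y) - relu_kernel n x y))) \<partial>gaussian_vector n)
    \<le> ennreal (exp (96 * s\<^sup>2))"
proof -
  let ?Z = "\<lambda>g. relu (inner_n n g x) * relu (inner_n n g y)" and ?\<mu> = "relu_kernel n x y"
  let ?M = "gaussian_vector n"
  have Z: "integrable ?M ?Z" "(LINT g|?M. ?Z g) = ?\<mu>"
    using has_bochner_integral_relu_kernel [OF x(1) y(1)] by (simp_all add: has_bochner_integral_iff)
  have E: "integrable ?M (\<lambda>g. exp (?Z g / 4))"
    using nn_integral_exp_relu_prod [OF x(2) y(2)]
    by (intro integrableI_nonneg) (auto intro: le_less_trans)
  have "ennreal (LINT g|?M. exp (?Z g / 4)) \<le> ennreal (3 / 2)"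
    using nn_integral_exp_relu_prod [OF x(2) y(2)] by (subst nn_integral_eq_integral [OF E, symmetric]) auto
  then have E': "(LINT g|?M. exp (?Z g / 4)) \<le> 3 / 2"
    by (simp add: ennreal_le_iff)
  have "(\<integral>\<^sup>+g. ennreal (exp (s * ?Z g)) \<partial>?M) \<le> (\<integral>\<^sup>+g. ennreal (1 + s * ?Z g + 64 * s\<^sup>2 * exp (?Z g / 4)) \<partial>?M)"
    by (intro nn_integral_mono ennreal_leI exp_le_quadratic s) simp
  also have "\<dots> = ennreal (LINT g|?M. 1 + s * ?Z g + 64 * s\<^sup>2 * exp (?Z g / 4))"
  proof (rule nn_integral_eq_integral)
    show "integrable ?M (\<lambda>g. 1 + s * ?Z g + 64 * s\<^sup>2 * exp (?Z g / 4))"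
      by (intro Bochner_Integration.integrable_add integrable_mult_right Z(1) E) simp
    have "0 \<le> 1 + s * ?Z g + 64 * s\<^sup>2 * exp (?Z g / 4)" for g
      by (rule order_trans [OF exp_ge_zero exp_le_quadratic [OF s]]) simp
    then show "AE g in ?M. 0 \<le> 1 + s * ?Z g + 64 * s\<^sup>2 * exp (?Z g / 4)" by simp
  qed
  also have "(LINT g|?M. 1 + s * ?Z g + 64 * s\<^sup>2 * exp (?Z g / 4)) = 1 + s * ?\<mu> + 64 * s\<^sup>2 * (LINT g|?M. exp (?Z g / 4))"
    using Z E by (simp add: gaussian_vector.prob_space)
  also have "\<dots> \<le> 1 + (s * ?\<mu> + 96 * s\<^sup>2)"
    using mult_left_mono [OF E', of "64 * s\<^sup>2"] by simp
  also have "\<dots> \<le> exp (s * ?\<mu> + 96 * s\<^sup>2)"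
    by (rule exp_ge_add_one_self)
  finally have main: "(\<integral>\<^sup>+g. ennreal (exp (s * ?Z g)) \<partial>?M) \<le> ennreal (exp (s * ?\<mu> + 96 * s\<^sup>2))"
    by (simp add: ennreal_leI)
  have "(\<integral>\<^sup>+g. ennreal (exp (s * (?Z g - ?\<mu>))) \<partial>?M) = (\<integral>\<^sup>+g. ennreal (exp (- s * ?\<mu>)) * ennreal (exp (s * ?Z g)) \<partial>?M)"
    by (simp add: ennreal_mult [symmetric] mult_exp_exp right_diff_distrib)
  also have "\<dots> = ennreal (exp (- s * ?\<mu>)) * (\<integral>\<^sup>+g. ennreal (exp (s * ?Z g)) \<partial>?M)"
    by (rule nn_integral_cmult) measurable
  also have "\<dots> \<le> ennreal (exp (- s * ?\<mu>)) * ennreal (exp (s * ?\<mu> + 96 * s\<^sup>2))"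
    by (intro mult_left_mono main) simp
  also have "\<dots> = ennreal (exp (96 * s\<^sup>2))"
    by (simp add: ennreal_mult [symmetric] mult_exp_exp)
  finally show ?thesis .
qed

lemma gaussian_rows_mgf:
  assumes [measurable]: "f \<in> borel_measurable (gaussian_vector n)"
  shows "(\<integral>\<^sup>+G. ennreal (exp (\<Sum>i<m. f (G i))) \<partial>gaussian_rows m n) =
    (\<integral>\<^sup>+g. ennreal (exp (f g)) \<partial>gaussian_vector n) ^ m"
proof -
  have "(\<integral>\<^sup>+G. ennreal (exp (\<Sum>i<m. f (G i))) \<partial>gaussian_rows m n) =
      (\<integral>\<^sup>+G. (\<Prod>i<m. ennreal (exp (f (G i)))) \<partial>gaussian_rows m n)"
    by (simp add: exp_sum prod_ennreal)
  also have "\<dots> = (\<Prod>i<m. \<integral>\<^sup>+g. ennreal (exp (f g)) \<partial>gaussian_vector n)"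
    unfolding gaussian_rows_def by (rule gaussian_vector_prod.product_nn_integral_prod) auto
  finally show ?thesis by simp
qed

lemma measurable_relu_prod_rows [measurable]:
  "(\<lambda>G. \<Sum>i<m. relu (inner_n n (G i) x) * relu (inner_n n (G i) y)) \<in> borel_measurable (gaussian_rows m n)"
proof (rule borel_measurable_sum)
  fix i assume "i \<in> {..<m}"
  then have [measurable]: "(\<lambda>G. G i) \<in> gaussian_rows m n \<rightarrow>\<^sub>M gaussian_vector n"
    by (intro measurable_gaussian_rows_component) simp
  show "(\<lambda>G. relu (inner_n n (G i) x) * relu (inner_n n (G i) y)) \<in> borel_measurable (gaussian_rows m n)"
    by measurable
qed

text \<open>Chernoff's bound with \<open>s = t / 192\<close>, the minimiser of
  \<open>96 s\<^sup>2 - s t\<close>, where the value is \<open>- t\<^sup>2 / 384\<close>. Since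
  \<open>t \<le> 1\<close>, this choice lies in the range of \<open>relu_prod_mgf\<close>; both
  signs of \<open>s\<close> give the two tails.\<close>

lemma relu_prod_bernstein:
  assumes x: "norm_n n x \<noteq> 0" "norm_n n x \<le> 1" and y: "norm_n n y \<noteq> 0" "norm_n n y \<le> 1"
    and t: "0 < t" "t \<le> 1"
  shows "emeasure (gaussian_rows m n) {G \<in> space (gaussian_rows m n).
      t * real m \<le> \<bar>(\<Sum>i<m. relu (inner_n n (G i) x) * relu (inner_n n (G i) y)) - real m * relu_kernel n x y\<bar>}
    \<le> ennreal (2 * exp (- (t\<^sup>2 * real m / 384)))"
proof -
  let ?R = "gaussian_rows m n" and ?\<mu> = "relu_kernel n x y"
  let ?Z = "\<lambda>g. relu (inner_n n g x) * relu (inner_n n g y)"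
  let ?S = "\<lambda>G. (\<Sum>i<m. ?Z (G i)) - real m * ?\<mu>"
  have tail: "emeasure ?R {G \<in> space ?R. t * real m * (t / 192) \<le> s * ?S G} \<le> ennreal (exp (- (t\<^sup>2 * real m / 384)))"
    if s: "\<bar>s\<bar> = t / 192" for s
  proof -
    have "emeasure ?R {G \<in> space ?R. t * real m * (t / 192) \<le> s * ?S G} \<le>
        ennreal (exp (- (t * real m * (t / 192)))) * (\<integral>\<^sup>+G. ennreal (exp (s * ?S G)) \<partial>?R)"
      by (rule exp_Markov_inequality) measurable
    also have "(\<integral>\<^sup>+G. ennreal (exp (s * ?S G)) \<partial>?R) = (\<integral>\<^sup>+G. ennreal (exp (\<Sum>i<m. s * (?Z (G i) - ?\<mu>))) \<partial>?R)"
      by (intro nn_integral_cong) (simp add: sum_distrib_left [symmetric] sum_subtractf)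
    also have "\<dots> = (\<integral>\<^sup>+g. ennreal (exp (s * (?Z g - ?\<mu>))) \<partial>gaussian_vector n) ^ m"
      by (rule gaussian_rows_mgf) measurable
    also have "\<dots> \<le> ennreal (exp (96 * s\<^sup>2)) ^ m"
      using s t by (intro power_mono relu_prod_mgf x y) auto
    also have "\<dots> = ennreal (exp (real m * (96 * s\<^sup>2)))"
      by (simp add: ennreal_power exp_of_nat_mult)
    also have "ennreal (exp (- (t * real m * (t / 192)))) * \<dots> = ennreal (exp (- (t\<^sup>2 * real m / 384)))"
    proof -
      have "s\<^sup>2 = (t / 192)\<^sup>2" using s by (metis power2_abs)
      then have "96 * s\<^sup>2 = t\<^sup>2 / 384" by (simp add: power_divide)
      then have "- (t * real m * (t / 192)) + real m * (96 * s\<^sup>2) = - (t\<^sup>2 * real m / 384)"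
        by (simp only:) (simp add: power2_eq_square)
      then show ?thesis
        by (simp only: ennreal_mult [symmetric] mult_exp_exp exp_ge_zero)
    qed
    finally show ?thesis by (simp add: mult_left_mono)
  qed
  have "{G \<in> space ?R. t * real m \<le> \<bar>?S G\<bar>} \<subseteq>
      {G \<in> space ?R. t * real m * (t / 192) \<le> (t / 192) * ?S G} \<union> {G \<in> space ?R. t * real m * (t / 192) \<le> (- (t / 192)) * ?S G}"
    (is "_ \<subseteq> ?A \<union> ?B")
  proof
    fix G assume "G \<in> {G \<in> space ?R. t * real m \<le> \<bar>?S G\<bar>}"
    then have G: "G \<in> space ?R" "t * real m \<le> ?S G \<or> t * real m \<le> - ?S G" by auto
    have pos: "0 \<le> t / 192" using t by simp
    have scale: "a * c \<le> c * b" if "a \<le> b" "0 \<le> c" for a b c :: real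
      using mult_right_mono [of a b c] that by (simp add: mult.commute)
    have scale': "a * c \<le> - c * b" if "a \<le> - b" "0 \<le> c" for a b c :: real
      using mult_right_mono [of a "- b" c] that by (simp add: mult.commute)
    from G(2) show "G \<in> ?A \<union> ?B"
    proof
      assume "t * real m \<le> ?S G"
      then show ?thesis using scale [OF _ pos] G(1) by blast
    next
      assume "t * real m \<le> - ?S G"
      then show ?thesis using scale' [OF _ pos] G(1) by blast
    qed
  qed
  then have "emeasure ?R {G \<in> space ?R. t * real m \<le> \<bar>?S G\<bar>} \<le> emeasure ?R (?A \<union> ?B)"
    by (rule emeasure_mono) measurable
  also have "\<dots> \<le> emeasure ?R ?A + emeasure ?R ?B"
    by (rule emeasure_subadditive) measurable
  also have "\<dots> \<le> ennreal (exp (- (t\<^sup>2 * real m / 384))) + ennreal (exp (- (t\<^sup>2 * real m / 384)))"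
    using t by (intro add_mono tail) auto
  also have "\<dots> = ennreal (2 * exp (- (t\<^sup>2 * real m / 384)))"
    by (simp add: ennreal_plus [symmetric] del: ennreal_plus)
  finally show ?thesis .
qed

section \<open>Concentration of the maximum of a Gaussian process\<close>

text \<open>Meant for finite nonempty \<open>T\<close>: there the maximum is attained, and it is
  measurable and integrable in \<open>g\<close>.\<close>

definition max_inner :: "nat \<Rightarrow> (nat \<Rightarrow> real) set \<Rightarrow> (nat \<Rightarrow> real) \<Rightarrow> real" where
  "max_inner n T g = Max ((\<lambda>t. inner_n n g t) ` T)"

lemma measurable_max_inner [measurable (raw)]:
  assumes "finite T" "X \<in> M \<rightarrow>\<^sub>M gaussian_vector n"
  shows "(\<lambda>w. max_inner n T (X w)) \<in> borel_measurable M"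
  unfolding max_inner_def using assms by (intro borel_measurable_Max measurable_inner_n_const) auto

lemma max_inner_ge: "finite T \<Longrightarrow> t \<in> T \<Longrightarrow> inner_n n g t \<le> max_inner n T g"
  by (simp add: max_inner_def)

lemma max_inner_attained:
  assumes "finite T" "T \<noteq> {}"
  obtains t where "t \<in> T" "inner_n n g t = max_inner n T g"
proof -
  have "max_inner n T g \<in> (\<lambda>t. inner_n n g t) ` T"
    unfolding max_inner_def using assms by (intro Max_in) auto
  then show ?thesis using that by auto
qed

lemma inner_n_lincomb: "inner_n n (lincomb_n n a x b y) t = a * inner_n n x t + b * inner_n n y t"
  by (simp add: inner_n_def lincomb_n_def sum_distrib_left sum.distrib [symmetric] algebra_simps)

lemma max_inner_cong: "(\<And>t. inner_n n x t = inner_n n y t) \<Longrightarrow> max_inner n T x = max_inner n T y"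
  by (simp add: max_inner_def)

lemma max_inner_scale:
  assumes "finite T" "T \<noteq> {}" "0 \<le> a"
  shows "max_inner n T (lincomb_n n a x 0 y) = a * max_inner n T x"
proof (rule antisym)
  obtain t where t: "t \<in> T" "inner_n n (lincomb_n n a x 0 y) t = max_inner n T (lincomb_n n a x 0 y)"
    using assms max_inner_attained by blast
  then show "max_inner n T (lincomb_n n a x 0 y) \<le> a * max_inner n T x"
    using mult_left_mono [OF max_inner_ge [OF assms(1) t(1), of n x] assms(3)] by (simp add: inner_n_lincomb)
next
  obtain t where t: "t \<in> T" "inner_n n x t = max_inner n T x"
    using assms max_inner_attained by blast
  then show "a * max_inner n T x \<le> max_inner n T (lincomb_n n a x 0 y)"
    using max_inner_ge [OF assms(1) t(1), of n "lincomb_n n a x 0 y"] by (simp add: inner_n_lincomb)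
qed

lemma nn_integral_exp_inner_n_scale:
  "(\<integral>\<^sup>+g. ennreal (exp (c * inner_n n g v)) \<partial>gaussian_vector n) = ennreal (exp (c\<^sup>2 * (norm_n n v)\<^sup>2 / 2))"
proof -
  have "inner_n n g (\<lambda>i. c * v i) = c * inner_n n g v" for g
    by (simp add: inner_n_def sum_distrib_left algebra_simps)
  moreover have "(norm_n n (\<lambda>i. c * v i))\<^sup>2 = c\<^sup>2 * (norm_n n v)\<^sup>2"
    by (simp add: inner_n_self [symmetric]) (simp add: inner_n_def sum_distrib_left power2_eq_square algebra_simps)
  ultimately show ?thesis
    using nn_integral_exp_inner_n [of n "\<lambda>i. c * v i"] by simp
qed

lemma integrable_inner_n: "integrable (gaussian_vector n) (\<lambda>g. inner_n n g x)"
proof (rule gaussian_vector.square_integrable_imp_integrable)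
  show "integrable (gaussian_vector n) (\<lambda>g. (inner_n n g x)\<^sup>2)"
    using has_bochner_integral_inner_n_sq [of n x] by (simp add: has_bochner_integral_iff)
qed measurable

lemma integrable_max_inner:
  assumes T: "finite T" "T \<noteq> {}"
  shows "integrable (gaussian_vector n) (max_inner n T)"
proof (rule Bochner_Integration.integrable_bound)
  show "integrable (gaussian_vector n) (\<lambda>g. \<Sum>t\<in>T. \<bar>inner_n n g t\<bar>)"
    by (intro Bochner_Integration.integrable_sum integrable_abs integrable_inner_n)
  show "max_inner n T \<in> borel_measurable (gaussian_vector n)"
    using measurable_max_inner [OF T(1) measurable_ident] by simp
  have "norm (max_inner n T g) \<le> norm (\<Sum>t\<in>T. \<bar>inner_n n g t\<bar>)" for g
  proof -
    obtain t where t: "t \<in> T" "inner_n n g t = max_inner n T g"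
      using T max_inner_attained by blast
    have "\<bar>inner_n n g t\<bar> \<le> (\<Sum>t\<in>T. \<bar>inner_n n g t\<bar>)"
      using T(1) t(1) by (intro member_le_sum) auto
    then show ?thesis using t(2) by simp
  qed
  then show "AE g in gaussian_vector n. norm (max_inner n T g) \<le> norm (\<Sum>t\<in>T. \<bar>inner_n n g t\<bar>)"
    by simp
qed

text \<open>A crude bound depending on \<open>T\<close>. Only its finiteness matters: in the limit
  of many small rotations it is multiplied by a factor tending to 0.\<close>

lemma nn_integral_exp_max_inner_finite:
  assumes T: "finite T" "T \<noteq> {}"
  obtains B where "0 \<le> B" "(\<integral>\<^sup>+g. ennreal (exp (max_inner n T g)) \<partial>gaussian_vector n) \<le> ennreal B"
proof
  have "(\<integral>\<^sup>+g. ennreal (exp (max_inner n T g)) \<partial>gaussian_vector n) \<le>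
      (\<integral>\<^sup>+g. (\<Sum>t\<in>T. ennreal (exp (inner_n n g t))) \<partial>gaussian_vector n)"
  proof (rule nn_integral_mono)
    fix g
    obtain t where t: "t \<in> T" "inner_n n g t = max_inner n T g"
      using T max_inner_attained by blast
    have "ennreal (exp (inner_n n g t)) \<le> (\<Sum>t\<in>T. ennreal (exp (inner_n n g t)))"
      using T(1) t(1) by (intro member_le_sum) auto
    then show "ennreal (exp (max_inner n T g)) \<le> (\<Sum>t\<in>T. ennreal (exp (inner_n n g t)))"
      using t(2) by simp
  qed
  also have "\<dots> = (\<Sum>t\<in>T. ennreal (exp ((norm_n n t)\<^sup>2 / 2)))"
    by (subst nn_integral_sum) (simp_all add: nn_integral_exp_inner_n)
  also have "\<dots> = ennreal (\<Sum>t\<in>T. exp ((norm_n n t)\<^sup>2 / 2))"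
    by (rule sum_ennreal) simp
  finally show "(\<integral>\<^sup>+g. ennreal (exp (max_inner n T g)) \<partial>gaussian_vector n) \<le> ennreal (\<Sum>t\<in>T. exp ((norm_n n t)\<^sup>2 / 2))" .
  show "0 \<le> (\<Sum>t\<in>T. exp ((norm_n n t)\<^sup>2 / 2))" by (intro sum_nonneg) simp
qed

text \<open>For fixed \<open>X\<close> with maximiser \<open>t\<close> the increment is at most
  \<open>(1 - cos \<eta>) max_inner X - sin \<eta> \<langle>t, Y\<rangle>\<close>, whose exponential moment over \<open>Y\<close> is explicit.\<close>
lemma max_inner_rotation_step:
  assumes T: "finite T" "T \<noteq> {}" and \<sigma>: "\<And>t. t \<in> T \<Longrightarrow> norm_n n t \<le> \<sigma>" and L: "0 \<le> L"
  shows "(\<integral>\<^sup>+X. \<integral>\<^sup>+Y. ennreal (exp (L * (max_inner n T X - max_inner n T (lincomb_n n (cos \<eta>) X (sin \<eta>) Y))))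
      \<partial>gaussian_vector n \<partial>gaussian_vector n) \<le>
    ennreal (exp ((L * sin \<eta>)\<^sup>2 * \<sigma>\<^sup>2 / 2)) *
    (\<integral>\<^sup>+X. ennreal (exp (L * (1 - cos \<eta>) * max_inner n T X)) \<partial>gaussian_vector n)"
proof -
  let ?g = "gaussian_vector n" and ?F = "max_inner n T"
  have "(\<integral>\<^sup>+Y. ennreal (exp (L * (?F X - ?F (lincomb_n n (cos \<eta>) X (sin \<eta>) Y)))) \<partial>?g) \<le>
      ennreal (exp ((L * sin \<eta>)\<^sup>2 * \<sigma>\<^sup>2 / 2)) * ennreal (exp (L * (1 - cos \<eta>) * ?F X))" for X
  proof -
    obtain t where t: "t \<in> T" "inner_n n X t = ?F X"
      using T max_inner_attained by blast
    have "(\<integral>\<^sup>+Y. ennreal (exp (L * (?F X - ?F (lincomb_n n (cos \<eta>) X (sin \<eta>) Y)))) \<partial>?g) \<le>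
      (\<integral>\<^sup>+Y. ennreal (exp (L * (1 - cos \<eta>) * ?F X)) * ennreal (exp ((- (L * sin \<eta>)) * inner_n n Y t)) \<partial>?g)"
    proof (rule nn_integral_mono)
      fix Y
      have "cos \<eta> * ?F X + sin \<eta> * inner_n n Y t \<le> ?F (lincomb_n n (cos \<eta>) X (sin \<eta>) Y)"
        using max_inner_ge [OF T(1) t(1), of n "lincomb_n n (cos \<eta>) X (sin \<eta>) Y"]
        by (simp add: inner_n_lincomb t(2))
      then have "L * (?F X - ?F (lincomb_n n (cos \<eta>) X (sin \<eta>) Y)) \<le>
          L * (?F X - (cos \<eta> * ?F X + sin \<eta> * inner_n n Y t))"
        by (intro mult_left_mono L) simp
      also have "\<dots> = L * (1 - cos \<eta>) * ?F X + (- (L * sin \<eta>)) * inner_n n Y t"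
        by (simp add: algebra_simps)
      finally show "ennreal (exp (L * (?F X - ?F (lincomb_n n (cos \<eta>) X (sin \<eta>) Y)))) \<le>
          ennreal (exp (L * (1 - cos \<eta>) * ?F X)) * ennreal (exp ((- (L * sin \<eta>)) * inner_n n Y t))"
        by (simp only: ennreal_mult [symmetric] exp_ge_zero mult_exp_exp ennreal_le_iff exp_le_cancel_iff)
    qed
    also have "\<dots> = ennreal (exp (L * (1 - cos \<eta>) * ?F X)) * ennreal (exp ((- (L * sin \<eta>))\<^sup>2 * (norm_n n t)\<^sup>2 / 2))"
      by (subst nn_integral_cmult) (simp_all only: nn_integral_exp_inner_n_scale, measurable)
    also have "\<dots> \<le> ennreal (exp (L * (1 - cos \<eta>) * ?F X)) * ennreal (exp ((L * sin \<eta>)\<^sup>2 * \<sigma>\<^sup>2 / 2))"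
      using \<sigma> [OF t(1)] by (intro mult_left_mono ennreal_leI) (auto intro!: mult_left_mono power_mono)
    finally show ?thesis by (simp only: mult.commute)
  qed
  then have "(\<integral>\<^sup>+X. \<integral>\<^sup>+Y. ennreal (exp (L * (?F X - ?F (lincomb_n n (cos \<eta>) X (sin \<eta>) Y)))) \<partial>?g \<partial>?g) \<le>
      (\<integral>\<^sup>+X. ennreal (exp ((L * sin \<eta>)\<^sup>2 * \<sigma>\<^sup>2 / 2)) * ennreal (exp (L * (1 - cos \<eta>) * ?F X)) \<partial>?g)"
    by (rule nn_integral_mono)
  also have "\<dots> = ennreal (exp ((L * sin \<eta>)\<^sup>2 * \<sigma>\<^sup>2 / 2)) * (\<integral>\<^sup>+X. ennreal (exp (L * (1 - cos \<eta>) * ?F X)) \<partial>?g)"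
    by (rule nn_integral_cmult) (use T in measurable)
  finally show ?thesis .
qed

text \<open>Jensen's inequality lets each increment of the interpolation be estimated separately,
  whatever its dependence on the others. The price is a factor \<open>N\<close> in the exponent,
  which rotation angles of order \<open>1 / N\<close> compensate.\<close>

lemma exp_average_le:
  fixes D :: "nat \<Rightarrow> real"
  assumes "0 < N"
  shows "exp (\<Sum>j<N. D j) \<le> (\<Sum>j<N. 1 / real N * exp (real N * D j))"
proof -
  have "exp (\<Sum>j<N. (1 / real N) *\<^sub>R (real N * D j)) \<le> (\<Sum>j<N. (1 / real N) * exp (real N * D j))"
    using assms by (intro convex_on_sum [OF _ _ exp_convex]) auto
  then show ?thesis using assms by simp
qed

lemma one_minus_cos_le: "1 - cos x \<le> x\<^sup>2 / 2" for x :: real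
proof -
  have "1 - cos x = 2 * (sin (x / 2))\<^sup>2"
    using cos_double_sin [of "x / 2"] by simp
  also have "(sin (x / 2))\<^sup>2 \<le> (x / 2)\<^sup>2"
    using abs_sin_x_le_abs_x [of "x / 2"] by (simp only: abs_le_square_iff)
  finally show ?thesis by (simp add: power_divide)
qed

text \<open>The segment from \<open>Y\<close> to \<open>X\<close> is traversed along the quarter circle
  \<open>sin (k \<eta>) X + cos (k \<eta>) Y\<close>, so that each step is a rotated copy of the first one.\<close>
lemma max_inner_symmetrized_mgf_steps:
  assumes T: "finite T" "T \<noteq> {}" and \<sigma>: "\<And>t. t \<in> T \<Longrightarrow> norm_n n t \<le> \<sigma>" and l: "0 \<le> l" and N: "0 < N"
    and \<eta>: "\<eta> = pi / (2 * real N)"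
  shows "(\<integral>\<^sup>+X. \<integral>\<^sup>+Y. ennreal (exp (l * (max_inner n T X - max_inner n T Y))) \<partial>gaussian_vector n \<partial>gaussian_vector n) \<le>
    ennreal (exp ((l * real N * sin \<eta>)\<^sup>2 * \<sigma>\<^sup>2 / 2)) *
    (\<integral>\<^sup>+X. ennreal (exp (l * real N * (1 - cos \<eta>) * max_inner n T X)) \<partial>gaussian_vector n)" (is "_ \<le> ?rhs")
proof -
  let ?g = "gaussian_vector n" and ?F = "max_inner n T"
  define Z where "Z k X Y = lincomb_n n (sin (real k * \<eta>)) X (cos (real k * \<eta>)) Y" for k X Y
  have [measurable]: "(\<lambda>p. Z k (fst p) (snd p)) \<in> ?g \<Otimes>\<^sub>M ?g \<rightarrow>\<^sub>M ?g"
    "X \<in> space ?g \<Longrightarrow> Z k X \<in> ?g \<rightarrow>\<^sub>M ?g" for k X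
    unfolding Z_def by measurable
  let ?D = "\<lambda>k X Y. l * real N * (?F (Z (Suc k) X Y) - ?F (Z k X Y))"
  have [measurable]: "(\<lambda>p. ?D k (fst p) (snd p)) \<in> borel_measurable (?g \<Otimes>\<^sub>M ?g)" for k
    using T(1) by measurable
  have N\<eta>: "real N * \<eta> = pi / 2" using N by (simp add: \<eta>)
  have "?F (Z N X Y) = ?F X" "?F (Z 0 X Y) = ?F Y" for X Y
    unfolding Z_def N\<eta> by (auto intro!: max_inner_cong simp: inner_n_lincomb)
  then have tele: "l * (?F X - ?F Y) = (\<Sum>k<N. l * (?F (Z (Suc k) X Y) - ?F (Z k X Y)))" for X Y
    using sum_lessThan_telescope [of "\<lambda>k. ?F (Z k X Y)" N] by (simp add: sum_distrib_left [symmetric])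
  have step: "(\<integral>\<^sup>+X. \<integral>\<^sup>+Y. ennreal (exp (?D k X Y)) \<partial>?g \<partial>?g) \<le> ?rhs" for k
  proof -
    let ?f = "\<lambda>X Y. ennreal (exp (l * real N * (?F X - ?F (lincomb_n n (cos \<eta>) X (sin \<eta>) Y))))"
    let ?a = "sin (real (Suc k) * \<eta>)" and ?b = "cos (real (Suc k) * \<eta>)"
    have "?F (lincomb_n n (cos \<eta>) (lincomb_n n ?a X ?b Y) (sin \<eta>) (lincomb_n n ?a Y (- ?b) X)) = ?F (Z k X Y)" for X Y
    proof -
      \<comment> \<open>\<open>Z k\<close> is \<open>Z (Suc k)\<close> moved back by \<eta>, so the
        increment takes the form of \<open>max_inner_rotation_step\<close>: a maximum minus that at
        a slightly rotated point.\<close>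
      have k: "real k * \<eta> = real (Suc k) * \<eta> - \<eta>" by (simp add: algebra_simps)
      show ?thesis
        unfolding Z_def k sin_diff cos_diff
        by (intro max_inner_cong) (simp add: inner_n_lincomb algebra_simps)
    qed
    then have "(\<integral>\<^sup>+X. \<integral>\<^sup>+Y. ennreal (exp (?D k X Y)) \<partial>?g \<partial>?g) =
        (\<integral>\<^sup>+X. \<integral>\<^sup>+Y. ?f (lincomb_n n ?a X ?b Y) (lincomb_n n ?a Y (- ?b) X) \<partial>?g \<partial>?g)"
      by (simp add: Z_def)
    also have "\<dots> = (\<integral>\<^sup>+X. \<integral>\<^sup>+Y. ?f X Y \<partial>?g \<partial>?g)"
    proof (rule gaussian_vector_rotation [where f = ?f])
      show "case_prod ?f \<in> borel_measurable (?g \<Otimes>\<^sub>M ?g)"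
        using T(1) by measurable
    qed simp
    also have "\<dots> \<le> ?rhs"
      using l by (intro max_inner_rotation_step [OF T \<sigma>]) auto
    finally show ?thesis .
  qed
  have "(\<integral>\<^sup>+X. \<integral>\<^sup>+Y. ennreal (exp (l * (?F X - ?F Y))) \<partial>?g \<partial>?g) \<le>
      (\<integral>\<^sup>+X. \<integral>\<^sup>+Y. (\<Sum>k<N. ennreal (1 / real N) * ennreal (exp (?D k X Y))) \<partial>?g \<partial>?g)"
  proof (intro nn_integral_mono)
    fix X Y
    have "exp (l * (?F X - ?F Y)) \<le> (\<Sum>k<N. 1 / real N * exp (?D k X Y))"
    proof -
      have eq: "real N * (l * x) = l * real N * x" for x by simp
      show ?thesis
        by (subst tele, rule order_trans [OF exp_average_le [OF N]]) (simp only: eq order_refl)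
    qed
    then have "ennreal (exp (l * (?F X - ?F Y))) \<le> ennreal (\<Sum>k<N. 1 / real N * exp (?D k X Y))"
      by (rule ennreal_leI)
    also have "\<dots> = (\<Sum>k<N. ennreal (1 / real N) * ennreal (exp (?D k X Y)))"
    proof -
      have "ennreal (\<Sum>k<N. 1 / real N * exp (?D k X Y)) = (\<Sum>k<N. ennreal (1 / real N * exp (?D k X Y)))"
        by (rule sum_ennreal [symmetric]) simp
      then show ?thesis by (simp only: ennreal_mult zero_le_divide_1_iff of_nat_0_le_iff exp_ge_zero)
    qed
    finally show "ennreal (exp (l * (?F X - ?F Y))) \<le> (\<Sum>k<N. ennreal (1 / real N) * ennreal (exp (?D k X Y)))" .
  qed
  also have "\<dots> = (\<integral>\<^sup>+X. (\<Sum>k<N. ennreal (1 / real N) * (\<integral>\<^sup>+Y. ennreal (exp (?D k X Y)) \<partial>?g)) \<partial>?g)"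
    using T(1) by (intro nn_integral_cong) (simp add: nn_integral_sum nn_integral_cmult)
  also have "\<dots> = (\<Sum>k<N. ennreal (1 / real N) * (\<integral>\<^sup>+X. \<integral>\<^sup>+Y. ennreal (exp (?D k X Y)) \<partial>?g \<partial>?g))"
    using T(1) by (simp add: nn_integral_sum nn_integral_cmult)
  also have "\<dots> \<le> (\<Sum>k<N. ennreal (1 / real N) * ?rhs)"
    by (intro sum_mono mult_left_mono step) simp
  also have "\<dots> = ?rhs"
    using N by (simp add: mult.assoc [symmetric] ennreal_of_nat_eq_real_of_nat ennreal_mult [symmetric])
  finally show ?thesis .
qed

text \<open>The limit of infinitely many steps. The product \<open>N * sin \<eta>\<close> stays
  below \<open>pi / 2\<close>, which gives the constant \<open>pi\<^sup>2 / 8\<close>, whereas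
  \<open>N * (1 - cos \<eta>)\<close> is of order \<open>1 / N\<close>, so the remaining exponential
  moment tends to 1.\<close>

lemma max_inner_symmetrized_mgf:
  assumes T: "finite T" "T \<noteq> {}" and \<sigma>: "\<And>t. t \<in> T \<Longrightarrow> norm_n n t \<le> \<sigma>" and l: "0 \<le> l"
  shows "(\<integral>\<^sup>+X. \<integral>\<^sup>+Y. ennreal (exp (l * (max_inner n T X - max_inner n T Y))) \<partial>gaussian_vector n \<partial>gaussian_vector n) \<le>
    ennreal (exp (pi\<^sup>2 * l\<^sup>2 * \<sigma>\<^sup>2 / 8))"
proof -
  let ?g = "gaussian_vector n" and ?F = "max_inner n T"
  obtain B where B: "0 \<le> B" "(\<integral>\<^sup>+g. ennreal (exp (?F g)) \<partial>?g) \<le> ennreal B"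
    using nn_integral_exp_max_inner_finite [OF T] by blast
  \<comment> \<open>Chosen so that \<open>l * N * (\<eta>\<^sup>2 / 2) = c / N\<close> for
    \<open>\<eta> = pi / (2 * N)\<close>.\<close>
  define c where "c = l * pi\<^sup>2 / 8"
  have c: "0 \<le> c" using l by (simp add: c_def)
  have "(\<integral>\<^sup>+X. \<integral>\<^sup>+Y. ennreal (exp (l * (?F X - ?F Y))) \<partial>?g \<partial>?g) \<le>
      ennreal (exp (pi\<^sup>2 * l\<^sup>2 * \<sigma>\<^sup>2 / 8) * (1 + c / real N * B))" (is "?J \<le> _") if N: "0 < N" "c \<le> real N" for N
  proof -
    define \<eta> where "\<eta> = pi / (2 * real N)"
    have \<eta>: "0 \<le> \<eta>" by (simp add: \<eta>_def)
    define s where "s = l * real N * (1 - cos \<eta>)"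
    have s0: "0 \<le> s" using l by (simp add: s_def)
    have "s \<le> l * real N * (\<eta>\<^sup>2 / 2)"
      unfolding s_def using l by (intro mult_left_mono one_minus_cos_le) auto
    also have "\<dots> = c / real N"
      using N by (simp add: \<eta>_def c_def power2_eq_square)
    finally have sc: "s \<le> c / real N" .
    also have "c / real N \<le> 1" using N by simp
    finally have s1: "s \<le> 1" .
    have "\<bar>real N * sin \<eta>\<bar> \<le> real N * \<eta>"
      using abs_sin_x_le_abs_x [of \<eta>] \<eta> by (simp add: abs_mult mult_left_mono)
    also have "real N * \<eta> = pi / 2" using N by (simp add: \<eta>_def)
    finally have "(real N * sin \<eta>)\<^sup>2 \<le> (pi / 2)\<^sup>2"
      by (intro power2_le_iff_abs_le [THEN iffD2]) auto
    then have "l\<^sup>2 * (real N * sin \<eta>)\<^sup>2 * \<sigma>\<^sup>2 \<le> l\<^sup>2 * (pi / 2)\<^sup>2 * \<sigma>\<^sup>2"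
      by (intro mult_left_mono mult_right_mono) auto
    then have e: "(l * real N * sin \<eta>)\<^sup>2 * \<sigma>\<^sup>2 / 2 \<le> pi\<^sup>2 * l\<^sup>2 * \<sigma>\<^sup>2 / 8"
      by (simp add: power_mult_distrib power_divide mult_ac)
    have "(\<integral>\<^sup>+X. ennreal (exp (s * ?F X)) \<partial>?g) \<le> (\<integral>\<^sup>+X. 1 + ennreal s * ennreal (exp (?F X)) \<partial>?g)"
    proof (rule nn_integral_mono)
      fix X
      \<comment> \<open>Convexity between 0 and \<open>?F X\<close> compares the moment of order
        \<open>s\<close> with that of order 1; the condition \<open>c \<le> N\<close> ensures
        \<open>s \<le> 1\<close>.\<close>
      have "exp ((1 - s) *\<^sub>R 0 + s *\<^sub>R ?F X) \<le> (1 - s) * exp 0 + s * exp (?F X)"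
        using s0 s1 by (intro convex_onD [OF exp_convex]) auto
      also have "\<dots> \<le> 1 + s * exp (?F X)" using s0 by simp
      finally have "ennreal (exp (s * ?F X)) \<le> ennreal (1 + s * exp (?F X))" by (intro ennreal_leI) simp
      then show "ennreal (exp (s * ?F X)) \<le> 1 + ennreal s * ennreal (exp (?F X))"
        using s0 by (simp add: ennreal_mult)
    qed
    also have "\<dots> = 1 + ennreal s * (\<integral>\<^sup>+X. ennreal (exp (?F X)) \<partial>?g)"
      using T(1) by (simp add: nn_integral_add nn_integral_cmult gaussian_vector.emeasure_space_1)
    also have "\<dots> \<le> 1 + ennreal (c / real N) * ennreal B"
      using B sc by (intro add_mono mult_mono ennreal_leI) auto
    also have "\<dots> = ennreal (1 + c / real N * B)"
      using B(1) c by (simp add: ennreal_mult [symmetric])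
    finally have mgf: "(\<integral>\<^sup>+X. ennreal (exp (s * ?F X)) \<partial>?g) \<le> ennreal (1 + c / real N * B)" .
    have "?J \<le> ennreal (exp ((l * real N * sin \<eta>)\<^sup>2 * \<sigma>\<^sup>2 / 2)) * (\<integral>\<^sup>+X. ennreal (exp (s * ?F X)) \<partial>?g)"
      unfolding s_def by (rule max_inner_symmetrized_mgf_steps [OF T \<sigma> l N(1) \<eta>_def])
    also have "\<dots> \<le> ennreal (exp (pi\<^sup>2 * l\<^sup>2 * \<sigma>\<^sup>2 / 8)) * ennreal (1 + c / real N * B)"
      using e by (intro mult_mono mgf ennreal_leI) auto
    also have "\<dots> = ennreal (exp (pi\<^sup>2 * l\<^sup>2 * \<sigma>\<^sup>2 / 8) * (1 + c / real N * B))"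
      using B(1) c by (simp only: ennreal_mult exp_ge_zero add_nonneg_nonneg zero_le_one divide_nonneg_nonneg of_nat_0_le_iff mult_nonneg_nonneg)
    finally show ?thesis .
  qed
  note bound = this
  have "\<forall>\<^sub>F N in sequentially. ?J \<le> ennreal (exp (pi\<^sup>2 * l\<^sup>2 * \<sigma>\<^sup>2 / 8) * (1 + c / real N * B))"
  proof (rule eventually_sequentiallyI [of "Suc (nat \<lceil>c\<rceil>)"])
    fix N assume "Suc (nat \<lceil>c\<rceil>) \<le> N"
    then have "0 < N" "real (nat \<lceil>c\<rceil>) \<le> real N" by linarith+
    then show "?J \<le> ennreal (exp (pi\<^sup>2 * l\<^sup>2 * \<sigma>\<^sup>2 / 8) * (1 + c / real N * B))"
      using real_nat_ceiling_ge [of c] by (intro bound) linarith+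
  qed
  moreover have "(\<lambda>N. ennreal (exp (pi\<^sup>2 * l\<^sup>2 * \<sigma>\<^sup>2 / 8) * (1 + c / real N * B))) \<longlonglongrightarrow> ennreal (exp (pi\<^sup>2 * l\<^sup>2 * \<sigma>\<^sup>2 / 8) * (1 + 0 * B))"
    by (intro tendsto_intros tendsto_ennrealI lim_const_over_n)
  ultimately have "?J \<le> ennreal (exp (pi\<^sup>2 * l\<^sup>2 * \<sigma>\<^sup>2 / 8) * (1 + 0 * B))"
    using tendsto_lowerbound trivial_limit_sequentially by blast
  then show ?thesis by simp
qed

text \<open>By Jensen the independent copy in the symmetrised bound contributes at least
  \<open>exp (- l * \<mu>)\<close>, so it may be replaced by the mean.\<close>

lemma max_inner_concentration:
  assumes T: "finite T" "T \<noteq> {}" and \<sigma>: "\<And>t. t \<in> T \<Longrightarrow> norm_n n t \<le> \<sigma>" and l: "0 \<le> l"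
  shows "(\<integral>\<^sup>+g. ennreal (exp (l * max_inner n T g)) \<partial>gaussian_vector n) \<le>
    ennreal (exp (l * (LINT g|gaussian_vector n. max_inner n T g) + pi\<^sup>2 * l\<^sup>2 * \<sigma>\<^sup>2 / 8))"
proof -
  let ?g = "gaussian_vector n" and ?F = "max_inner n T"
  define \<mu> where "\<mu> = (LINT g|?g. ?F g)"
  let ?I = "\<integral>\<^sup>+X. ennreal (exp (l * ?F X)) \<partial>?g"
  have [measurable]: "?F \<in> borel_measurable ?g"
    using integrable_max_inner [OF T] by (rule borel_measurable_integrable)
  have int: "integrable ?g (\<lambda>Y. exp (- l * \<mu>) * (1 - l * (?F Y - \<mu>)))"
    using integrable_max_inner [OF T] by simp
  have intexp: "integrable ?g (\<lambda>Y. exp (- l * ?F Y))"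
  proof (rule integrableI_nonneg)
    obtain t where t: "t \<in> T" using T by blast
    have "(\<integral>\<^sup>+Y. ennreal (exp (- l * ?F Y)) \<partial>?g) \<le> (\<integral>\<^sup>+Y. ennreal (exp (- l * inner_n n Y t)) \<partial>?g)"
      using l max_inner_ge [OF T(1) t, of n] by (intro nn_integral_mono ennreal_leI) (simp add: mult_left_mono)
    also have "\<dots> < \<infinity>"
      by (simp only: nn_integral_exp_inner_n_scale) simp
    finally show "(\<integral>\<^sup>+Y. ennreal (exp (- l * ?F Y)) \<partial>?g) < \<infinity>" .
  qed simp_all
  have jensen: "ennreal (exp (- l * \<mu>)) \<le> (\<integral>\<^sup>+Y. ennreal (exp (- l * ?F Y)) \<partial>?g)"
  proof -
    \<comment> \<open>Jensen through the tangent of the exponential at the mean, integrated.\<close>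
    have "exp (- l * \<mu>) = (LINT Y|?g. exp (- l * \<mu>) * (1 - l * (?F Y - \<mu>)))"
      using integrable_max_inner [OF T] by (simp add: \<mu>_def [symmetric] gaussian_vector.prob_space)
    also have "\<dots> \<le> (LINT Y|?g. exp (- l * ?F Y))"
    proof (rule integral_mono [OF int intexp])
      fix Y
      have "exp (- l * \<mu>) * (1 + (- l * (?F Y - \<mu>))) \<le> exp (- l * \<mu>) * exp (- l * (?F Y - \<mu>))"
        by (intro mult_left_mono exp_ge_add_one_self) simp
      then show "exp (- l * \<mu>) * (1 - l * (?F Y - \<mu>)) \<le> exp (- l * ?F Y)"
        by (simp add: mult_exp_exp algebra_simps)
    qed
    finally have "ennreal (exp (- l * \<mu>)) \<le> ennreal (LINT Y|?g. exp (- l * ?F Y))"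
      by (rule ennreal_leI)
    also have "\<dots> = (\<integral>\<^sup>+Y. ennreal (exp (- l * ?F Y)) \<partial>?g)"
      by (rule nn_integral_eq_integral [OF intexp, symmetric]) simp
    finally show ?thesis .
  qed
  have "?I * ennreal (exp (- l * \<mu>)) \<le> ?I * (\<integral>\<^sup>+Y. ennreal (exp (- l * ?F Y)) \<partial>?g)"
    by (intro mult_left_mono jensen) simp
  also have "\<dots> = (\<integral>\<^sup>+X. \<integral>\<^sup>+Y. ennreal (exp (l * ?F X)) * ennreal (exp (- l * ?F Y)) \<partial>?g \<partial>?g)"
    by (simp add: nn_integral_cmult nn_integral_multc)
  also have "\<dots> = (\<integral>\<^sup>+X. \<integral>\<^sup>+Y. ennreal (exp (l * (?F X - ?F Y))) \<partial>?g \<partial>?g)"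
    by (simp add: ennreal_mult [symmetric] mult_exp_exp right_diff_distrib)
  also have "\<dots> \<le> ennreal (exp (pi\<^sup>2 * l\<^sup>2 * \<sigma>\<^sup>2 / 8))"
    by (rule max_inner_symmetrized_mgf [OF T \<sigma> l])
  finally have main: "?I * ennreal (exp (- l * \<mu>)) \<le> ennreal (exp (pi\<^sup>2 * l\<^sup>2 * \<sigma>\<^sup>2 / 8))" .
  have "?I = ?I * (ennreal (exp (- l * \<mu>)) * ennreal (exp (l * \<mu>)))"
    by (simp add: ennreal_mult [symmetric] mult_exp_exp)
  also have "\<dots> = (?I * ennreal (exp (- l * \<mu>))) * ennreal (exp (l * \<mu>))"
    by (simp only: mult.assoc)
  also have "\<dots> \<le> ennreal (exp (pi\<^sup>2 * l\<^sup>2 * \<sigma>\<^sup>2 / 8)) * ennreal (exp (l * \<mu>))"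
    by (rule mult_right_mono [OF main]) simp
  also have "\<dots> = ennreal (exp (l * \<mu> + pi\<^sup>2 * l\<^sup>2 * \<sigma>\<^sup>2 / 8))"
    by (simp add: ennreal_mult [symmetric] mult_exp_exp add.commute)
  finally show ?thesis by (simp add: \<mu>_def)
qed

section \<open>Uniform bounds for Gaussian matrices\<close>

text \<open>The transposed matrix applied to \<open>h\<close>, as an extensional vector.\<close>

definition comb_rows :: "nat \<Rightarrow> nat \<Rightarrow> (nat \<Rightarrow> real) \<Rightarrow> (nat \<Rightarrow> nat \<Rightarrow> real) \<Rightarrow> nat \<Rightarrow> real" where
  "comb_rows m n h G = (\<lambda>j\<in>{..<n}. \<Sum>i<m. h i * G i j)"

lemma measurable_comb_rows [measurable (raw)]:
  assumes "h \<in> M \<rightarrow>\<^sub>M gaussian_vector m" "G \<in> M \<rightarrow>\<^sub>M gaussian_rows m n"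
  shows "(\<lambda>w. comb_rows m n (h w) (G w)) \<in> M \<rightarrow>\<^sub>M gaussian_vector n"
proof -
  have 1: "(\<lambda>w. h w i) \<in> borel_measurable M" if "i < m" for i
    using that by (intro measurable_compose [OF assms(1)] measurable_gaussian_vector_component)
  have 2: "(\<lambda>w. G w i j) \<in> borel_measurable M" if "i < m" "j < n" for i j
    using measurable_compose [OF assms(2) measurable_compose [OF measurable_gaussian_rows_component
          measurable_gaussian_vector_component]] that by blast
  show ?thesis
    unfolding measurable_cong_sets [OF refl sets_gaussian_vector] comb_rows_def
    by (intro measurable_restrict borel_measurable_sum borel_measurable_times 1 2) auto
qed

lemma measurable_comb_rows_const [measurable (raw)]:
  assumes "G \<in> M \<rightarrow>\<^sub>M gaussian_rows m n"
  shows "(\<lambda>w. comb_rows m n h (G w)) \<in> M \<rightarrow>\<^sub>M gaussian_vector n"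
proof -
  have 2: "(\<lambda>w. G w i j) \<in> borel_measurable M" if "i < m" "j < n" for i j
    using measurable_compose [OF assms measurable_compose [OF measurable_gaussian_rows_component
          measurable_gaussian_vector_component]] that by blast
  show ?thesis
    unfolding measurable_cong_sets [OF refl sets_gaussian_vector] comb_rows_def
    by (intro measurable_restrict borel_measurable_sum borel_measurable_times 2) auto
qed

lemma nn_integral_gaussian_rows_0: "(\<integral>\<^sup>+G. f G \<partial>gaussian_rows 0 n) = f (\<lambda>_. undefined)"
  by (simp add: gaussian_rows_def nn_integral_empty PiM_empty nn_integral_count_space_finite)

lemma nn_integral_gaussian_rows_Suc:
  assumes "f \<in> borel_measurable (gaussian_rows (Suc m) n)"
  shows "(\<integral>\<^sup>+G. f G \<partial>gaussian_rows (Suc m) n) = (\<integral>\<^sup>+r. \<integral>\<^sup>+G. f (G(m := r)) \<partial>gaussian_rows m n \<partial>gaussian_vector n)"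
  using assms unfolding gaussian_rows_def lessThan_Suc
  by (intro gaussian_vector_prod.product_nn_integral_insert_rev) auto

lemma norm_n_Suc: "norm_n (Suc m) h = sqrt ((norm_n m h)\<^sup>2 + (h m)\<^sup>2)"
  by (simp add: inner_n_self [symmetric] norm_n_def [of "Suc m"] inner_n_Suc power2_eq_square [of "h m"])

text \<open>For fixed \<open>h\<close> the combination of the rows is a Gaussian vector scaled by
  the norm of \<open>h\<close>. A new row \<open>r\<close> adds \<open>h m * r\<close> to
  \<open>norm_n m h * g\<close>; a rotation of the pair \<open>(g, r)\<close> turns the sum into a
  multiple of a single Gaussian vector.\<close>

lemma gaussian_rows_comb:
  assumes "f \<in> borel_measurable (gaussian_vector n)"
  shows "(\<integral>\<^sup>+G. f (comb_rows m n h G) \<partial>gaussian_rows m n) =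
    (\<integral>\<^sup>+g. f (lincomb_n n (norm_n m h) g 0 g) \<partial>gaussian_vector n)"
  using assms
proof (induction m arbitrary: f)
  case 0
  have "comb_rows 0 n h G = lincomb_n n (norm_n 0 h) g 0 g" for G g
    by (simp add: comb_rows_def lincomb_n_def norm_n_def inner_n_def)
  then show ?case
    by (simp add: nn_integral_gaussian_rows_0 lincomb_n_def norm_n_def inner_n_def gaussian_vector.emeasure_space_1
        gaussian_rows.emeasure_space_1)
next
  case (Suc m)
  note [measurable] = Suc.prems
  let ?g = "gaussian_vector n"
  define R where "R = norm_n (Suc m) h"
  obtain \<alpha> \<beta> where ab: "\<alpha>\<^sup>2 + \<beta>\<^sup>2 = 1" "norm_n m h = R * \<alpha>" "h m = R * \<beta>"
    unfolding R_def norm_n_Suc by (rule unit_vector_direction)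
  have comb: "comb_rows (Suc m) n h (G(m := r)) = lincomb_n n 1 (comb_rows m n h G) (h m) r" for G r
    by (auto simp: comb_rows_def lincomb_n_def fun_eq_iff intro!: sum.cong)
  have lin: "lincomb_n n 1 (lincomb_n n (norm_n m h) g 0 g) (h m) r =
      lincomb_n n R (lincomb_n n \<alpha> g \<beta> r) 0 (lincomb_n n \<alpha> g \<beta> r)" for g r
    unfolding ab(2,3) by (auto simp: lincomb_n_def fun_eq_iff algebra_simps)
  have "(\<integral>\<^sup>+G. f (comb_rows (Suc m) n h G) \<partial>gaussian_rows (Suc m) n) =
      (\<integral>\<^sup>+r. \<integral>\<^sup>+G. f (lincomb_n n 1 (comb_rows m n h G) (h m) r) \<partial>gaussian_rows m n \<partial>?g)"
    by (subst nn_integral_gaussian_rows_Suc, measurable) (simp add: comb)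
  also have "\<dots> = (\<integral>\<^sup>+r. \<integral>\<^sup>+g. f (lincomb_n n 1 (lincomb_n n (norm_n m h) g 0 g) (h m) r) \<partial>?g \<partial>?g)"
  proof (rule nn_integral_cong)
    fix r assume [measurable]: "r \<in> space ?g"
    show "(\<integral>\<^sup>+G. f (lincomb_n n 1 (comb_rows m n h G) (h m) r) \<partial>gaussian_rows m n) =
      (\<integral>\<^sup>+g. f (lincomb_n n 1 (lincomb_n n (norm_n m h) g 0 g) (h m) r) \<partial>?g)"
      by (rule Suc.IH [where f = "\<lambda>v. f (lincomb_n n 1 v (h m) r)"]) measurable
  qed
  also have "\<dots> = (\<integral>\<^sup>+g. \<integral>\<^sup>+r. f (lincomb_n n 1 (lincomb_n n (norm_n m h) g 0 g) (h m) r) \<partial>?g \<partial>?g)"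
    by (rule gaussian_vector_pair.Fubini') measurable
  also have "\<dots> = (\<integral>\<^sup>+g. \<integral>\<^sup>+r. f (lincomb_n n R (lincomb_n n \<alpha> g \<beta> r) 0 (lincomb_n n \<alpha> g \<beta> r)) \<partial>?g \<partial>?g)"
    by (simp only: lin)
  also have "\<dots> = (\<integral>\<^sup>+g. \<integral>\<^sup>+r. f (lincomb_n n R g 0 g) \<partial>?g \<partial>?g)"
    by (rule gaussian_vector_rotation [OF _ ab(1), where f = "\<lambda>X Y. f (lincomb_n n R X 0 X)"]) measurable
  also have "\<dots> = (\<integral>\<^sup>+g. f (lincomb_n n R g 0 g) \<partial>?g)"
    by (simp add: gaussian_vector.emeasure_space_1)
  finally show ?case by (simp add: R_def)
qed

lemma inner_n_comb_rows: "inner_n n (comb_rows m n h G) z = inner_n m h (\<lambda>i. inner_n n (G i) z)"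
proof -
  have "inner_n n (comb_rows m n h G) z = (\<Sum>j<n. \<Sum>i<m. h i * (G i j * z j))"
    by (simp add: inner_n_def comb_rows_def sum_distrib_right mult.assoc)
  also have "\<dots> = (\<Sum>i<m. \<Sum>j<n. h i * (G i j * z j))"
    by (rule sum.swap)
  also have "\<dots> = inner_n m h (\<lambda>i. inner_n n (G i) z)"
    by (simp add: inner_n_def sum_distrib_left)
  finally show ?thesis .
qed

lemma norm_n_sq: "(norm_n n x)\<^sup>2 = (\<Sum>i<n. (x i)\<^sup>2)"
  by (simp only: inner_n_self [symmetric]) (simp add: inner_n_def power2_eq_square)

lemma nn_integral_exp_norm_sq:
  "(\<integral>\<^sup>+h. ennreal (exp ((norm_n m h)\<^sup>2 / 4)) \<partial>gaussian_vector m) = ennreal (sqrt 2) ^ m"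
proof -
  have "(\<integral>\<^sup>+h. ennreal (exp ((norm_n m h)\<^sup>2 / 4)) \<partial>gaussian_vector m) =
      (\<integral>\<^sup>+h. (\<Prod>i<m. ennreal (exp ((h i)\<^sup>2 / 4))) \<partial>gaussian_vector m)"
    by (simp add: norm_n_sq prod_ennreal exp_sum [symmetric] sum_divide_distrib)
  also have "\<dots> = (\<Prod>i<m. \<integral>\<^sup>+s. ennreal (exp (s\<^sup>2 / 4)) \<partial>\<gamma>)"
    unfolding gaussian_vector_def by (rule std_gaussian_prod.product_nn_integral_prod) auto
  finally show ?thesis by (simp add: nn_integral_exp_sq_quarter)
qed

lemma measurable_norm_n [measurable (raw)]:
  assumes [measurable]: "X \<in> M \<rightarrow>\<^sub>M gaussian_vector n"
  shows "(\<lambda>w. norm_n n (X w)) \<in> borel_measurable M"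
  unfolding norm_n_def by measurable

interpretation rows_vec: pair_prob_space "gaussian_rows m n" "gaussian_vector k" for m n k
  by unfold_locales

text \<open>Linearisation: \<open>exp (l\<^sup>2 |G z|\<^sup>2 / 2)\<close> is the average of \<open>exp (l \<langle>h, G z\<rangle>)\<close> over a Gaussian \<open>h\<close>, and
  \<open>\<langle>h, G z\<rangle> \<le> max_inner (G\<^sup>T h)\<close>, where \<open>G\<^sup>T h\<close> is distributed as \<open>|h| g\<close>.\<close>
lemma gaussian_rows_sup_norm:
  assumes T: "finite T" "T \<noteq> {}" and \<sigma>: "\<And>t. t \<in> T \<Longrightarrow> norm_n n t \<le> \<sigma>" and "0 < \<sigma>"
    and w: "(LINT g|gaussian_vector n. max_inner n T g) \<le> w"
  shows "emeasure (gaussian_rows m n) {G \<in> space (gaussian_rows m n).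
      \<exists>z\<in>T. 4 * w\<^sup>2 + 2 * pi\<^sup>2 * \<sigma>\<^sup>2 * real m \<le> (\<Sum>i<m. (inner_n n (G i) z)\<^sup>2)} \<le> ennreal (exp (- (real m / 2)))"
proof -
  let ?R = "gaussian_rows m n" and ?F = "max_inner n T" and ?g = "gaussian_vector n" and ?h = "gaussian_vector m"
  note T(1) [measurable]
  \<comment> \<open>This makes the variance term of the concentration bound equal to
    \<open>(norm_n m h)\<^sup>2 / 8\<close>, half of the exponent whose Gaussian integral is
    available; the other half absorbs the mean.\<close>
  define l where "l = 1 / (pi * \<sigma>)"
  have l: "0 < l" using \<open>0 < \<sigma>\<close> by (simp add: l_def)
  have ls: "pi\<^sup>2 * l\<^sup>2 * \<sigma>\<^sup>2 = 1" using \<open>0 < \<sigma>\<close> by (simp add: l_def power_divide power_mult_distrib)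
  define u where "u G = (\<integral>\<^sup>+h. ennreal (exp (l * ?F (comb_rows m n h G))) \<partial>?h)" for G
  have [measurable]: "(\<lambda>p. ?F (comb_rows m n (snd p) (fst p))) \<in> borel_measurable (?R \<Otimes>\<^sub>M ?h)"
    "(\<lambda>p. ?F (comb_rows m n (fst p) (snd p))) \<in> borel_measurable (?h \<Otimes>\<^sub>M ?R)"
    using T(1) by measurable
  have [measurable]: "u \<in> borel_measurable ?R"
    unfolding u_def by measurable
  \<comment> \<open>One function \<open>u\<close> dominates all \<open>z\<close> in \<open>T\<close>
    simultaneously. Markov's inequality is then applied once and the size of \<open>T\<close> does
    not enter.\<close>
  have lower: "ennreal (exp (l\<^sup>2 * (\<Sum>i<m. (inner_n n (G i) z)\<^sup>2) / 2)) \<le> u G" if "z \<in> T" for G z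
  proof -
    let ?v = "\<lambda>i. inner_n n (G i) z"
    have "(\<Sum>i<m. (inner_n n (G i) z)\<^sup>2) = (norm_n m ?v)\<^sup>2"
      by (rule norm_n_sq [symmetric])
    then have "ennreal (exp (l\<^sup>2 * (\<Sum>i<m. (inner_n n (G i) z)\<^sup>2) / 2)) = (\<integral>\<^sup>+h. ennreal (exp (l * inner_n m h ?v)) \<partial>?h)"
      by (simp add: nn_integral_exp_inner_n_scale)
    also have "\<dots> \<le> u G"
      unfolding u_def
    proof (intro nn_integral_mono ennreal_leI)
      fix h
      have "inner_n m h ?v \<le> ?F (comb_rows m n h G)"
        using max_inner_ge [OF T(1) that, of n "comb_rows m n h G"] by (simp add: inner_n_comb_rows)
      then show "exp (l * inner_n m h ?v) \<le> exp (l * ?F (comb_rows m n h G))"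
        using l by simp
    qed
    finally show ?thesis .
  qed
  have upper: "(\<integral>\<^sup>+G. u G \<partial>?R) \<le> ennreal (exp (2 * l\<^sup>2 * w\<^sup>2)) * ennreal (sqrt 2) ^ m"
  proof -
    have "(\<integral>\<^sup>+G. u G \<partial>?R) = (\<integral>\<^sup>+h. \<integral>\<^sup>+G. ennreal (exp (l * ?F (comb_rows m n h G))) \<partial>?R \<partial>?h)"
      unfolding u_def by (rule rows_vec.Fubini'[symmetric]) measurable
    also have "\<dots> \<le> (\<integral>\<^sup>+h. ennreal (exp (2 * l\<^sup>2 * w\<^sup>2)) * ennreal (exp ((norm_n m h)\<^sup>2 / 4)) \<partial>?h)"
    proof (rule nn_integral_mono)
      fix h
      let ?N = "norm_n m h"
      have meas: "(\<lambda>v. ennreal (exp (l * ?F v))) \<in> borel_measurable ?g"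
        using T(1) by measurable
      have "(\<integral>\<^sup>+G. ennreal (exp (l * ?F (comb_rows m n h G))) \<partial>?R) =
          (\<integral>\<^sup>+g. ennreal (exp (l * ?F (lincomb_n n ?N g 0 g))) \<partial>?g)"
        by (rule gaussian_rows_comb [OF meas])
      also have "\<dots> = (\<integral>\<^sup>+g. ennreal (exp ((l * ?N) * ?F g)) \<partial>?g)"
        by (simp add: max_inner_scale [OF T] mult.assoc)
      also have "\<dots> \<le> ennreal (exp ((l * ?N) * (LINT g|?g. ?F g) + pi\<^sup>2 * (l * ?N)\<^sup>2 * \<sigma>\<^sup>2 / 8))"
        using l by (intro max_inner_concentration [OF T \<sigma>]) auto
      also have "\<dots> \<le> ennreal (exp (2 * l\<^sup>2 * w\<^sup>2 + ?N\<^sup>2 / 4))"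
      proof (intro ennreal_leI, unfold exp_le_cancel_iff)
        have "pi\<^sup>2 * (l * ?N)\<^sup>2 * \<sigma>\<^sup>2 = (pi\<^sup>2 * l\<^sup>2 * \<sigma>\<^sup>2) * ?N\<^sup>2"
          by (simp add: power_mult_distrib)
        then have 1: "pi\<^sup>2 * (l * ?N)\<^sup>2 * \<sigma>\<^sup>2 / 8 = ?N\<^sup>2 / 8" unfolding ls by simp
        have 2: "l * ?N * (LINT g|?g. ?F g) \<le> l * ?N * w"
          using l w by (intro mult_left_mono) auto
        \<comment> \<open>The cross term \<open>l * ?N * w\<close> is split so that the part
          quadratic in \<open>?N\<close> uses exactly the remaining
          \<open>?N\<^sup>2 / 8\<close>.\<close>
        have "0 \<le> (?N / 2 - 2 * (l * w))\<^sup>2 / 2" by simp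
        also have "\<dots> = ?N\<^sup>2 / 8 + 2 * l\<^sup>2 * w\<^sup>2 - l * ?N * w"
          by (simp add: power2_diff power_mult_distrib power_divide field_simps)
        finally show "l * ?N * (LINT g|?g. ?F g) + pi\<^sup>2 * (l * ?N)\<^sup>2 * \<sigma>\<^sup>2 / 8 \<le> 2 * l\<^sup>2 * w\<^sup>2 + ?N\<^sup>2 / 4"
          using 1 2 by linarith
      qed
      also have "\<dots> = ennreal (exp (2 * l\<^sup>2 * w\<^sup>2)) * ennreal (exp (?N\<^sup>2 / 4))"
        by (simp only: exp_add ennreal_mult exp_ge_zero)
      finally show "(\<integral>\<^sup>+G. ennreal (exp (l * ?F (comb_rows m n h G))) \<partial>?R) \<le>
          ennreal (exp (2 * l\<^sup>2 * w\<^sup>2)) * ennreal (exp (?N\<^sup>2 / 4))" .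
    qed
    also have "\<dots> = ennreal (exp (2 * l\<^sup>2 * w\<^sup>2)) * ennreal (sqrt 2) ^ m"
      by (subst nn_integral_cmult, measurable) (simp only: nn_integral_exp_norm_sq)
    finally show ?thesis .
  qed
  \<comment> \<open>\<open>l\<^sup>2 / 2\<close> times the threshold. Against the mean of
    \<open>u\<close> its first summand cancels, and \<open>exp (- m)\<close> outweighs
    \<open>sqrt 2 ^ m\<close> up to \<open>exp (- m / 2)\<close>.\<close>
  define a where "a = 2 * l\<^sup>2 * w\<^sup>2 + real m"
  have "{G \<in> space ?R. \<exists>z\<in>T. 4 * w\<^sup>2 + 2 * pi\<^sup>2 * \<sigma>\<^sup>2 * real m \<le> (\<Sum>i<m. (inner_n n (G i) z)\<^sup>2)} \<subseteq>
      {G \<in> space ?R. 1 \<le> ennreal (exp (- a)) * u G}"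
  proof safe
    fix G z assume z: "z \<in> T" "4 * w\<^sup>2 + 2 * pi\<^sup>2 * \<sigma>\<^sup>2 * real m \<le> (\<Sum>i<m. (inner_n n (G i) z)\<^sup>2)"
    have "a = l\<^sup>2 * (4 * w\<^sup>2 + 2 * pi\<^sup>2 * \<sigma>\<^sup>2 * real m) / 2"
    proof -
      have "l\<^sup>2 * (4 * w\<^sup>2 + 2 * pi\<^sup>2 * \<sigma>\<^sup>2 * real m) / 2 = 2 * l\<^sup>2 * w\<^sup>2 + (pi\<^sup>2 * l\<^sup>2 * \<sigma>\<^sup>2) * real m"
        by (simp add: algebra_simps)
      then show ?thesis by (simp add: ls a_def)
    qed
    also have "\<dots> \<le> l\<^sup>2 * (\<Sum>i<m. (inner_n n (G i) z)\<^sup>2) / 2"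
      using z(2) by (intro divide_right_mono mult_left_mono) auto
    finally have "ennreal (exp a) \<le> ennreal (exp (l\<^sup>2 * (\<Sum>i<m. (inner_n n (G i) z)\<^sup>2) / 2))"
      by (intro ennreal_leI) simp
    also have "\<dots> \<le> u G" by (rule lower [OF z(1)])
    finally have "ennreal (exp (- a)) * ennreal (exp a) \<le> ennreal (exp (- a)) * u G"
      by (intro mult_left_mono) auto
    then show "1 \<le> ennreal (exp (- a)) * u G"
      by (simp add: ennreal_mult [symmetric] mult_exp_exp)
  qed
  then have "emeasure ?R {G \<in> space ?R. \<exists>z\<in>T. 4 * w\<^sup>2 + 2 * pi\<^sup>2 * \<sigma>\<^sup>2 * real m \<le> (\<Sum>i<m. (inner_n n (G i) z)\<^sup>2)} \<le>
      emeasure ?R {G \<in> space ?R. 1 \<le> ennreal (exp (- a)) * u G}"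
    by (rule emeasure_mono) measurable
  also have "\<dots> \<le> ennreal (exp (- a)) * (\<integral>\<^sup>+G. u G * indicator (space ?R) G \<partial>?R)"
    by (rule nn_integral_Markov_inequality) measurable
  also have "(\<integral>\<^sup>+G. u G * indicator (space ?R) G \<partial>?R) = (\<integral>\<^sup>+G. u G \<partial>?R)"
    by (rule nn_integral_cong) simp
  also have "ennreal (exp (- a)) * \<dots> \<le> ennreal (exp (- a)) * (ennreal (exp (2 * l\<^sup>2 * w\<^sup>2)) * ennreal (sqrt 2) ^ m)"
    by (intro mult_left_mono upper) simp
  also have "\<dots> \<le> ennreal (exp (- a)) * (ennreal (exp (2 * l\<^sup>2 * w\<^sup>2)) * ennreal (exp (1 / 2)) ^ m)"
  proof (intro mult_left_mono power_mono ennreal_leI)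
    have "(2::real) \<le> exp 1" using exp_ge_add_one_self [of "1::real"] by simp
    also have "\<dots> = (exp (1 / 2))\<^sup>2" by (simp add: exp_double [symmetric])
    finally show "sqrt 2 \<le> exp (1 / 2)" by (intro real_le_lsqrt) auto
  qed auto
  also have "\<dots> = ennreal (exp (- (real m / 2)))"
    by (simp add: ennreal_power exp_of_nat_mult [symmetric] ennreal_mult [symmetric] mult_exp_exp a_def)
  finally show ?thesis .
qed

section \<open>Sudakov minoration\<close>

definition diffs :: "(nat \<Rightarrow> real) set \<Rightarrow> (nat \<Rightarrow> real) set" where
  "diffs P = (\<lambda>p. diff_n (fst p) (snd p)) ` (P \<times> P)"

lemma diffs_finite: "finite P \<Longrightarrow> finite (diffs P)"
  and diffs_nonempty: "P \<noteq> {} \<Longrightarrow> diffs P \<noteq> {}"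
  and diffsI: "x \<in> P \<Longrightarrow> y \<in> P \<Longrightarrow> diff_n x y \<in> diffs P"
  by (auto simp: diffs_def image_iff)

lemma max_inner_diffs_nonneg:
  assumes "finite P" "P \<noteq> {}"
  shows "0 \<le> max_inner n (diffs P) g"
proof -
  obtain x where "x \<in> P" using assms by blast
  then have "inner_n n g (diff_n x x) \<le> max_inner n (diffs P) g"
    by (intro max_inner_ge diffs_finite diffsI assms)
  then show ?thesis by (simp add: inner_n_def)
qed

text \<open>The translates by \<open>a (x - x0)\<close>, \<open>x \<in> P\<close>, of the set where \<open>max_inner\<close> is at most \<open>2 w\<close> are disjoint
  as soon as \<open>a \<epsilon>\<^sup>2 \<ge> 4 w\<close>, and each of them has a substantial Gaussian measure.\<close>
lemma local_packing:
  assumes P: "finite P" and w: "0 < w" and \<epsilon>: "0 < \<epsilon>"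
    and W: "(LINT g|gaussian_vector n. max_inner n (diffs (insert x0 P)) g) \<le> w"
    and sep: "\<And>x y. x \<in> P \<Longrightarrow> y \<in> P \<Longrightarrow> x \<noteq> y \<Longrightarrow> \<epsilon> < norm_n n (diff_n x y)"
    and near: "\<And>x. x \<in> P \<Longrightarrow> norm_n n (diff_n x x0) \<le> 2 * \<epsilon>"
  shows "real (card P) \<le> 2 * exp (40 * w\<^sup>2 / \<epsilon>\<^sup>2)"
proof -
  let ?g = "gaussian_vector n" and ?F = "max_inner n (diffs (insert x0 P))"
  have fin: "finite (diffs (insert x0 P))" and ne: "diffs (insert x0 P) \<noteq> {}"
    using P by (auto intro!: diffs_finite diffs_nonempty)
  have [measurable]: "?F \<in> borel_measurable ?g"
    using integrable_max_inner [OF fin ne] by (rule borel_measurable_integrable)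
  define A where "A = {g \<in> space ?g. ?F g \<le> 2 * w}"
  have [measurable]: "A \<in> sets ?g" unfolding A_def by measurable
  have inA: "inner_n n g (diff_n x y) \<le> 2 * w" if "g \<in> A" "x \<in> insert x0 P" "y \<in> insert x0 P" for g x y
    using max_inner_ge [OF fin diffsI [OF that(2,3)], of n g] that(1) by (simp add: A_def)
  \<comment> \<open>The maximum over differences is nonnegative with mean at most \<open>w\<close>,
    so \<open>A\<close> has at least half of the mass.\<close>
  have "measure ?g {g \<in> space ?g. 2 * w \<le> ?F g} \<le> (LINT g|?g. ?F g) / (2 * w)"
    using P w by (intro integral_Markov_inequality_measure [OF integrable_max_inner [OF fin ne], of "{}"])
      (auto intro!: max_inner_diffs_nonneg)
  also have "\<dots> \<le> 1 / 2" using W w by (simp add: divide_le_eq)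
  finally have "1 / 2 \<le> measure ?g {g \<in> space ?g. \<not> 2 * w \<le> ?F g}"
    by (subst gaussian_vector.prob_neg) auto
  also have "\<dots> \<le> measure ?g A"
    by (rule gaussian_vector.finite_measure_mono) (auto simp: A_def)
  finally have A: "1 / 2 \<le> measure ?g A" .
  define a where "a = 4 * w / \<epsilon>\<^sup>2"
  have a: "0 < a" using w \<epsilon> by (simp add: a_def)
  define v where "v x = (\<lambda>i. a * (x0 i - x i))" for x :: "nat \<Rightarrow> real"
  have inner_v: "inner_n n g (v x) = - (a * inner_n n g (diff_n x x0))" for g x
    by (simp add: v_def inner_n_def sum_distrib_left sum_negf [symmetric] algebra_simps)
  have norm_v: "inner_n n (v x) (v x) = a\<^sup>2 * (norm_n n (diff_n x x0))\<^sup>2" for x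
    by (simp add: inner_n_self [symmetric]) (simp add: v_def inner_n_def sum_distrib_left power2_eq_square algebra_simps)
  let ?sh = "\<lambda>x g. \<lambda>i\<in>{..<n}. g i + v x i"
  have sh [measurable]: "?sh x \<in> ?g \<rightarrow>\<^sub>M ?g" for x
  proof -
    have "(\<lambda>g. g i + v x i) \<in> borel_measurable ?g" if "i < n" for i
      using measurable_gaussian_vector_component [OF that] by measurable
    then show ?thesis
      unfolding measurable_cong_sets [OF refl sets_gaussian_vector] by (intro measurable_restrict) auto
  qed
  \<comment> \<open>A lower bound for the Cameron-Martin factor on \<open>A\<close>: the linear term
    is at most \<open>2 * w\<close> there because \<open>x0\<close> belongs to the set, and the
    quadratic term uses the distance \<open>2 * \<epsilon>\<close> to \<open>x0\<close>. With the
    chosen \<open>a\<close> the exponent is \<open>8 + 32 = 40\<close> times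
    \<open>w\<^sup>2 / \<epsilon>\<^sup>2\<close>.\<close>
  define E where "E = exp (- (2 * a * w + 2 * a\<^sup>2 * \<epsilon>\<^sup>2))"
  have lower: "ennreal (E / 2) \<le> (\<integral>\<^sup>+g. indicator A (?sh x g) \<partial>?g)" if x: "x \<in> P" for x
  proof -
    have "ennreal (E / 2) \<le> ennreal (E * measure ?g A)"
      using A by (intro ennreal_leI) (simp add: E_def)
    also have "\<dots> = (\<integral>\<^sup>+g. ennreal E * indicator A g \<partial>?g)"
      by (simp add: nn_integral_cmult gaussian_vector.emeasure_eq_measure ennreal_mult E_def)
    also have "\<dots> \<le> (\<integral>\<^sup>+g. indicator A g * ennreal (exp (inner_n n g (v x) - inner_n n (v x) (v x) / 2)) \<partial>?g)"
    proof (rule nn_integral_mono)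
      fix g
      show "ennreal E * indicator A g \<le> indicator A g * ennreal (exp (inner_n n g (v x) - inner_n n (v x) (v x) / 2))"
      proof (cases "g \<in> A")
        case True
        have "a * inner_n n g (diff_n x x0) \<le> a * (2 * w)"
          using inA [OF True, of x x0] x a by (intro mult_left_mono) auto
        moreover have "a\<^sup>2 * (norm_n n (diff_n x x0))\<^sup>2 \<le> a\<^sup>2 * (2 * \<epsilon>)\<^sup>2"
          using near [OF x] by (intro mult_left_mono power_mono) auto
        ultimately have "- (2 * a * w + 2 * a\<^sup>2 * \<epsilon>\<^sup>2) \<le> inner_n n g (v x) - inner_n n (v x) (v x) / 2"
          unfolding norm_v unfolding inner_v by (simp add: power_mult_distrib)
        then show ?thesis using True by (simp add: E_def ennreal_leI)
      qed simp
    qed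
    also have "\<dots> = (\<integral>\<^sup>+g. indicator A (?sh x g) \<partial>?g)"
      by (rule gaussian_vector_shift [symmetric]) measurable
    finally show ?thesis .
  qed
  have disj: "(\<Sum>x\<in>P. indicator A (?sh x g)) \<le> (1::ennreal)" for g
  proof (cases "\<exists>x\<in>P. ?sh x g \<in> A")
    case True
    then obtain x where x: "x \<in> P" "?sh x g \<in> A" by blast
    have "?sh y g \<notin> A" if y: "y \<in> P" "y \<noteq> x" for y
    proof
      assume yA: "?sh y g \<in> A"
      \<comment> \<open>Testing the two translates against opposite differences cancels
        \<open>g\<close>; what remains is \<open>a\<close> times the squared distance of
        \<open>x\<close> and \<open>y\<close>.\<close>
      have "inner_n n (?sh y g) (diff_n x y) \<le> 2 * w"
        by (rule inA [OF yA]) (use x y in auto)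
      moreover have "inner_n n (?sh x g) (diff_n y x) \<le> 2 * w"
        by (rule inA [OF x(2)]) (use x y in auto)
      moreover have "inner_n n (?sh y g) (diff_n x y) + inner_n n (?sh x g) (diff_n y x) =
          a * (norm_n n (diff_n x y))\<^sup>2"
        unfolding inner_n_self [symmetric] inner_n_def sum_distrib_left sum.distrib [symmetric]
        by (intro sum.cong refl) (simp add: v_def algebra_simps)
      moreover have "a * \<epsilon>\<^sup>2 < a * (norm_n n (diff_n x y))\<^sup>2"
        using sep [OF x(1) y(1)] y(2) a \<epsilon> by (intro mult_strict_left_mono power_strict_mono) auto
      moreover have "a * \<epsilon>\<^sup>2 = 4 * w" using \<epsilon> by (simp add: a_def)
      ultimately show False by linarith
    qed
    then have "(\<Sum>y\<in>P. indicator A (?sh y g)) = (\<Sum>y\<in>P. if y = x then 1 else (0::ennreal))"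
      using x by (intro sum.cong) auto
    then show ?thesis using P by simp
  next
    case False
    then have "(\<Sum>x\<in>P. indicator A (?sh x g)) = (\<Sum>x\<in>P. (0::ennreal))"
      by (intro sum.cong) auto
    then show ?thesis by simp
  qed
  have "ennreal (real (card P) * (E / 2)) = (\<Sum>x\<in>P. ennreal (E / 2))"
    by (simp add: ennreal_mult [symmetric] ennreal_of_nat_eq_real_of_nat E_def)
  also have "\<dots> \<le> (\<Sum>x\<in>P. \<integral>\<^sup>+g. indicator A (?sh x g) \<partial>?g)"
    by (intro sum_mono lower)
  also have "\<dots> = (\<integral>\<^sup>+g. (\<Sum>x\<in>P. indicator A (?sh x g)) \<partial>?g)"
    by (rule nn_integral_sum [symmetric]) measurable
  also have "\<dots> \<le> (\<integral>\<^sup>+g. 1 \<partial>?g)"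
    by (intro nn_integral_mono disj)
  also have "\<dots> = 1" by (simp add: gaussian_vector.emeasure_space_1)
  finally have "real (card P) * (E / 2) \<le> 1" by (simp flip: ennreal_1)
  then have "real (card P) \<le> 2 * (1 / E)" by (simp add: E_def field_simps)
  also have "1 / E = exp (40 * w\<^sup>2 / \<epsilon>\<^sup>2)"
  proof -
    have "2 * a * w + 2 * a\<^sup>2 * \<epsilon>\<^sup>2 = 40 * w\<^sup>2 / \<epsilon>\<^sup>2"
      using \<epsilon> by (simp add: a_def power2_eq_square field_simps)
    then show ?thesis unfolding E_def by (simp add: exp_minus field_simps)
  qed
  finally show ?thesis .
qed

text \<open>The bound on separated sets guarantees one of greatest cardinality, and a point farther
  than \<epsilon> from all of it could be added.\<close>

lemma maximal_separated:
  fixes d :: "'a \<Rightarrow> 'a \<Rightarrow> real"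
  assumes bound: "\<And>P. finite P \<Longrightarrow> P \<subseteq> S \<Longrightarrow> (\<forall>x\<in>P. \<forall>y\<in>P. x \<noteq> y \<longrightarrow> \<epsilon> < d x y) \<Longrightarrow> real (card P) \<le> b"
    and sym: "\<And>x y. d x y = d y x" and refl: "\<And>x. d x x = 0" and \<epsilon>: "0 \<le> \<epsilon>"
  obtains P where "finite P" "P \<subseteq> S" "real (card P) \<le> b" "\<And>x. x \<in> S \<Longrightarrow> \<exists>y\<in>P. d x y \<le> \<epsilon>"
proof -
  define Q where "Q P \<longleftrightarrow> finite P \<and> P \<subseteq> S \<and> (\<forall>x\<in>P. \<forall>y\<in>P. x \<noteq> y \<longrightarrow> \<epsilon> < d x y)" for P
  have "Q {}" by (simp add: Q_def)
  moreover have "\<forall>P. Q P \<longrightarrow> card P < Suc (nat \<lfloor>b\<rfloor>)"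
    using bound by (auto simp: Q_def less_Suc_eq_le intro!: le_nat_floor)
  ultimately obtain P where P: "Q P" "\<And>P'. Q P' \<Longrightarrow> card P' \<le> card P"
    using ex_has_greatest_nat [of Q "{}" card "Suc (nat \<lfloor>b\<rfloor>)"] by blast
  have "\<exists>y\<in>P. d x y \<le> \<epsilon>" if x: "x \<in> S" for x
  proof (rule ccontr)
    assume "\<not> (\<exists>y\<in>P. d x y \<le> \<epsilon>)"
    then have far: "\<epsilon> < d x y" if "y \<in> P" for y using that by auto
    then have "x \<notin> P" using refl [of x] \<epsilon> by force
    moreover have "Q (insert x P)"
      using P(1) x far sym by (auto simp: Q_def)
    ultimately show False
      using P(1) P(2) [of "insert x P"] by (simp add: Q_def)
  qed
  then show ?thesis using that [of P] P(1) bound by (auto simp: Q_def)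
qed

text \<open>\<open>local_packing\<close> only counts points within distance
  \<open>2 * \<epsilon>\<close> of a centre. Nets are therefore refined dyadically: at scale 2 one
  point is enough, and each halving covers the pieces around the points of the coarser net. The
  sizes multiply, but the exponents form a geometric series dominated by the finest scale.\<close>

lemma sudakov_net:
  assumes K: "K \<noteq> {}" and unit: "\<And>x. x \<in> K \<Longrightarrow> norm_n n x \<le> 1" and w: "1 \<le> w"
    and W: "\<And>P. finite P \<Longrightarrow> P \<noteq> {} \<Longrightarrow> P \<subseteq> K \<Longrightarrow> (LINT g|gaussian_vector n. max_inner n (diffs P) g) \<le> w"
    and \<epsilon>: "0 < \<epsilon>"
  shows "\<exists>N. finite N \<and> N \<subseteq> K \<and> (\<forall>x\<in>K. \<exists>y\<in>N. norm_n n (diff_n x y) \<le> \<epsilon>) \<and> real (card N) \<le> exp (100 * w\<^sup>2 / \<epsilon>\<^sup>2)"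
proof -
  have "\<exists>N. finite N \<and> N \<subseteq> K \<and> (\<forall>x\<in>K. \<exists>y\<in>N. norm_n n (diff_n x y) \<le> \<epsilon>) \<and> real (card N) \<le> exp (100 * w\<^sup>2 / \<epsilon>\<^sup>2)"
    if "0 < \<epsilon>" "2 \<le> 2 ^ k * \<epsilon>" for k \<epsilon>
    using that
  proof (induction k arbitrary: \<epsilon>)
    case 0
    obtain x0 where x0: "x0 \<in> K" using K by blast
    have "norm_n n (diff_n x x0) \<le> \<epsilon>" if "x \<in> K" for x
      using norm_n_triangle_diff [of n x x0 "\<lambda>_. 0"] norm_n_diff_commute [of n "\<lambda>_. 0" x0] unit [OF that] unit [OF x0] 0
      by simp
    then show ?case using x0 by (intro exI [of _ "{x0}"]) simp
  next
    case (Suc k)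
    then obtain N where N: "finite N" "N \<subseteq> K" "\<And>x. x \<in> K \<Longrightarrow> \<exists>y\<in>N. norm_n n (diff_n x y) \<le> 2 * \<epsilon>"
        "real (card N) \<le> exp (100 * w\<^sup>2 / (2 * \<epsilon>)\<^sup>2)"
      using Suc.IH [of "2 * \<epsilon>"] by (auto simp: mult_ac)
    show ?case
    proof (cases "2 \<le> \<epsilon>")
      case True
      obtain x0 where x0: "x0 \<in> K" using K by blast
      have "norm_n n (diff_n x x0) \<le> \<epsilon>" if "x \<in> K" for x
        using norm_n_triangle_diff [of n x x0 "\<lambda>_. 0"] norm_n_diff_commute [of n "\<lambda>_. 0" x0] unit [OF that] unit [OF x0] True
        by simp
      then show ?thesis using x0 by (intro exI [of _ "{x0}"]) simp
    next
      case False
      define b where "b = 2 * exp (40 * w\<^sup>2 / \<epsilon>\<^sup>2)"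
      have "\<exists>P. finite P \<and> P \<subseteq> K \<and> real (card P) \<le> b \<and>
          (\<forall>x. x \<in> K \<and> norm_n n (diff_n x y) \<le> 2 * \<epsilon> \<longrightarrow> (\<exists>z\<in>P. norm_n n (diff_n x z) \<le> \<epsilon>))"
        if y: "y \<in> N" for y
      proof (rule maximal_separated [of "{x \<in> K. norm_n n (diff_n x y) \<le> 2 * \<epsilon>}" \<epsilon> "\<lambda>x y. norm_n n (diff_n x y)" b])
        fix P assume P: "finite P" "P \<subseteq> {x \<in> K. norm_n n (diff_n x y) \<le> 2 * \<epsilon>}"
          "\<forall>x\<in>P. \<forall>y\<in>P. x \<noteq> y \<longrightarrow> \<epsilon> < norm_n n (diff_n x y)"
        show "real (card P) \<le> b"
          unfolding b_def
        proof (rule local_packing [where ?x0.0 = y])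
          show "(LINT g|gaussian_vector n. max_inner n (diffs (insert y P)) g) \<le> w"
            using P y N by (intro W) auto
        qed (use P w Suc.prems in auto)
      next
        show "norm_n n (diff_n x z) = norm_n n (diff_n z x)" for x z
          by (rule norm_n_diff_commute)
        show "norm_n n (diff_n x x) = 0" for x by (simp add: norm_n_def inner_n_def)
      next
        fix P assume "finite P" "P \<subseteq> {x \<in> K. norm_n n (diff_n x y) \<le> 2 * \<epsilon>}" "real (card P) \<le> b"
          "\<And>x. x \<in> {x \<in> K. norm_n n (diff_n x y) \<le> 2 * \<epsilon>} \<Longrightarrow> \<exists>z\<in>P. norm_n n (diff_n x z) \<le> \<epsilon>"
        then show ?thesis by blast
      qed (use Suc.prems in simp)
      then have "\<forall>y\<in>N. \<exists>P. finite P \<and> P \<subseteq> K \<and> real (card P) \<le> b \<and>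
          (\<forall>x. x \<in> K \<and> norm_n n (diff_n x y) \<le> 2 * \<epsilon> \<longrightarrow> (\<exists>z\<in>P. norm_n n (diff_n x z) \<le> \<epsilon>))"
        by blast
      from bchoice [OF this] obtain f where f': "\<forall>y\<in>N. finite (f y) \<and> f y \<subseteq> K \<and> real (card (f y)) \<le> b \<and>
          (\<forall>x. x \<in> K \<and> norm_n n (diff_n x y) \<le> 2 * \<epsilon> \<longrightarrow> (\<exists>z\<in>f y. norm_n n (diff_n x z) \<le> \<epsilon>))" ..
      then have f: "\<And>y. y \<in> N \<Longrightarrow> finite (f y)" "\<And>y. y \<in> N \<Longrightarrow> f y \<subseteq> K" "\<And>y. y \<in> N \<Longrightarrow> real (card (f y)) \<le> b"
          "\<And>x y. y \<in> N \<Longrightarrow> x \<in> K \<Longrightarrow> norm_n n (diff_n x y) \<le> 2 * \<epsilon> \<Longrightarrow> \<exists>z\<in>f y. norm_n n (diff_n x z) \<le> \<epsilon>"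
        by simp_all
      let ?N = "\<Union>y\<in>N. f y"
      have "real (card ?N) \<le> (\<Sum>y\<in>N. real (card (f y)))"
        using card_UN_le [OF N(1), of f] by (metis of_nat_le_iff of_nat_sum)
      also have "\<dots> \<le> real (card N) * b"
        using sum_bounded_above [of N "\<lambda>y. real (card (f y))" b] f(3) by simp
      \<comment> \<open>The coarser net costs \<open>100 / 4 = 25\<close>, the packing 40, and 4
        absorbs the factor 2 in \<open>b\<close>, since \<open>\<epsilon> < 2\<close> and
        \<open>w \<ge> 1\<close>. The total 69 stays below 100, which closes the induction.\<close>
      also have "\<dots> \<le> exp (25 * (w\<^sup>2 / \<epsilon>\<^sup>2)) * (exp (4 * (w\<^sup>2 / \<epsilon>\<^sup>2)) * exp (40 * (w\<^sup>2 / \<epsilon>\<^sup>2)))"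
      proof (intro mult_mono)
        show "real (card N) \<le> exp (25 * (w\<^sup>2 / \<epsilon>\<^sup>2))"
          using N(4) by (simp add: power_mult_distrib)
        have "\<epsilon>\<^sup>2 \<le> 2\<^sup>2" using False Suc.prems by (intro power_mono) auto
        moreover have "1\<^sup>2 \<le> w\<^sup>2" using w by (intro power_mono) auto
        ultimately have "1 \<le> 4 * (w\<^sup>2 / \<epsilon>\<^sup>2)" using Suc.prems(1) by (simp add: field_simps)
        then have "2 \<le> exp (4 * (w\<^sup>2 / \<epsilon>\<^sup>2))"
          using exp_ge_add_one_self [of "4 * (w\<^sup>2 / \<epsilon>\<^sup>2)"] by linarith
        then show "b \<le> exp (4 * (w\<^sup>2 / \<epsilon>\<^sup>2)) * exp (40 * (w\<^sup>2 / \<epsilon>\<^sup>2))"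
          unfolding b_def by (intro mult_mono) auto
      qed (auto simp: b_def)
      also have "\<dots> = exp (69 * (w\<^sup>2 / \<epsilon>\<^sup>2))" by (simp add: mult_exp_exp)
      also have "\<dots> \<le> exp (100 * w\<^sup>2 / \<epsilon>\<^sup>2)" by (simp add: divide_right_mono)
      finally have "real (card ?N) \<le> exp (100 * w\<^sup>2 / \<epsilon>\<^sup>2)" .
      moreover have "\<exists>z\<in>?N. norm_n n (diff_n x z) \<le> \<epsilon>" if "x \<in> K" for x
        using N(3) [OF that] f(4) that by blast
      moreover have "finite ?N" "?N \<subseteq> K" using N(1) f by auto
      ultimately show ?thesis by blast
    qed
  qed
  moreover obtain k where "2 / \<epsilon> < 2 ^ k"
    using real_arch_pow [of 2 "2 / \<epsilon>"] by auto
  then have "2 \<le> 2 ^ k * \<epsilon>" using \<epsilon> by (simp add: field_simps)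
  ultimately show ?thesis using \<epsilon> by blast
qed

section \<open>Comparing finite subsets with the Gaussian width\<close>

lemma abs_inner_n_diff_le:
  assumes "norm_n n x \<le> 1" "norm_n n y \<le> 1"
  shows "\<bar>inner_n n g (diff_n x y)\<bar> \<le> 2 + 2 * (norm_n n g)\<^sup>2"
proof -
  have "norm_n n (diff_n x y) \<le> 2"
    using norm_n_triangle_diff [of n x y "\<lambda>_. 0"] norm_n_diff_commute [of n "\<lambda>_. 0" y] assms by simp
  then have "\<bar>inner_n n g (diff_n x y)\<bar> \<le> norm_n n g * 2"
    by (intro order_trans [OF inner_n_Cauchy_Schwarz] mult_left_mono) simp_all
  also have "\<dots> \<le> 2 + 2 * (norm_n n g)\<^sup>2"
  proof -
    have "0 \<le> (norm_n n g - 1)\<^sup>2" by simp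
    then have "2 * norm_n n g \<le> (norm_n n g)\<^sup>2 + 1" by (simp add: power2_diff)
    moreover have "0 \<le> (norm_n n g)\<^sup>2" by simp
    ultimately show ?thesis by linarith
  qed
  finally show ?thesis .
qed

lemma integrable_norm_sq: "integrable (gaussian_vector n) (\<lambda>g. (norm_n n g)\<^sup>2)"
proof -
  have "integrable (gaussian_vector n) (\<lambda>g. (g i)\<^sup>2)" if "i < n" for i
  proof -
    have "inner_n n g (\<lambda>j. if j = i then 1 else 0) = g i" for g
      using that by (simp add: inner_n_def if_distrib cong: if_cong)
    then show ?thesis
      using has_bochner_integral_inner_n_sq [of n "\<lambda>j. if j = i then 1 else 0"] by (simp add: has_bochner_integral_iff)
  qed
  then show ?thesis
    unfolding norm_n_sq by (intro Bochner_Integration.integrable_sum) simp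
qed

lemma continuous_on_inner_n_diff:
  "continuous_on S (\<lambda>p. inner_n n g (diff_n (fst p) (snd p)))"
proof -
  have "continuous_on S (\<lambda>p. (fst p :: nat \<Rightarrow> real) i)" "continuous_on S (\<lambda>p. (snd p :: nat \<Rightarrow> real) i)"
    for S :: "((nat \<Rightarrow> real) \<times> (nat \<Rightarrow> real)) set" and i
    by (rule continuous_on_product_then_coordinatewise, rule continuous_on_fst continuous_on_snd, rule continuous_on_id)+
  then show ?thesis
    unfolding inner_n_def by (intro continuous_on_sum continuous_on_mult continuous_on_const continuous_on_diff)
qed

text \<open>Monotonicity of the integral requires the supremum over \<open>K \<times> K\<close> to
  be integrable; otherwise its Bochner integral is 0 by convention. Measurability holds because
  continuity in the pair allows the supremum to be taken over a countable dense set; a quadratic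
  function of the norm dominates it.\<close>

lemma gaussian_width_finite_subset:
  assumes unit: "\<And>x. x \<in> K \<Longrightarrow> norm_n n x \<le> 1" and P: "finite P" "P \<noteq> {}" "P \<subseteq> K"
  shows "(LINT g|gaussian_vector n. max_inner n (diffs P) g) \<le> gaussian_width n K"
proof -
  let ?g = "gaussian_vector n"
  define f where "f g p = inner_n n g (diff_n (fst p) (snd p))" for g :: "nat \<Rightarrow> real" and p :: "(nat \<Rightarrow> real) \<times> (nat \<Rightarrow> real)"
  have bd: "\<bar>f g p\<bar> \<le> 2 + 2 * (norm_n n g)\<^sup>2" if "p \<in> K \<times> K" for g p
    unfolding f_def using that by (intro abs_inner_n_diff_le unit) auto
  then have bdd: "bdd_above (f g ` S)" if "S \<subseteq> K \<times> K" for g S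
    using that by (intro bdd_aboveI2 [of _ _ "2 + 2 * (norm_n n g)\<^sup>2"]) (use abs_le_D1 in blast)
  obtain x0 where x0: "x0 \<in> P" using P by blast
  obtain D where D: "countable D" "D \<subseteq> K \<times> K" "K \<times> K \<subseteq> closure D"
    by (rule separable)
  have "D \<noteq> {}" using D(3) x0 P(3) by auto
  have cont: "continuous_on UNIV (f g)" for g
    unfolding f_def by (rule continuous_on_inner_n_diff)
  have "(SUP p\<in>K\<times>K. f g p) = (SUP p\<in>D. f g p)" for g
  proof (rule antisym)
    have "f g p \<le> (SUP p\<in>D. f g p)" if "p \<in> closure D" for p
    proof -
      have "closed {p. f g p \<le> (SUP p\<in>D. f g p)}"
        by (intro closed_Collect_le cont continuous_on_const)
      moreover have "D \<subseteq> {p. f g p \<le> (SUP p\<in>D. f g p)}"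
        using bdd [OF D(2)] by (auto intro: cSUP_upper)
      ultimately show ?thesis using that closure_minimal by blast
    qed
    then show "(SUP p\<in>K\<times>K. f g p) \<le> (SUP p\<in>D. f g p)"
      using D(3) x0 P(3) by (intro cSUP_least) auto
    show "(SUP p\<in>D. f g p) \<le> (SUP p\<in>K\<times>K. f g p)"
      by (intro cSUP_subset_mono bdd D(2) \<open>D \<noteq> {}\<close>) auto
  qed
  then have "(\<lambda>g. SUP p\<in>K\<times>K. f g p) = (\<lambda>g. SUP p\<in>D. f g p)" by blast
  also have "\<dots> \<in> borel_measurable ?g"
    unfolding f_def using D(1) bdd [OF D(2)] by (intro borel_measurable_cSUP) (auto simp: f_def)
  finally have meas: "(\<lambda>g. SUP p\<in>K\<times>K. f g p) \<in> borel_measurable ?g" .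
  have bd': "\<bar>SUP p\<in>K\<times>K. f g p\<bar> \<le> 2 + 2 * (norm_n n g)\<^sup>2" for g
  proof -
    have "(SUP p\<in>K\<times>K. f g p) \<le> 2 + 2 * (norm_n n g)\<^sup>2"
      using bd x0 P(3) by (intro cSUP_least) (auto dest!: abs_le_D1)
    moreover have "f g (x0, x0) \<le> (SUP p\<in>K\<times>K. f g p)"
      using x0 P(3) by (intro cSUP_upper bdd) auto
    moreover have "f g (x0, x0) = 0" by (simp add: f_def inner_n_def)
    ultimately show ?thesis by simp
  qed
  have int: "integrable ?g (\<lambda>g. SUP p\<in>K\<times>K. f g p)"
  proof (rule Bochner_Integration.integrable_bound)
    show "integrable ?g (\<lambda>g. 2 + 2 * (norm_n n g)\<^sup>2)"
      using integrable_norm_sq by simp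
    show "AE g in ?g. norm (SUP p\<in>K\<times>K. f g p) \<le> norm (2 + 2 * (norm_n n g)\<^sup>2)"
      using bd' by simp
  qed (rule meas)
  have fin: "finite (diffs P)" "diffs P \<noteq> {}"
    using diffs_finite [OF P(1)] diffs_nonempty [OF P(2)] by simp_all
  have "(LINT g|?g. max_inner n (diffs P) g) \<le> (LINT g|?g. (SUP p\<in>K\<times>K. f g p))"
  proof (rule integral_mono [OF integrable_max_inner [OF fin] int])
    fix g
    obtain t where t: "t \<in> diffs P" "inner_n n g t = max_inner n (diffs P) g"
      using fin max_inner_attained by blast
    then obtain p where p: "p \<in> P \<times> P" "t = diff_n (fst p) (snd p)" unfolding diffs_def by blast
    then have "f g p \<le> (SUP p\<in>K\<times>K. f g p)"
      using P(3) by (intro cSUP_upper bdd) auto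
    then show "max_inner n (diffs P) g \<le> (SUP p\<in>K\<times>K. f g p)"
      using t(2) p(2) by (simp add: f_def)
  qed
  then show ?thesis by (simp add: gaussian_width_def f_def)
qed

section \<open>Stability of the angle\<close>

definition rows_of :: "nat \<Rightarrow> nat \<Rightarrow> (nat \<times> nat \<Rightarrow> real) \<Rightarrow> nat \<Rightarrow> nat \<Rightarrow> real" where
  "rows_of m n G = (\<lambda>i\<in>{..<m}. \<lambda>j\<in>{..<n}. G (i, j))"

lemma prob_space_gaussian_matrix: "prob_space (gaussian_matrix m n)"
  unfolding gaussian_matrix_def by (intro prob_space_PiM prob_space_std_gaussian)

lemma indep_vars_PiM_coordinates:
  assumes "\<And>i. i \<in> I \<Longrightarrow> prob_space (M i)"
  shows "prob_space.indep_vars (PiM I M) M (\<lambda>i \<omega>. \<omega> i) I"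
proof (cases "I = {}")
  case True
  interpret prob_space "PiM I M" by (rule prob_space_PiM) fact
  show ?thesis unfolding indep_vars_def indep_sets_def using True by simp
next
  case False
  interpret prob_space "PiM I M" by (rule prob_space_PiM) fact
  have "distr (PiM I M) (PiM I M) (\<lambda>\<omega>. \<lambda>i\<in>I. \<omega> i) = distr (PiM I M) (PiM I M) (\<lambda>\<omega>. \<omega>)"
    by (rule distr_cong) (auto simp: space_PiM PiE_restrict)
  also have "\<dots> = PiM I M" by (rule distr_id)
  also have "\<dots> = (\<Pi>\<^sub>M i\<in>I. distr (PiM I M) (M i) (\<lambda>\<omega>. \<omega> i))"
    by (intro PiM_cong refl distr_PiM_component [symmetric] assms)
  finally show ?thesis
    using False by (subst indep_vars_iff_distr_eq_PiM') auto
qed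

text \<open>Disjoint blocks of independent coordinates are independent, and each block is a
  reindexed Gaussian vector. Independence is translated into a product law over a nonempty index
  set, hence \<open>0 < m\<close>.\<close>

lemma distr_rows_of:
  assumes "0 < m"
  shows "distr (gaussian_matrix m n) (gaussian_rows m n) (rows_of m n) = gaussian_rows m n"
    and measurable_rows_of: "rows_of m n \<in> gaussian_matrix m n \<rightarrow>\<^sub>M gaussian_rows m n"
proof -
  let ?I = "{..<m} \<times> {..<n}" and ?M = "gaussian_matrix m n"
  interpret prob_space ?M by (rule prob_space_gaussian_matrix)
  have coord: "(\<lambda>G. G p) \<in> ?M \<rightarrow>\<^sub>M \<gamma>" if "p \<in> ?I" for p
    using that unfolding gaussian_matrix_def by (rule measurable_component_singleton)
  have rowmeas: "(\<lambda>G. \<lambda>j\<in>{..<n}. G (i, j)) \<in> ?M \<rightarrow>\<^sub>M gaussian_vector n" if "i < m" for i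
    unfolding gaussian_vector_def using that by (intro measurable_restrict coord) auto
  show "rows_of m n \<in> ?M \<rightarrow>\<^sub>M gaussian_rows m n"
    unfolding rows_of_def gaussian_rows_def by (intro measurable_restrict rowmeas) auto
  have indep: "indep_vars (\<lambda>_. gaussian_vector n) (\<lambda>i G. \<lambda>j\<in>{..<n}. G (i, j)) {..<m}"
  proof -
    have "indep_vars (\<lambda>_. \<gamma>) (\<lambda>p G. G p) ?I"
      unfolding gaussian_matrix_def by (intro indep_vars_PiM_coordinates prob_space_std_gaussian)
    then have "indep_vars (\<lambda>i. PiM ({i} \<times> {..<n}) (\<lambda>_. \<gamma>)) (\<lambda>i G. restrict (\<lambda>p. G p) ({i} \<times> {..<n})) {..<m}"
      by (rule indep_vars_restrict) (auto simp: disjoint_family_on_def)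
    then have "indep_vars (\<lambda>_. gaussian_vector n)
        (\<lambda>i G. (\<lambda>h. \<lambda>j\<in>{..<n}. h (i, j)) (restrict (\<lambda>p. G p) ({i} \<times> {..<n}))) {..<m}"
      unfolding gaussian_vector_def
      by (rule indep_vars_compose2) (intro measurable_restrict measurable_component_singleton, auto)
    then show ?thesis
      by (rule indep_vars_cong [THEN iffD1, rotated -1]) (auto simp: fun_eq_iff)
  qed
  have row: "distr ?M (gaussian_vector n) (\<lambda>G. \<lambda>j\<in>{..<n}. G (i, j)) = gaussian_vector n" if "i < m" for i
    unfolding gaussian_matrix_def gaussian_vector_def
    using that by (intro distr_PiM_reindex [where f = "\<lambda>j. (i, j)"] prob_space_std_gaussian) (auto simp: inj_on_def)
  have "distr ?M (gaussian_rows m n) (rows_of m n) =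
      (\<Pi>\<^sub>M i\<in>{..<m}. distr ?M (gaussian_vector n) (\<lambda>G. \<lambda>j\<in>{..<n}. G (i, j)))"
    unfolding gaussian_rows_def rows_of_def
    using indep assms rowmeas by (subst (asm) indep_vars_iff_distr_eq_PiM') auto
  also have "\<dots> = gaussian_rows m n"
    unfolding gaussian_rows_def by (intro PiM_cong refl row) simp
  finally show "distr ?M (gaussian_rows m n) (rows_of m n) = gaussian_rows m n" .
qed

text \<open>All squared norms are at least \<open>\<beta>\<^sup>2 / 2\<close> in the limit, so
  \<delta> is a relative error of at most \<open>r\<close>. The denominator, a geometric mean of two
  quantities with relative error \<open>r\<close>, again has relative error \<open>r\<close>.
  Numerator and denominator together contribute \<open>2 * r\<close>.\<close>

lemma quotient_stability:
  fixes a b p q p0 q0 :: real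
  assumes \<beta>: "0 < \<beta>" and \<delta>: "0 \<le> \<delta>" "\<delta> \<le> \<beta>\<^sup>2 / 8"
    and a: "\<bar>a - b\<bar> \<le> \<delta>" "\<bar>a\<bar> \<le> sqrt p * sqrt q"
    and p: "\<bar>p - p0\<bar> \<le> \<delta>" "\<beta>\<^sup>2 / 2 \<le> p0" and q: "\<bar>q - q0\<bar> \<le> \<delta>" "\<beta>\<^sup>2 / 2 \<le> q0"
  shows "\<bar>a / (sqrt p * sqrt q) - b / (sqrt p0 * sqrt q0)\<bar> \<le> 4 * \<delta> / \<beta>\<^sup>2"
proof -
  define r A B where "r = 2 * \<delta> / \<beta>\<^sup>2" and "A = sqrt p * sqrt q" and "B = sqrt p0 * sqrt q0"
  have b2: "0 < \<beta>\<^sup>2" using \<beta> by simp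
  have r: "0 \<le> r" "r \<le> 1" using b2 \<delta> by (simp_all add: r_def divide_le_eq)
  have d: "\<delta> = r * (\<beta>\<^sup>2 / 2)" using b2 by (simp add: r_def)
  have p0: "0 < p0" "0 < q0" using p(2) q(2) b2 by linarith+
  have dp: "\<delta> \<le> r * p0" "\<delta> \<le> r * q0" 
    unfolding d by (rule mult_left_mono [OF p(2) r(1)], rule mult_left_mono [OF q(2) r(1)])
  have pu: "p \<le> (1 + r) * p0" "(1 - r) * p0 \<le> p" "q \<le> (1 + r) * q0" "(1 - r) * q0 \<le> q"
    using p(1) q(1) dp by (simp_all add: algebra_simps abs_le_iff)
  have pq: "0 < p" "0 < q"
    using p q \<delta>(2) b2 by linarith+
  have AB: "0 < A" "0 < B" using pq p0 by (simp_all add: A_def B_def)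
  have A2: "A\<^sup>2 = p * q" "B\<^sup>2 = p0 * q0" using pq p0 by (simp_all add: A_def B_def power_mult_distrib)
  have "A\<^sup>2 \<le> ((1 + r) * p0) * ((1 + r) * q0)"
    unfolding A2 using pu pq r p0 by (intro mult_mono) auto
  also have "\<dots> = ((1 + r) * B)\<^sup>2" by (simp add: power_mult_distrib A2) (simp add: power2_eq_square)
  finally have up: "A \<le> (1 + r) * B" by (rule power2_le_imp_le) (use r AB in simp)
  have "((1 - r) * B)\<^sup>2 = ((1 - r) * p0) * ((1 - r) * q0)"
    by (simp add: power_mult_distrib A2) (simp add: power2_eq_square)
  also have "\<dots> \<le> A\<^sup>2"
    unfolding A2 using pu pq r p0 by (intro mult_mono) auto
  finally have lo: "(1 - r) * B \<le> A" by (rule power2_le_imp_le) (use AB in simp)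
  have BA: "\<bar>B - A\<bar> \<le> r * B" using up lo by (simp add: algebra_simps abs_le_iff)
  have "(\<beta>\<^sup>2 / 2)\<^sup>2 \<le> B\<^sup>2"
    unfolding A2(2) power2_eq_square [of "\<beta>\<^sup>2 / 2"] using p(2) q(2) p0 by (intro mult_mono) auto
  then have "\<beta>\<^sup>2 / 2 \<le> B" by (rule power2_le_imp_le) (use AB in simp)
  then have dB: "\<delta> \<le> r * B" unfolding d by (rule mult_left_mono) (rule r(1))
  have "\<bar>a / A\<bar> \<le> 1" using a(2) AB by (simp add: A_def [symmetric])
  then have "\<bar>(a / A) * (B - A)\<bar> \<le> 1 * \<bar>B - A\<bar>"
    unfolding abs_mult by (intro mult_right_mono) auto
  then have "\<bar>(a / A) * (B - A)\<bar> \<le> r * B" using BA by simp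
  then have num: "\<bar>(a - b) + (a / A) * (B - A)\<bar> \<le> r * B + r * B"
    by (intro order_trans [OF abs_triangle_ineq] add_mono order_trans [OF a(1) dB])
  \<comment> \<open>Written so that the error of the denominator is multiplied by
    \<open>a / A\<close>, which Cauchy-Schwarz bounds by 1.\<close>
  have "a / A - b / B = ((a - b) + (a / A) * (B - A)) / B"
    using AB by (simp add: field_simps)
  then have "\<bar>a / A - b / B\<bar> = \<bar>(a - b) + (a / A) * (B - A)\<bar> / B"
    using AB by (simp only: abs_divide abs_of_pos)
  also have "\<dots> \<le> (r * B + r * B) / B"
    by (rule divide_right_mono [OF num]) (use AB in simp)
  also have "\<dots> = 4 * \<delta> / \<beta>\<^sup>2" using AB by (simp add: r_def)
  finally show ?thesis by (simp add: A_def B_def)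
qed

text \<open>With the scaling \<open>1 / sqrt m\<close> the inner products of layer outputs are the
  empirical averages. Dividing the kernel by its diagonal square roots leaves
  \<open>cos + psi\<close>, and the diagonal, half the squared norm, keeps the outputs away from
  0.\<close>

lemma cos_angle_n_relu_layer:
  assumes m: "0 < m" and \<beta>: "0 < \<beta>" and \<delta>: "0 < \<delta>" "\<delta> \<le> \<beta>\<^sup>2 / 8"
    and K: "K \<subseteq> annulus n \<beta>" and x: "x \<in> K" and y: "y \<in> K"
    and close: "\<And>x y. x \<in> K \<Longrightarrow> y \<in> K \<Longrightarrow>
      \<bar>(\<Sum>i<m. relu (inner_n n (rows_of m n G i) x) * relu (inner_n n (rows_of m n G i) y)) - real m * relu_kernel n x y\<bar> \<le> \<delta> * real m"
  defines "u \<equiv> relu_layer m n (\<lambda>ij. G ij / sqrt (real m)) x" and "v \<equiv> relu_layer m n (\<lambda>ij. G ij / sqrt (real m)) y"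
  shows "norm_n m u \<noteq> 0 \<and> norm_n m v \<noteq> 0 \<and>
     \<bar>cos (angle_n m u v) - (cos (angle_n n x y) + psi n x y)\<bar> \<le> 15 * \<delta> / (\<beta>\<^sup>2 - 2 * \<delta>)"
proof -
  let ?L = "relu_layer m n (\<lambda>ij. G ij / sqrt (real m))"
  let ?k = "relu_kernel n"
  have layer: "?L z i = relu (inner_n n (rows_of m n G i) z) / sqrt (real m)" if "i < m" for z i
  proof -
    have "(\<Sum>j<n. G (i, j) / sqrt (real m) * z j) = (1 / sqrt (real m)) * inner_n n (rows_of m n G i) z"
      using that by (simp add: inner_n_def rows_of_def sum_distrib_left)
    then show ?thesis
      using that relu_mult [of "1 / sqrt (real m)" "inner_n n (rows_of m n G i) z"] by (simp add: relu_layer_def)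
  qed
  have inner: "inner_n m (?L z) (?L z') =
      (\<Sum>i<m. relu (inner_n n (rows_of m n G i) z) * relu (inner_n n (rows_of m n G i) z')) / real m" for z z'
    unfolding inner_n_def [of m] sum_divide_distrib by (intro sum.cong refl) (simp add: layer)
  have err: "\<bar>inner_n m (?L z) (?L z') - ?k z z'\<bar> \<le> \<delta>" if "z \<in> K" "z' \<in> K" for z z'
  proof -
    have "inner_n m (?L z) (?L z') - ?k z z' =
      ((\<Sum>i<m. relu (inner_n n (rows_of m n G i) z) * relu (inner_n n (rows_of m n G i) z')) - real m * ?k z z') / real m"
      using m by (simp add: inner diff_divide_distrib)
    then show ?thesis using close [OF that] m by (simp add: abs_divide divide_le_eq)
  qed
  have nK: "\<beta> < norm_n n z" if "z \<in> K" for z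
    using K that by (auto simp: annulus_def)
  have self: "?k z z = (norm_n n z)\<^sup>2 / 2" "\<beta>\<^sup>2 / 2 \<le> ?k z z" if "z \<in> K" for z
  proof -
    show "?k z z = (norm_n n z)\<^sup>2 / 2"
      using nK [OF that] \<beta> by (intro relu_kernel_self) auto
    then show "\<beta>\<^sup>2 / 2 \<le> ?k z z"
      using nK [OF that] \<beta> by (simp add: power_mono)
  qed
  have pos: "0 < inner_n m (?L z) (?L z)" if "z \<in> K" for z
    using err [OF that that] self(2) [OF that] \<delta> by (simp add: abs_le_iff)
  have nz: "norm_n m (?L z) \<noteq> 0" if "z \<in> K" for z
    using pos [OF that] by (simp add: norm_n_def)
  have norms: "norm_n n x * norm_n n y / 2 = sqrt (?k x x) * sqrt (?k y y)"
    by (simp add: self(1) x y real_sqrt_divide)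
  have "norm_n n x * norm_n n y \<noteq> 0" using nK [OF x] nK [OF y] \<beta> by auto
  then have limit: "cos (angle_n n x y) + psi n x y = ?k x y / (sqrt (?k x x) * sqrt (?k y y))"
    unfolding norms [symmetric] by (simp add: relu_kernel_def)
  have P: "0 < norm_n m u * norm_n m v"
    using nz [OF x] nz [OF y] by (simp add: u_def v_def order_less_le)
  have "\<bar>inner_n m u v / (norm_n m u * norm_n m v)\<bar> \<le> 1"
    using inner_n_Cauchy_Schwarz [of m u v]
    by (simp only: abs_divide abs_of_pos [OF P] pos_divide_le_eq [OF P] mult_1)
  then have "cos (angle_n m u v) = inner_n m u v / (norm_n m u * norm_n m v)"
    unfolding angle_n_def by (rule cos_arccos_abs)
  also have "\<dots> = inner_n m u v / (sqrt (inner_n m u u) * sqrt (inner_n m v v))"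
    by (simp add: norm_n_def)
  finally have "\<bar>cos (angle_n m u v) - (cos (angle_n n x y) + psi n x y)\<bar> =
      \<bar>inner_n m u v / (sqrt (inner_n m u u) * sqrt (inner_n m v v)) - ?k x y / (sqrt (?k x x) * sqrt (?k y y))\<bar>"
    unfolding limit by simp
  also have "\<dots> \<le> 4 * \<delta> / \<beta>\<^sup>2"
  proof (rule quotient_stability [OF \<beta>])
    show "\<bar>inner_n m u v\<bar> \<le> sqrt (inner_n m u u) * sqrt (inner_n m v v)"
      using inner_n_Cauchy_Schwarz [of m u v] by (simp add: norm_n_def)
  qed (use \<delta> err x y self in \<open>auto simp: u_def v_def\<close>)
  \<comment> \<open>The numerator grows and the denominator shrinks while staying positive.\<close>
  also have "\<dots> \<le> 15 * \<delta> / (\<beta>\<^sup>2 - 2 * \<delta>)"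
    using \<delta> \<beta> by (intro frac_le) auto
  finally show ?thesis using nz x y by (simp add: u_def v_def)
qed

section \<open>Uniform convergence and the theorem\<close>

text \<open>Continuity of the measure from below along an enumeration; it relies on \<open>b\<close>
  being the same for all finite subsets.\<close>

lemma emeasure_ex_countable_le:
  assumes S: "countable S" "S \<noteq> {}"
    and meas: "\<And>z. z \<in> S \<Longrightarrow> {x \<in> space M. Q z x} \<in> sets M"
    and fin: "\<And>F. finite F \<Longrightarrow> F \<noteq> {} \<Longrightarrow> F \<subseteq> S \<Longrightarrow> emeasure M {x \<in> space M. \<exists>z\<in>F. Q z x} \<le> b"
  shows "emeasure M {x \<in> space M. \<exists>z\<in>S. Q z x} \<le> b"
proof -
  define e where "e = from_nat_into S"
  have e: "range e = S" using S by (simp add: e_def range_from_nat_into)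
  define A where "A k = {x \<in> space M. \<exists>z\<in>e ` {..k}. Q z x}" for k
  have A: "A k \<in> sets M" for k
  proof -
    have "A k = (\<Union>i\<in>{..k}. {x \<in> space M. Q (e i) x})" by (auto simp: A_def)
    then show ?thesis using meas e by auto
  qed
  have "{x \<in> space M. \<exists>z\<in>S. Q z x} = (\<Union>k. A k)"
    unfolding A_def e [symmetric] by auto
  also have "emeasure M \<dots> = (SUP k. emeasure M (A k))"
    using A by (intro SUP_emeasure_incseq [symmetric]) (auto simp: incseq_def A_def intro: order_trans)
  also have "\<dots> \<le> b"
    unfolding A_def using e by (intro SUP_least fin) auto
  finally show ?thesis .
qed

lemma measurable_sq_rows [measurable]:
  "(\<lambda>G. \<Sum>i<m. (inner_n n (G i) z)\<^sup>2) \<in> borel_measurable (gaussian_rows m n)"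
proof (rule borel_measurable_sum)
  fix i assume "i \<in> {..<m}"
  then have [measurable]: "(\<lambda>G. G i) \<in> gaussian_rows m n \<rightarrow>\<^sub>M gaussian_vector n"
    by (intro measurable_gaussian_rows_component) simp
  show "(\<lambda>G. (inner_n n (G i) z)\<^sup>2) \<in> borel_measurable (gaussian_rows m n)"
    by measurable
qed

text \<open>Two scales are combined: the short differences have norm at most \<epsilon>, which
  multiplies \<open>m\<close>, while the mean of their maximum is bounded by the mean over all
  differences of their endpoints.\<close>

lemma gaussian_rows_oscillation:
  assumes D: "countable D" "D \<noteq> {}" "D \<subseteq> K \<times> K"
    and small: "\<And>p. p \<in> D \<Longrightarrow> norm_n n (diff_n (fst p) (snd p)) \<le> \<epsilon>" and "0 < \<epsilon>"
    and W: "\<And>P. finite P \<Longrightarrow> P \<noteq> {} \<Longrightarrow> P \<subseteq> K \<Longrightarrow> (LINT g|gaussian_vector n. max_inner n (diffs P) g) \<le> w"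
  shows "emeasure (gaussian_rows m n) {G \<in> space (gaussian_rows m n).
      \<exists>p\<in>D. 4 * w\<^sup>2 + 2 * pi\<^sup>2 * \<epsilon>\<^sup>2 * real m \<le> (\<Sum>i<m. (inner_n n (G i) (diff_n (fst p) (snd p)))\<^sup>2)}
    \<le> ennreal (exp (- (real m / 2)))"
proof (rule emeasure_ex_countable_le [OF D(1,2)])
  fix p
  show "{G \<in> space (gaussian_rows m n).
      4 * w\<^sup>2 + 2 * pi\<^sup>2 * \<epsilon>\<^sup>2 * real m \<le> (\<Sum>i<m. (inner_n n (G i) (diff_n (fst p) (snd p)))\<^sup>2)} \<in> sets (gaussian_rows m n)"
    by measurable
next
  fix F assume F: "finite F" "F \<noteq> {}" "F \<subseteq> D"
  define T where "T = (\<lambda>p. diff_n (fst p) (snd p)) ` F"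
  define P where "P = fst ` F \<union> snd ` F"
  have T: "finite T" "T \<noteq> {}" using F by (auto simp: T_def)
  have P: "finite P" "P \<noteq> {}" "P \<subseteq> K" using F D(3) by (auto simp: P_def)
  have sub: "T \<subseteq> diffs P" by (auto simp: T_def P_def intro!: diffsI)
  have fin: "finite (diffs P)" "diffs P \<noteq> {}"
    using diffs_finite [OF P(1)] diffs_nonempty [OF P(2)] by simp_all
  have "(LINT g|gaussian_vector n. max_inner n T g) \<le> (LINT g|gaussian_vector n. max_inner n (diffs P) g)"
  proof (rule integral_mono [OF integrable_max_inner [OF T] integrable_max_inner [OF fin]])
    fix g
    show "max_inner n T g \<le> max_inner n (diffs P) g"
      unfolding max_inner_def using T sub fin(1) by (intro Max_mono) auto
  qed
  also have "\<dots> \<le> w" by (rule W [OF P])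
  finally have "emeasure (gaussian_rows m n) {G \<in> space (gaussian_rows m n).
      \<exists>z\<in>T. 4 * w\<^sup>2 + 2 * pi\<^sup>2 * \<epsilon>\<^sup>2 * real m \<le> (\<Sum>i<m. (inner_n n (G i) z)\<^sup>2)} \<le> ennreal (exp (- (real m / 2)))"
    using small F(3) \<open>0 < \<epsilon>\<close> by (intro gaussian_rows_sup_norm [OF T]) (auto simp: T_def)
  then show "emeasure (gaussian_rows m n) {G \<in> space (gaussian_rows m n).
      \<exists>p\<in>F. 4 * w\<^sup>2 + 2 * pi\<^sup>2 * \<epsilon>\<^sup>2 * real m \<le> (\<Sum>i<m. (inner_n n (G i) (diff_n (fst p) (snd p)))\<^sup>2)}
    \<le> ennreal (exp (- (real m / 2)))"
    by (simp add: T_def)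
qed

lemma inner_n_perturb:
  "\<bar>inner_n m a b - inner_n m a' b'\<bar> \<le> norm_n m (diff_n a a') * norm_n m b + norm_n m a' * norm_n m (diff_n b b')"
proof -
  have "inner_n m a b - inner_n m a' b' = inner_n m (diff_n a a') b + inner_n m a' (diff_n b b')"
    by (simp add: inner_n_def sum_subtractf [symmetric] sum.distrib [symmetric] algebra_simps)
  then show ?thesis
    using inner_n_Cauchy_Schwarz [of m "diff_n a a'" b] inner_n_Cauchy_Schwarz [of m a' "diff_n b b'"] by linarith
qed

lemma norm_relu_diff_le:
  assumes "(\<Sum>i<m. (inner_n n (R i) (diff_n x y))\<^sup>2) \<le> c\<^sup>2" "0 \<le> c"
  shows "norm_n m (diff_n (\<lambda>i. relu (inner_n n (R i) x)) (\<lambda>i. relu (inner_n n (R i) y))) \<le> c"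
proof (rule power2_le_imp_le)
  have "(norm_n m (diff_n (\<lambda>i. relu (inner_n n (R i) x)) (\<lambda>i. relu (inner_n n (R i) y))))\<^sup>2 \<le>
      (\<Sum>i<m. (inner_n n (R i) (diff_n x y))\<^sup>2)"
    unfolding norm_n_sq inner_n_diff_right
    by (intro sum_mono) (simp add: abs_le_square_iff [symmetric] relu_lipschitz)
  then show "(norm_n m (diff_n (\<lambda>i. relu (inner_n n (R i) x)) (\<lambda>i. relu (inner_n n (R i) y))))\<^sup>2 \<le> c\<^sup>2"
    using assms(1) by linarith
qed fact

lemma uniform_relu_products:
  assumes m: "0 < m" and K: "K \<noteq> {}" and unit: "\<And>x. x \<in> K \<Longrightarrow> norm_n n x \<le> 1" and nz: "\<And>x. x \<in> K \<Longrightarrow> norm_n n x \<noteq> 0"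
    and w: "1 \<le> w" and \<delta>: "0 < \<delta>" "\<delta> \<le> 1" and mw: "10 ^ 11 * w\<^sup>2 \<le> \<delta> ^ 4 * real m"
    and W: "\<And>P. finite P \<Longrightarrow> P \<noteq> {} \<Longrightarrow> P \<subseteq> K \<Longrightarrow> (LINT g|gaussian_vector n. max_inner n (diffs P) g) \<le> w"
  obtains A where "A \<in> sets (gaussian_rows m n)"
    "1 - 3 * exp (- (\<delta>\<^sup>2 * real m / 12288)) \<le> measure (gaussian_rows m n) A"
    "\<And>R x y. R \<in> A \<Longrightarrow> x \<in> K \<Longrightarrow> y \<in> K \<Longrightarrow>
      \<bar>(\<Sum>i<m. relu (inner_n n (R i) x) * relu (inner_n n (R i) y)) - real m * relu_kernel n x y\<bar> \<le> \<delta> * real m"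
proof -
  let ?R = "gaussian_rows m n" and ?k = "relu_kernel n"
  let ?S = "\<lambda>R x y. \<Sum>i<m. relu (inner_n n (R i) x) * relu (inner_n n (R i) y)"
  let ?q = "\<lambda>R p. \<Sum>i<m. (inner_n n (R i) (diff_n (fst p) (snd p)))\<^sup>2"
  \<comment> \<open>The error budget in units of \<open>\<delta> * m\<close>: \<open>1 / 4\<close>
    on the net, \<open>3 * \<tau> / \<delta> = 3 / 32\<close> for moving the empirical product to
    the net, and \<open>2 * \<epsilon> / \<delta> = 1 / 100\<close> for moving the kernel.\<close>
  define \<epsilon> \<tau> where "\<epsilon> = \<delta> / 200" and "\<tau> = \<delta> / 32"
  have \<epsilon>: "0 < \<epsilon>" using \<delta> by (simp add: \<epsilon>_def)
  have w2: "10 ^ 11 * (w\<^sup>2 / \<delta>\<^sup>2) \<le> \<delta>\<^sup>2 * real m"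
  proof -
    have "10 ^ 11 * (w\<^sup>2 / \<delta>\<^sup>2) = (10 ^ 11 * w\<^sup>2) / \<delta>\<^sup>2" by simp
    also have "\<dots> \<le> (\<delta> ^ 4 * real m) / \<delta>\<^sup>2"
      by (intro divide_right_mono mw) simp
    also have "\<dots> = \<delta>\<^sup>2 * real m" using \<delta> by (simp add: power4_eq_xxxx power2_eq_square)
    finally show ?thesis .
  qed
  obtain N where N: "finite N" "N \<subseteq> K" "\<And>x. x \<in> K \<Longrightarrow> \<exists>y\<in>N. norm_n n (diff_n x y) \<le> \<epsilon>"
      "real (card N) \<le> exp (100 * w\<^sup>2 / \<epsilon>\<^sup>2)"
    using sudakov_net [OF K unit w W \<epsilon>] by blast
  define S where "S = {p \<in> K \<times> K. norm_n n (diff_n (fst p) (snd p)) \<le> \<epsilon>}"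
  \<comment> \<open>Density is taken among the close pairs themselves. Countability makes the bad
    event measurable, and the closed condition on its complement extends to all of
    \<open>S\<close>.\<close>
  obtain D where D: "countable D" "D \<subseteq> S" "S \<subseteq> closure D"
    by (rule separable)
  have "D \<noteq> {}"
  proof -
    obtain x where "x \<in> K" using K by blast
    then have "(x, x) \<in> S" using \<epsilon> by (simp add: S_def norm_n_def inner_n_def)
    then show ?thesis using D(3) by auto
  qed
  \<comment> \<open>The level of \<open>gaussian_rows_oscillation\<close>. With
    \<open>pi \<le> 4\<close> its second term is at most \<open>32 / 40000 < 1 / 1024\<close> times
    \<open>\<delta>\<^sup>2 * m\<close>, which leaves room for the width term.\<close>
  define thr where "thr = 4 * w\<^sup>2 + 2 * pi\<^sup>2 * \<epsilon>\<^sup>2 * real m"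
  have thr: "thr \<le> (\<tau> * sqrt (real m))\<^sup>2"
  proof -
    have "w\<^sup>2 = \<delta>\<^sup>2 * (w\<^sup>2 / \<delta>\<^sup>2)" using \<delta> by simp
    also have "\<dots> \<le> \<delta>\<^sup>2 * (\<delta>\<^sup>2 * real m / 10 ^ 11)"
      using w2 by (intro mult_left_mono) (simp_all add: field_simps)
    also have "\<dots> \<le> 1 * (\<delta>\<^sup>2 * real m / 10 ^ 11)"
      using \<delta> by (intro mult_right_mono) (simp_all add: power_le_one)
    finally have 1: "w\<^sup>2 \<le> \<delta>\<^sup>2 * real m / 10 ^ 11" by simp
    have "pi \<le> 4" using pi_less_4 by simp
    then have "pi\<^sup>2 \<le> 4\<^sup>2" by (intro power_mono) auto
    then have "pi\<^sup>2 * (\<delta>\<^sup>2 * real m) \<le> 4\<^sup>2 * (\<delta>\<^sup>2 * real m)"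
      by (intro mult_right_mono) auto
    then have 2: "2 * pi\<^sup>2 * \<epsilon>\<^sup>2 * real m \<le> 32 / 40000 * (\<delta>\<^sup>2 * real m)"
      by (simp add: \<epsilon>_def power_divide mult_ac)
    have "0 \<le> \<delta>\<^sup>2 * real m" by simp
    moreover have "w\<^sup>2 \<le> \<delta>\<^sup>2 * real m / 100000000000" using 1 by simp
    ultimately have "thr \<le> 1 / 1024 * (\<delta>\<^sup>2 * real m)"
      unfolding thr_def using 2 by linarith
    also have "\<dots> = (\<tau> * sqrt (real m))\<^sup>2"
      by (simp add: \<tau>_def power_mult_distrib power_divide)
    finally show ?thesis .
  qed
  define bad where "bad p = {R \<in> space ?R. (\<delta> / 4) * real m \<le> \<bar>?S R (fst p) (snd p) - real m * ?k (fst p) (snd p)\<bar>}"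
    for p :: "(nat \<Rightarrow> real) \<times> (nat \<Rightarrow> real)"
  define B1 where "B1 = (\<Union>p\<in>N \<times> N. bad p)"
  define B2 where "B2 = {R \<in> space ?R. \<exists>p\<in>D. thr \<le> ?q R p}"
  have bad_sets: "bad p \<in> sets ?R" for p
    unfolding bad_def by measurable
  have B1_sets: "B1 \<in> sets ?R"
    unfolding B1_def using N(1) by (intro sets.finite_UN bad_sets) auto
  have B2_sets: "B2 \<in> sets ?R"
  proof -
    have "B2 = (\<Union>p\<in>D. {R \<in> space ?R. thr \<le> ?q R p})" by (auto simp: B2_def)
    also have "\<dots> \<in> sets ?R"
      by (intro sets.countable_UN'' D(1)) measurable
    finally show ?thesis .
  qed
  have "emeasure ?R B1 \<le> (\<Sum>p\<in>N \<times> N. emeasure ?R (bad p))"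
    unfolding B1_def using N(1) bad_sets by (intro emeasure_subadditive_finite) auto
  also have "\<dots> \<le> (\<Sum>p\<in>N \<times> N. ennreal (2 * exp (- ((\<delta> / 4)\<^sup>2 * real m / 384))))"
    unfolding bad_def using \<delta> N(2) unit nz
    by (intro sum_mono relu_prod_bernstein) auto
  also have "\<dots> = ennreal (real (card N * card N) * (2 * exp (- ((\<delta> / 4)\<^sup>2 * real m / 384))))"
    by (simp add: ennreal_of_nat_eq_real_of_nat ennreal_mult [symmetric] card_cartesian_product)
  also have "\<dots> \<le> ennreal (2 * exp (- (\<delta>\<^sup>2 * real m / 12288)))"
  proof (rule ennreal_leI)
    have "real (card N * card N) \<le> exp (100 * w\<^sup>2 / \<epsilon>\<^sup>2) * exp (100 * w\<^sup>2 / \<epsilon>\<^sup>2)"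
      unfolding of_nat_mult by (intro mult_mono N(4)) auto
    then have "real (card N * card N) * (2 * exp (- ((\<delta> / 4)\<^sup>2 * real m / 384))) \<le>
        exp (100 * w\<^sup>2 / \<epsilon>\<^sup>2) * exp (100 * w\<^sup>2 / \<epsilon>\<^sup>2) * (2 * exp (- ((\<delta> / 4)\<^sup>2 * real m / 384)))"
      by (rule mult_right_mono) simp
    \<comment> \<open>\<open>8000000 = 2 * 100 * 200\<^sup>2\<close> comes from the pairs of net
      points. The constant \<open>10 ^ 11\<close> lets half of the Bernstein exponent pay for it, so
      6144 becomes 12288.\<close>
    also have "\<dots> = 2 * exp (8000000 * (w\<^sup>2 / \<delta>\<^sup>2) - \<delta>\<^sup>2 * real m / 6144)"
      by (simp add: mult_exp_exp \<epsilon>_def power_divide)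
    also have "\<dots> \<le> 2 * exp (- (\<delta>\<^sup>2 * real m / 12288))"
    proof -
      have "100000000000 * (w\<^sup>2 / \<delta>\<^sup>2) \<le> \<delta>\<^sup>2 * real m" using w2 by simp
      moreover have "0 \<le> \<delta>\<^sup>2 * real m" by simp
      ultimately have "8000000 * (w\<^sup>2 / \<delta>\<^sup>2) - \<delta>\<^sup>2 * real m / 6144 \<le> - (\<delta>\<^sup>2 * real m / 12288)"
        by linarith
      then show ?thesis by (intro mult_left_mono) (simp_all only: exp_le_cancel_iff zero_le_numeral)
    qed
    finally show "real (card N * card N) * (2 * exp (- ((\<delta> / 4)\<^sup>2 * real m / 384))) \<le> 2 * exp (- (\<delta>\<^sup>2 * real m / 12288))" .
  qed
  finally have B1: "measure ?R B1 \<le> 2 * exp (- (\<delta>\<^sup>2 * real m / 12288))"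
    by (simp add: gaussian_rows.emeasure_eq_measure)
  have "emeasure ?R B2 \<le> ennreal (exp (- (real m / 2)))"
    unfolding B2_def thr_def
    by (rule gaussian_rows_oscillation [OF D(1) \<open>D \<noteq> {}\<close> _ _ \<epsilon> W]) (use D(2) in \<open>auto simp: S_def\<close>)
  then have "measure ?R B2 \<le> exp (- (real m / 2))"
    by (simp add: gaussian_rows.emeasure_eq_measure)
  also have "\<dots> \<le> exp (- (\<delta>\<^sup>2 * real m / 12288))"
  proof -
    have "\<delta>\<^sup>2 * real m \<le> 1 * real m"
      using \<delta> by (intro mult_right_mono) (simp_all add: power_le_one)
    moreover have "0 \<le> real m" by simp
    ultimately have "\<delta>\<^sup>2 * real m / 12288 \<le> real m / 2" by linarith
    then show ?thesis by (simp only: exp_le_cancel_iff neg_le_iff_le)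
  qed
  finally have B2: "measure ?R B2 \<le> exp (- (\<delta>\<^sup>2 * real m / 12288))" .
  have "measure ?R (B1 \<union> B2) \<le> 3 * exp (- (\<delta>\<^sup>2 * real m / 12288))"
    using measure_Un_le [OF B1_sets B2_sets] B1 B2 by linarith
  then have prob: "1 - 3 * exp (- (\<delta>\<^sup>2 * real m / 12288)) \<le> measure ?R (space ?R - (B1 \<union> B2))"
    using B1_sets B2_sets by (subst gaussian_rows.prob_compl) auto
  have good: "\<bar>?S R x y - real m * ?k x y\<bar> \<le> \<delta> * real m"
    if R: "R \<in> space ?R - (B1 \<union> B2)" and x: "x \<in> K" and y: "y \<in> K" for R x y
  proof -
    define v where "v z = (\<lambda>i. relu (inner_n n (R i) z))" for z
    have Sv: "?S R z z' = inner_n m (v z) (v z')" for z z' by (simp add: v_def inner_n_def)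
    define s where "s = sqrt (real m)"
    have s: "0 \<le> s" "s * s = real m" by (simp_all add: s_def)
    have osc: "norm_n m (diff_n (v z) (v z')) \<le> \<tau> * s" if "z \<in> K" "z' \<in> K" "norm_n n (diff_n z z') \<le> \<epsilon>" for z z'
    proof -
      have "closed {p. ?q R p \<le> thr}"
        by (intro closed_Collect_le continuous_on_sum continuous_on_power continuous_on_inner_n_diff continuous_on_const)
      moreover have "D \<subseteq> {p. ?q R p \<le> thr}" using R by (auto simp: B2_def not_le intro: less_imp_le)
      ultimately have "closure D \<subseteq> {p. ?q R p \<le> thr}" by (intro closure_minimal)
      moreover have "(z, z') \<in> S" using that by (simp add: S_def)
      ultimately have "?q R (z, z') \<le> thr" using D(3) by blast
      then have "(\<Sum>i<m. (inner_n n (R i) (diff_n z z'))\<^sup>2) \<le> (\<tau> * s)\<^sup>2"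
        using thr by (simp add: s_def)
      then show ?thesis
        unfolding v_def using \<delta> s by (intro norm_relu_diff_le) (auto simp: \<tau>_def)
    qed
    have net: "\<bar>?S R z z' - real m * ?k z z'\<bar> \<le> (\<delta> / 4) * real m" if "z \<in> N" "z' \<in> N" for z z'
      using R that by (force simp: B1_def bad_def not_le)
    obtain x0 y0 where x0: "x0 \<in> N" "norm_n n (diff_n x x0) \<le> \<epsilon>" and y0: "y0 \<in> N" "norm_n n (diff_n y y0) \<le> \<epsilon>"
      using N(3) x y by blast
    have K0: "x0 \<in> K" "y0 \<in> K" using x0 y0 N(2) by auto
    \<comment> \<open>The diagonal case of the net estimate: the average of the squares is at most
      \<open>1 / 2 + 1 / 4\<close>.\<close>
    have nv: "norm_n m (v z) \<le> s" if "z \<in> N" for z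
    proof (rule power2_le_imp_le [OF _ s(1)])
      have zK: "z \<in> K" using that N(2) by auto
      have "?k z z \<le> 1 / 2"
        using relu_kernel_self [OF nz [OF zK]] unit [OF zK] by (simp add: power_le_one)
      then have "real m * ?k z z \<le> real m * (1 / 2)" by (intro mult_left_mono) auto
      moreover have "(\<delta> / 4) * real m \<le> (1 / 4) * real m" using \<delta> by (intro mult_right_mono) auto
      ultimately have "?S R z z \<le> real m" using net [OF that that] by linarith
      then show "(norm_n m (v z))\<^sup>2 \<le> s\<^sup>2"
        by (simp only: inner_n_self [symmetric] Sv power2_eq_square [of s] s(2))
    qed
    have ts: "\<tau> * s \<le> 1 * s" using \<delta> s by (intro mult_right_mono) (simp_all add: \<tau>_def)
    have nvy: "norm_n m (v y) \<le> 2 * s"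
      using norm_n_triangle [of m "v y" "v y0"] nv [OF y0(1)] osc [OF y K0(2) y0(2)] ts by linarith
    have "\<bar>?S R x y - ?S R x0 y0\<bar> \<le>
        norm_n m (diff_n (v x) (v x0)) * norm_n m (v y) + norm_n m (v x0) * norm_n m (diff_n (v y) (v y0))"
      unfolding Sv by (rule inner_n_perturb)
    also have "\<dots> \<le> (\<tau> * s) * (2 * s) + s * (\<tau> * s)"
      using osc [OF x K0(1) x0(2)] osc [OF y K0(2) y0(2)] nvy nv [OF x0(1)] s \<delta>
      by (intro add_mono mult_mono) (auto simp: \<tau>_def)
    also have "\<dots> = 3 * \<tau> * (s * s)" by simp
    also have "\<dots> = 3 / 32 * (\<delta> * real m)" unfolding s(2) by (simp add: \<tau>_def)
    finally have 1: "\<bar>?S R x y - ?S R x0 y0\<bar> \<le> 3 / 32 * (\<delta> * real m)" .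
    have "\<bar>?k x y - ?k x0 y0\<bar> \<le> norm_n n (diff_n x x0) * norm_n n y + norm_n n x0 * norm_n n (diff_n y y0)"
      by (rule relu_kernel_lipschitz) (use nz x y K0 in auto)
    also have "\<dots> \<le> \<epsilon> * 1 + 1 * \<epsilon>"
      using x0 y0 unit y K0 \<epsilon> by (intro add_mono mult_mono) auto
    finally have "real m * \<bar>?k x y - ?k x0 y0\<bar> \<le> real m * (2 * \<epsilon>)"
      by (intro mult_left_mono) auto
    then have 2: "\<bar>real m * ?k x y - real m * ?k x0 y0\<bar> \<le> 1 / 100 * (\<delta> * real m)"
      by (simp add: abs_mult right_diff_distrib [symmetric] \<epsilon>_def mult_ac)
    have "0 \<le> \<delta> * real m" using \<delta> by simp
    then show ?thesis using 1 2 net [OF x0(1) y0(1)] by linarith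
  qed
  show ?thesis
    by (rule that [OF _ prob good]) (use B1_sets B2_sets in auto)
qed

lemma gaussian_width_nonneg:
  assumes "K \<noteq> {}" "\<And>x. x \<in> K \<Longrightarrow> norm_n n x \<le> 1"
  shows "0 \<le> gaussian_width n K"
proof -
  obtain x where x: "x \<in> K" using assms(1) by blast
  have "0 \<le> (LINT g|gaussian_vector n. max_inner n (diffs {x}) g)"
    by (intro integral_nonneg_AE AE_I2 max_inner_diffs_nonneg) auto
  also have "\<dots> \<le> gaussian_width n K"
    using x by (intro gaussian_width_finite_subset assms(2)) auto
  finally show ?thesis .
qed

theorem theorem4:
  "\<exists>c0>0. \<exists>C>0. \<exists>c>0. \<forall>(n::nat) (m::nat) (\<beta>::real) (\<delta>::real) (K::(nat \<Rightarrow> real) set).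
     0 < \<beta> \<and> \<beta> < 1 \<and> 0 < \<delta> \<and> \<delta> \<le> c0 * \<beta>\<^sup>2 \<and> K \<subseteq> annulus n \<beta> \<and>
     1 \<le> m \<and> real m \<ge> C * gaussian_width n K ^ 4 / \<delta> ^ 4 \<longrightarrow>
     (\<exists>A \<in> sets (gaussian_matrix m n).
        measure (gaussian_matrix m n) A \<ge> 1 - 2 * exp (- c * \<delta> ^ 4 * real m) \<and>
        (\<forall>G \<in> A. \<forall>x \<in> K. \<forall>y \<in> K.
           (let M = (\<lambda>ij. G ij / sqrt (real m));
                u = relu_layer m n M x; v = relu_layer m n M y
            in norm_n m u \<noteq> 0 \<and> norm_n m v \<noteq> 0 \<and>
               \<bar>cos (angle_n m u v) - (cos (angle_n n x y) + psi n x y)\<bar>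
                 \<le> 15 * \<delta> / (\<beta>\<^sup>2 - 2 * \<delta>))))"
proof (rule exI [of _ "1 / 8"], intro conjI, simp, rule exI [of _ "10 ^ 12"], intro conjI, simp,
    rule exI [of _ "1 / 10 ^ 13"], intro conjI allI impI, simp, elim conjE)
  fix n m :: nat and \<beta> \<delta> :: real and K :: "(nat \<Rightarrow> real) set"
  assume \<beta>: "0 < \<beta>" "\<beta> < 1" and \<delta>: "0 < \<delta>" "\<delta> \<le> 1 / 8 * \<beta>\<^sup>2" and K: "K \<subseteq> annulus n \<beta>"
    and m: "1 \<le> m" "10 ^ 12 * gaussian_width n K ^ 4 / \<delta> ^ 4 \<le> real m"
  let ?good = "\<lambda>G x y. (let M = (\<lambda>ij. G ij / sqrt (real m)); u = relu_layer m n M x; v = relu_layer m n M y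
      in norm_n m u \<noteq> 0 \<and> norm_n m v \<noteq> 0 \<and>
         \<bar>cos (angle_n m u v) - (cos (angle_n n x y) + psi n x y)\<bar> \<le> 15 * \<delta> / (\<beta>\<^sup>2 - 2 * \<delta>))"
  let ?M = "gaussian_matrix m n"
  \<comment> \<open>The claimed probability is positive only for \<open>X\<close> above about
    \<open>5 * 10 ^ 12\<close>; together with \<open>10 ^ 12 * \<omega> ^ 4 \<le> X\<close> this
    gives the bound \<open>10 ^ 11 * (1 + \<omega>)\<^sup>2 \<le> X\<close> demanded by
    \<open>uniform_relu_products\<close>.\<close>
  define X where "X = \<delta> ^ 4 * real m"
  interpret prob_space ?M by (rule prob_space_gaussian_matrix)
  have "\<exists>A\<in>sets ?M. 1 - 2 * exp (- (X / 10 ^ 13)) \<le> measure ?M A \<and> (\<forall>G\<in>A. \<forall>x\<in>K. \<forall>y\<in>K. ?good G x y)"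
  proof (cases "K = {}")
    \<comment> \<open>The width of the empty set is a supremum over nothing and carries no
      information, but the claim is vacuous on the whole space.\<close>
    case True
    then show ?thesis by (intro bexI [of _ "space ?M"]) (auto simp: prob_space)
  next
    case Kne: False
    show ?thesis
    proof (cases "X / 10 ^ 13 \<le> 1 / 2")
      \<comment> \<open>The claimed lower bound on the probability is at most 0, so the empty event
        serves.\<close>
      case True
      have "1 / 2 \<le> exp (- (X / 10 ^ 13))"
        using True exp_ge_add_one_self [of "- (X / 10 ^ 13)"] by linarith
      then show ?thesis by (intro bexI [of _ "{}"]) auto
    next
      case False
      define \<omega> where "\<omega> = gaussian_width n K"
      have unit: "norm_n n x \<le> 1" and nz: "norm_n n x \<noteq> 0" if "x \<in> K" for x
        using K that \<beta> by (auto simp: annulus_def)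
      have \<omega>: "0 \<le> \<omega>" unfolding \<omega>_def using Kne unit by (rule gaussian_width_nonneg)
      have "\<beta>\<^sup>2 \<le> 1" using \<beta> by (simp add: power_le_one)
      then have \<delta>1: "\<delta> \<le> 1" using \<delta> by linarith
      have "10 ^ 12 * \<omega> ^ 4 \<le> X"
        using m(2) \<delta> by (simp add: \<omega>_def X_def field_simps)
      then have "1000000000000 * \<omega> ^ 4 \<le> X" by simp
      moreover have "5000000000000 \<le> X" using False by simp
      moreover have "(1 + \<omega>)\<^sup>2 \<le> 3 + \<omega> ^ 4"
      proof -
        have "0 \<le> (\<omega> - 1)\<^sup>2" "0 \<le> (\<omega>\<^sup>2 - 1)\<^sup>2" by simp_all
        moreover have "(\<omega>\<^sup>2 - 1)\<^sup>2 = \<omega> ^ 4 - 2 * \<omega>\<^sup>2 + 1"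
          by (simp add: power2_eq_square power4_eq_xxxx algebra_simps)
        ultimately show ?thesis by (simp add: power2_sum power2_diff)
      qed
      ultimately have "100000000000 * (1 + \<omega>)\<^sup>2 \<le> X" by linarith
      then have mw: "10 ^ 11 * (1 + \<omega>)\<^sup>2 \<le> \<delta> ^ 4 * real m" by (simp add: X_def)
      have W: "(LINT g|gaussian_vector n. max_inner n (diffs P) g) \<le> 1 + \<omega>"
        if "finite P" "P \<noteq> {}" "P \<subseteq> K" for P
        using gaussian_width_finite_subset [OF unit that] by (simp add: \<omega>_def)
      obtain A where A: "A \<in> sets (gaussian_rows m n)"
          "1 - 3 * exp (- (\<delta>\<^sup>2 * real m / 12288)) \<le> measure (gaussian_rows m n) A"
          "\<And>R x y. R \<in> A \<Longrightarrow> x \<in> K \<Longrightarrow> y \<in> K \<Longrightarrow>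
           \<bar>(\<Sum>i<m. relu (inner_n n (R i) x) * relu (inner_n n (R i) y)) - real m * relu_kernel n x y\<bar> \<le> \<delta> * real m"
        by (rule uniform_relu_products [OF _ Kne unit nz _ \<delta>(1) \<delta>1 mw W]) (use m \<omega> in auto)
      let ?A = "rows_of m n -` A \<inter> space ?M"
      have m0: "0 < m" using m(1) by simp
      have "?A \<in> sets ?M" by (rule measurable_sets [OF measurable_rows_of [OF m0] A(1)])
      moreover have "measure ?M ?A = measure (gaussian_rows m n) A"
        using measure_distr [OF measurable_rows_of [OF m0] A(1)] by (simp add: distr_rows_of [OF m0])
      \<comment> \<open>One unit of the exponent pays for lowering the prefactor from 3 to 2; it is
        available because \<open>X\<close> exceeds \<open>5 * 10 ^ 12\<close> in this case.\<close>
      moreover have "3 * exp (- (\<delta>\<^sup>2 * real m / 12288)) \<le> 2 * exp (- (X / 10 ^ 13))"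
      proof -
        have "X \<le> \<delta>\<^sup>2 * real m"
        proof -
          have "\<delta> ^ 4 = \<delta>\<^sup>2 * \<delta>\<^sup>2" by (simp add: power4_eq_xxxx power2_eq_square)
          also have "\<dots> \<le> \<delta>\<^sup>2 * 1" using \<delta>(1) \<delta>1 by (intro mult_left_mono) (auto simp: power_le_one)
          finally show ?thesis unfolding X_def by (intro mult_right_mono) auto
        qed
        then have "1 + X / 10 ^ 13 \<le> \<delta>\<^sup>2 * real m / 12288"
          using False by simp
        then have "exp 1 * exp (- (\<delta>\<^sup>2 * real m / 12288)) \<le> exp (- (X / 10 ^ 13))"
          by (simp add: mult_exp_exp)
        moreover have "2 * exp (- (\<delta>\<^sup>2 * real m / 12288)) \<le> exp 1 * exp (- (\<delta>\<^sup>2 * real m / 12288))"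
          using exp_ge_add_one_self [of "1::real"] by (intro mult_right_mono) auto
        ultimately show ?thesis by (smt (verit) exp_ge_zero)
      qed
      moreover have "?good G x y" if "G \<in> ?A" "x \<in> K" "y \<in> K" for G x y
        unfolding Let_def
        using that \<delta> by (intro cos_angle_n_relu_layer [OF m0 \<beta>(1) _ _ K] A(3)) auto
      ultimately show ?thesis using A(2) by (intro bexI [of _ ?A]) auto
    qed
  qed
  then show "\<exists>A\<in>sets ?M. 1 - 2 * exp (- (1 / 10 ^ 13) * \<delta> ^ 4 * real m) \<le> measure ?M A \<and>
      (\<forall>G\<in>A. \<forall>x\<in>K. \<forall>y\<in>K. ?good G x y)"
    by (simp add: X_def)
qed

end
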